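(* Let $n\ge 1$, $R=K[x_1,\dots,x_n]$, and $0\le k\le n$, where $(n,k,0,\dots,0)$ (with $n$ entries) is the $f$-vector of some simplicial complex on $n$ vertices. Then, for the Hilbert function $H$ corresponding to the $f$-vector $(n,k,0,\dots,0)$, there is a squarefree monomial ideal $I\subseteq R$ such that $R/I$ has Hilbert function $H$ and whose graded Betti numbers are smallest among all squarefree monomial ideals with this Hilbert function: $\beta^I_{i,j}\le\beta^J_{i,j}$ for all $i,j$ and every squarefree monomial ideal $J\subseteq R$ such that $R/J$ has Hilbert function $H$.
   Context: $K$ is a field. For a homogeneous ideal $I\subseteq R$, the Hilbert function of $R/I$ is $H(R/I,d)=\dim_K(R/I)_d$, and $\beta^I_{i,j}$ denotes the graded Betti numbers of $R/I$: the $i$-th module in the minimal graded free resolution of $R/I$ is $\bigoplus_j R(-j)^{\beta^I_{i,j}}$. A simplicial complex $\Delta$ on $n$ vertices is a collection of subsets (faces) of $\{1,\dots,n\}$ closed under taking subsets and containing every $\{v\}$; its associated (Stanley–Reisner) ideal in $R$ is generated by the squarefree monomials corresponding to the minimal non-faces. Its $f$-vector is $(f_0,\dots,f_{n-1})$, where $f_i$ is the number of faces of cardinality $i+1$. The Hilbert function corresponding to an $f$-vector $(f_0,\dots,f_{n-1})$ is $H(0)=1$ and $H(m)=\sum_{i=0}^{n-1}f_i\binom{m-1}{i}$ for $m>0$; it is the Hilbert function of $R/I$ for the ideal $I$ associated to any complex with that $f$-vector. *)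

theory Defs
  imports Complex_Main "HOL-Library.Poly_Mapping" "HOL-Library.Cardinality"
begin

text \<open>
  The polynomial ring \<open>R = K[x\<^sub>1,\<dots>,x\<^sub>n]\<close> is the ring of finitely supported functions from
  exponent vectors to \<open>K\<close>, where the variables (and the vertices of simplicial complexes) are the
  elements of a finite type \<open>'n\<close> with \<open>n = CARD('n)\<close>.
\<close>

type_synonym ('n, 'k) pring = "('n \<Rightarrow>\<^sub>0 nat) \<Rightarrow>\<^sub>0 'k"

definition mdeg :: "('n::finite \<Rightarrow>\<^sub>0 nat) \<Rightarrow> nat" where
  "mdeg m = (\<Sum>x\<in>UNIV. Poly_Mapping.lookup m x)"

definition homogeneous :: "nat \<Rightarrow> ('n::finite, 'k::field) pring \<Rightarrow> bool" where
  "homogeneous d p \<longleftrightarrow> (\<forall>m\<in>Poly_Mapping.keys p. mdeg m = d)"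

definition const :: "'k \<Rightarrow> ('n::finite, 'k::field) pring" where
  "const c = Poly_Mapping.single 0 c"

definition squarefree_exponent :: "('n::finite \<Rightarrow>\<^sub>0 nat) \<Rightarrow> bool" where
  "squarefree_exponent m \<longleftrightarrow> (\<forall>x. Poly_Mapping.lookup m x \<le> 1)"

text \<open>Ideals are submodules of \<open>R\<close> over itself, so \<open>module.span (*)\<close> is the generated ideal.\<close>

definition squarefree_monomial_ideal :: "('n::finite, 'k::field) pring set \<Rightarrow> bool" where
  "squarefree_monomial_ideal I \<longleftrightarrow>
     (\<exists>M. (\<forall>m\<in>M. squarefree_exponent m) \<and>
          I = module.span (*) ((\<lambda>m. Poly_Mapping.single m 1) ` M))"

text \<open>
  \<open>B\<close> is a set of homogeneous polynomials of degree \<open>d\<close> whose residue classes form a \<open>K\<close>-basis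
  of \<open>(R/I)\<^sub>d = R\<^sub>d / (I \<inter> R\<^sub>d)\<close> (by uniqueness, the classes of distinct elements of \<open>B\<close> are distinct).
\<close>

definition residue_basis :: "('n::finite, 'k::field) pring set \<Rightarrow> nat \<Rightarrow> ('n, 'k) pring set \<Rightarrow> bool" where
  "residue_basis I d B \<longleftrightarrow>
     finite B \<and> (\<forall>b\<in>B. homogeneous d b) \<and>
     (\<forall>p. homogeneous d p \<longrightarrow>
        (\<exists>!c. (\<forall>b. b \<notin> B \<longrightarrow> c b = 0) \<and> p - (\<Sum>b\<in>B. const (c b) * b) \<in> I))"

definition hilbert_function :: "('n::finite, 'k::field) pring set \<Rightarrow> nat \<Rightarrow> nat" where
  "hilbert_function I d = card (SOME B. residue_basis I d B)"

text \<open>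
  For \<open>b :: nat \<Rightarrow> nat\<close>, the graded free module \<open>\<Oplus>\<^sub>j R(-j)\<^bsup>b j\<^esup>\<close> has as basis the pairs \<open>(j, l)\<close> with
  \<open>l < b j\<close>, where \<open>(j, l)\<close> is in degree \<open>j\<close>.  Its elements are finitely supported
  coordinate vectors.  Shifts are natural numbers, since \<open>R/I\<close> lives in nonnegative degrees and so
  its minimal graded free resolution involves no negative \<open>j\<close>.
\<close>

type_synonym ('n, 'k) fvec = "(nat \<times> nat) \<Rightarrow>\<^sub>0 ('n, 'k) pring"

definition free_module :: "(nat \<Rightarrow> nat) \<Rightarrow> ('n::finite, 'k::field) fvec set" where
  "free_module b = {v. \<forall>(j, l)\<in>Poly_Mapping.keys v. l < b j}"

definition vscale :: "('n::finite, 'k::field) pring \<Rightarrow> ('n, 'k) fvec \<Rightarrow> ('n, 'k) fvec" where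
  "vscale r v = Poly_Mapping.map ((*) r) v"

text \<open>\<open>R(-j)\<^sub>d = R\<^sub>d\<^sub>-\<^sub>j\<close>, so the coordinate at a basis element of degree \<open>j\<close> has degree \<open>d - j\<close>.\<close>

definition vhomogeneous :: "nat \<Rightarrow> ('n::finite, 'k::field) fvec \<Rightarrow> bool" where
  "vhomogeneous d v \<longleftrightarrow>
     (\<forall>(j, l)\<in>Poly_Mapping.keys v. \<forall>m\<in>Poly_Mapping.keys (Poly_Mapping.lookup v (j, l)). mdeg m + j = d)"

text \<open>\<open>R\<close>-linear maps of degree 0 on a submodule \<open>M\<close> of a free module; \<open>scale\<close> and \<open>hom\<close> are the
  scalar multiplication and the grading of the target.\<close>

definition graded_linear_on ::
  "('n::finite, 'k::field) fvec set \<Rightarrow> (('n, 'k) pring \<Rightarrow> 'm::ab_group_add \<Rightarrow> 'm) \<Rightarrow>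
   (nat \<Rightarrow> 'm \<Rightarrow> bool) \<Rightarrow> (('n, 'k) fvec \<Rightarrow> 'm) \<Rightarrow> bool" where
  "graded_linear_on M scale hom \<phi> \<longleftrightarrow>
     (\<forall>u\<in>M. \<forall>v\<in>M. \<phi> (u + v) = \<phi> u + \<phi> v) \<and>
     (\<forall>r. \<forall>v\<in>M. \<phi> (vscale r v) = scale r (\<phi> v)) \<and>
     (\<forall>d. \<forall>v\<in>M. vhomogeneous d v \<longrightarrow> hom d (\<phi> v))"

text \<open>
  Graded free resolutions \<open>\<dots> \<rightarrow> F\<^sub>2 \<rightarrow> F\<^sub>1 \<rightarrow> F\<^sub>0 \<rightarrow> R/I \<rightarrow> 0\<close> with \<open>F\<^sub>i = \<Oplus>\<^sub>j R(-j)\<^bsup>b i j\<^esup>\<close> and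
  \<open>\<phi> i : F\<^bsub>i+1\<^esub> \<rightarrow> F\<^sub>i\<close>.  The augmentation \<open>F\<^sub>0 \<rightarrow> R/I\<close> is given by a lift \<open>\<epsilon> : F\<^sub>0 \<rightarrow> R\<close>, which exists
  since \<open>F\<^sub>0\<close> is free; thus its kernel is \<open>{v \<in> F\<^sub>0. \<epsilon> v \<in> I}\<close>.  Each \<open>b i j\<close> is finite; that for fixed \<open>i\<close>
  only finitely many of them are nonzero in a minimal resolution follows from Noetherianity.
\<close>

definition graded_free_resolution ::
  "('n::finite, 'k::field) pring set \<Rightarrow> (nat \<Rightarrow> nat \<Rightarrow> nat) \<Rightarrow>
   (('n, 'k) fvec \<Rightarrow> ('n, 'k) pring) \<Rightarrow> (nat \<Rightarrow> ('n, 'k) fvec \<Rightarrow> ('n, 'k) fvec) \<Rightarrow> bool" where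
  "graded_free_resolution I b \<epsilon> \<phi> \<longleftrightarrow>
     graded_linear_on (free_module (b 0)) (*) homogeneous \<epsilon> \<and>
     (\<forall>i. graded_linear_on (free_module (b (Suc i))) vscale vhomogeneous (\<phi> i)) \<and>
     (\<forall>p. \<exists>v\<in>free_module (b 0). p - \<epsilon> v \<in> I) \<and>
     \<phi> 0 ` free_module (b 1) = {v \<in> free_module (b 0). \<epsilon> v \<in> I} \<and>
     (\<forall>i. \<phi> (Suc i) ` free_module (b (Suc (Suc i))) = {v \<in> free_module (b (Suc i)). \<phi> i v = 0})"

text \<open>Minimality: the image of every \<open>\<phi> i\<close> lies in \<open>(x\<^sub>1,\<dots>,x\<^sub>n) F\<^sub>i\<close>, that is, all coordinates of its
  elements have zero constant term.\<close>

definition minimal_graded_free_resolution ::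
  "('n::finite, 'k::field) pring set \<Rightarrow> (nat \<Rightarrow> nat \<Rightarrow> nat) \<Rightarrow>
   (('n, 'k) fvec \<Rightarrow> ('n, 'k) pring) \<Rightarrow> (nat \<Rightarrow> ('n, 'k) fvec \<Rightarrow> ('n, 'k) fvec) \<Rightarrow> bool" where
  "minimal_graded_free_resolution I b \<epsilon> \<phi> \<longleftrightarrow>
     graded_free_resolution I b \<epsilon> \<phi> \<and>
     (\<forall>i. \<forall>v\<in>free_module (b (Suc i)). \<forall>e.
        Poly_Mapping.lookup (Poly_Mapping.lookup (\<phi> i v) e) 0 = 0)"

text \<open>The minimal graded free resolution of \<open>R/I\<close> exists for homogeneous \<open>I\<close> and is unique up to
  isomorphism, so the choice is immaterial.\<close>

definition betti :: "('n::finite, 'k::field) pring set \<Rightarrow> nat \<Rightarrow> nat \<Rightarrow> nat" where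
  "betti I = (SOME b. \<exists>\<epsilon> \<phi>. minimal_graded_free_resolution I b \<epsilon> \<phi>)"

definition simplicial_complex :: "'n::finite set set \<Rightarrow> bool" where
  "simplicial_complex \<Delta> \<longleftrightarrow> (\<forall>F\<in>\<Delta>. \<forall>G. G \<subseteq> F \<longrightarrow> G \<in> \<Delta>) \<and> (\<forall>v. {v} \<in> \<Delta>)"

definition f_vector :: "'n::finite set set \<Rightarrow> nat list" where
  "f_vector \<Delta> = map (\<lambda>i. card {F\<in>\<Delta>. card F = i + 1}) [0..<CARD('n)]"

definition hilbert_of_f_vector :: "nat list \<Rightarrow> nat \<Rightarrow> nat" where
  "hilbert_of_f_vector f m =
     (if m = 0 then 1 else (\<Sum>i<length f. f ! i * ((m - 1) choose i)))"

end

theory Submission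
  imports Defs "HOL-Library.FuncSet"
begin

text \<open>
  An ideal with this Hilbert function is the Stanley--Reisner ideal of a graph with \<open>n\<close> vertices and
  \<open>k\<close> edges, and only \<open>\<beta>\<^bsub>j-1,j\<^esub>\<close> and \<open>\<beta>\<^bsub>j-2,j\<^esub>\<close> can be nonzero for \<open>j > 0\<close>: in a squarefree
  degree the Koszul complex of the variables on \<open>R/I\<close> is the cochain complex of an induced subgraph,
  which has dimension at most 1, and in the other degrees it is contractible.  Comparing ranks in the
  resolution degree by degree, the difference \<open>\<beta>\<^bsub>j-1,j\<^esub> - \<beta>\<^bsub>j-2,j\<^esub>\<close> depends only on the Hilbert function.
  Hence a graph is optimal as soon as, for every \<open>j\<close>, one of these two numbers vanishes.  For \<open>k < n\<close> a
  star does this, its induced subgraphs having no first cohomology; for \<open>k = n\<close> the \<open>n\<close>-cycle does, since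
  its proper induced subgraphs have no first cohomology and it is itself connected.
\<close>

text \<open>\<open>betti\<close> is a choice among the ranks of minimal resolutions, so each fact
  about it is proved for an arbitrary minimal resolution, and one has to be constructed to give the
  choice a meaning. The link between Betti numbers and Koszul homology is the balancing of Tor; only
  vanishing is transported, by moving acyclicity of the Koszul complex along the resolution one
  syzygy at a time. Vanishing suffices because equal differences of nonnegative numbers, with one of
  the two terms zero on the optimal side, force both inequalities. In a squarefree degree with
  support U, position i of the Koszul complex is spanned by the faces inside U with card U - i
  elements, so edges sit at i = j - 2 and vertices at i = j - 1. A triangle in a competing complex
  would break this range, so the Hilbert function must first exclude it. Two small cases hide in the
  f-vector: for n = 1 the list has no entry for k, and for n = 2 the existence of a complex rules
  out k = 2, where no cycle is available.\<close>

abbreviation lookup :: "('a \<Rightarrow>\<^sub>0 'b::zero) \<Rightarrow> 'a \<Rightarrow> 'b" where "lookup \<equiv> Poly_Mapping.lookup"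
abbreviation keys :: "('a \<Rightarrow>\<^sub>0 'b::zero) \<Rightarrow> 'a set" where "keys \<equiv> Poly_Mapping.keys"
abbreviation single :: "'a \<Rightarrow> 'b \<Rightarrow> 'a \<Rightarrow>\<^sub>0 'b::zero" where "single \<equiv> Poly_Mapping.single"

section \<open>Exponent vectors and monomials\<close>

definition ind :: "'n::finite set \<Rightarrow> 'n \<Rightarrow>\<^sub>0 nat" where
  "ind A = Abs_poly_mapping (\<lambda>x. if x \<in> A then 1 else 0)"

lemma lookup_ind: "lookup (ind A) x = (if x \<in> A then 1 else 0)"
  by (simp add: ind_def)

lemma keys_ind [simp]: "keys (ind A) = A"
  by (auto simp: in_keys_iff lookup_ind split: if_splits)

lemma mdeg_zero [simp]: "mdeg 0 = 0"
  by (simp add: mdeg_def)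

lemma mdeg_add: "mdeg (m + m') = mdeg m + mdeg m'"
  by (simp add: mdeg_def lookup_add sum.distrib)

lemma mdeg_ind [simp]: "mdeg (ind A) = card A"
  by (simp add: mdeg_def lookup_ind sum.If_cases)

lemma mdeg_eq_0_iff: "mdeg m = 0 \<longleftrightarrow> m = 0"
  by (auto simp: mdeg_def intro: poly_mapping_eqI)

lemma keys_eq_empty_iff: "keys m = {} \<longleftrightarrow> m = 0"
  by simp

lemma card_keys_le_mdeg: "card (keys m) \<le> mdeg m"
proof -
  have "card (keys m) = (\<Sum>x\<in>UNIV. if x \<in> keys m then 1 else 0)"
    by (simp add: sum.If_cases)
  also have "\<dots> \<le> mdeg m"
    unfolding mdeg_def by (intro sum_mono) (auto simp: in_keys_iff)
  finally show ?thesis .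
qed

lemma ind_keys_add: "ind (keys m) + (m - ind (keys m)) = m"
  by (rule poly_mapping_eqI) (auto simp: lookup_add lookup_minus lookup_ind in_keys_iff)

lemma diff_ind_add: "A \<subseteq> keys u \<Longrightarrow> (u - ind A) + ind A = u"
  by (rule poly_mapping_eqI) (auto simp: lookup_add lookup_minus lookup_ind in_keys_iff)

lemma mdeg_diff_ind: "A \<subseteq> keys u \<Longrightarrow> mdeg (u - ind A) + card A = mdeg u"
  by (metis diff_ind_add mdeg_add mdeg_ind)

lemma finite_mdeg: "finite {m :: 'n::finite \<Rightarrow>\<^sub>0 nat. mdeg m = d}"
proof -
  have "lookup ` {m :: 'n \<Rightarrow>\<^sub>0 nat. mdeg m = d} \<subseteq> {f. \<forall>x. (x \<in> UNIV \<longrightarrow> f x \<in> {..d}) \<and> (x \<notin> UNIV \<longrightarrow> f x = 0)}"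
    by (auto simp: mdeg_def intro: member_le_sum)
  then have "finite (lookup ` {m :: 'n \<Rightarrow>\<^sub>0 nat. mdeg m = d})"
    by (rule finite_subset) (rule finite_set_of_finite_funs, auto)
  then show ?thesis
    by (rule finite_imageD) (auto simp: inj_on_def lookup_inject)
qed

lemma squarefree_eq_ind:
  assumes "\<And>v. lookup u v < 2"
  shows "u = ind (keys u)"
proof (rule poly_mapping_eqI)
  fix v show "lookup u v = lookup (ind (keys u)) v"
    using assms[of v] by (auto simp: lookup_ind in_keys_iff)
qed

section \<open>Multiplication by a monomial, coefficient by coefficient\<close>

lemma sum_single_keys: "(\<Sum>m\<in>keys p. single m (lookup p m)) = p"
  by (rule poly_mapping_eqI) (auto simp: lookup_sum lookup_single when_def in_keys_iff)

lemma single_mult_expand: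
  fixes p :: "('n \<Rightarrow>\<^sub>0 nat) \<Rightarrow>\<^sub>0 'k::field"
  shows "single t c * p = (\<Sum>m\<in>keys p. single (t + m) (c * lookup p m))"
proof -
  have "single t c * p = single t c * (\<Sum>m\<in>keys p. single m (lookup p m))"
    by (simp add: sum_single_keys)
  also have "\<dots> = (\<Sum>m\<in>keys p. single (t + m) (c * lookup p m))"
    by (simp add: sum_distrib_left mult_single)
  finally show ?thesis .
qed

lemma lookup_single_mult:
  fixes p :: "('n \<Rightarrow>\<^sub>0 nat) \<Rightarrow>\<^sub>0 'k::field"
  shows "lookup (single t c * p) (t + m) = c * lookup p m"
proof -
  have "lookup (single t c * p) (t + m) = (\<Sum>m'\<in>keys p. if m' = m then c * lookup p m' else 0)"
    by (simp add: single_mult_expand lookup_sum lookup_single when_def)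
  also have "\<dots> = c * lookup p m"
    by (simp add: in_keys_iff)
  finally show ?thesis .
qed

lemma lookup_single_mult_eq_0:
  fixes p :: "('n \<Rightarrow>\<^sub>0 nat) \<Rightarrow>\<^sub>0 'k::field"
  assumes "\<And>m'. m \<noteq> t + m'"
  shows "lookup (single t c * p) m = 0"
  using assms[symmetric] by (simp add: single_mult_expand lookup_sum lookup_single when_def)

lemma lookup_const_mult: "lookup (const c * p) m = c * lookup p m"
  using lookup_single_mult[of 0 c p m] by (simp add: const_def)

definition X :: "'n::finite \<Rightarrow> ('n, 'k::field) pring" where
  "X v = single (ind {v}) 1"

lemma lookup_X_mult:
  "lookup (X v * p) m = (if v \<in> keys m then lookup p (m - ind {v}) else 0)"
proof (cases "v \<in> keys m")
  case True
  then have "ind {v} + (m - ind {v}) = m"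
    using diff_ind_add[of "{v}" m] by (simp add: add.commute)
  then show ?thesis
    using True lookup_single_mult[of "ind {v}" 1 p "m - ind {v}"] by (simp add: X_def)
next
  case False
  then have "lookup (X v * p) m = 0"
    unfolding X_def by (intro lookup_single_mult_eq_0) (auto simp: in_keys_iff lookup_add lookup_ind)
  with False show ?thesis by simp
qed

section \<open>Squarefree monomial ideals\<close>

text \<open>Weaker than \<open>simplicial_complex\<close>: a squarefree monomial ideal may contain
  variables or 1, so vertices and even the empty face may be missing.\<close>

definition down_closed :: "'n set set \<Rightarrow> bool" where
  "down_closed \<Delta> \<longleftrightarrow> (\<forall>F\<in>\<Delta>. \<forall>G. G \<subseteq> F \<longrightarrow> G \<in> \<Delta>)"

lemma down_closedD: "down_closed \<Delta> \<Longrightarrow> F \<in> \<Delta> \<Longrightarrow> G \<subseteq> F \<Longrightarrow> G \<in> \<Delta>"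
  by (auto simp: down_closed_def)

text \<open>\<open>keys m\<close> is the support of the monomial \<open>m\<close>.\<close>

definition SR :: "'n::finite set set \<Rightarrow> ('n, 'k::field) pring set" where
  "SR \<Delta> = {p. \<forall>m\<in>keys p. keys m \<notin> \<Delta>}"

lemma mem_SR_iff: "p \<in> SR \<Delta> \<longleftrightarrow> (\<forall>m. keys m \<in> \<Delta> \<longrightarrow> lookup p m = 0)"
  by (auto simp: SR_def in_keys_iff)

text \<open>Taking all sets as faces turns statements about \<open>R / SR \<Delta>\<close> into
  statements about R itself, which is how the Koszul complex of R is treated.\<close>

lemma SR_UNIV [simp]: "SR UNIV = {0}"
  by (auto simp: mem_SR_iff intro: poly_mapping_eqI)

lemma SR_zero: "0 \<in> SR \<Delta>"
  by (simp add: mem_SR_iff)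

lemma SR_add: "p \<in> SR \<Delta> \<Longrightarrow> q \<in> SR \<Delta> \<Longrightarrow> p + q \<in> SR \<Delta>"
  by (simp add: mem_SR_iff lookup_add)

lemma SR_sum: "(\<And>x. x \<in> A \<Longrightarrow> f x \<in> SR \<Delta>) \<Longrightarrow> sum f A \<in> SR \<Delta>"
  by (simp add: mem_SR_iff lookup_sum)

lemma keys_add_nat: "keys (m + m') = keys m \<union> keys (m' :: 'n \<Rightarrow>\<^sub>0 nat)"
  by (auto simp: in_keys_iff lookup_add)

lemma SR_mult:
  assumes "down_closed \<Delta>" "p \<in> SR \<Delta>"
  shows "q * p \<in> SR \<Delta>"
  unfolding SR_def
proof safe
  fix m assume m: "m \<in> keys (q * p)" "keys m \<in> \<Delta>"
  then obtain a b where "m = a + b" "b \<in> keys p"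
    using keys_mult[of q p] by auto
  with m assms show False
    by (auto simp: SR_def keys_add_nat dest: down_closedD)
qed

lemma module_pring: "module ((*) :: ('n::finite, 'k::field) pring \<Rightarrow> _)"
  by standard (auto simp: algebra_simps)

lemma subspace_SR:
  assumes "down_closed \<Delta>"
  shows "module.subspace (*) (SR \<Delta> :: ('n::finite, 'k::field) pring set)"
  unfolding module.subspace_def[OF module_pring]
  using SR_zero SR_add SR_mult[OF assms] by blast

text \<open>Membership of a monomial depends only on its support, and the monomial is a multiple of
  the squarefree monomial on that support, which is a generator when the support is a
  non-face.\<close>

lemma squarefree_monomial_ideal_SR:
  assumes "down_closed \<Delta>"
  shows "squarefree_monomial_ideal (SR \<Delta> :: ('n::finite, 'k::field) pring set)"
proof -
  interpret module "(*) :: ('n, 'k) pring \<Rightarrow> _" by (rule module_pring)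
  let ?M = "{ind F | F. F \<notin> \<Delta>}"
  let ?G = "(\<lambda>m. single m 1) ` ?M :: ('n, 'k) pring set"
  have "SR \<Delta> \<subseteq> span ?G"
  proof
    fix p :: "('n, 'k) pring" assume p: "p \<in> SR \<Delta>"
    have "single m (lookup p m) \<in> span ?G" if "m \<in> keys p" for m
    proof -
      have "single m (lookup p m) = single (m - ind (keys m)) (lookup p m) * single (ind (keys m)) 1"
        by (simp add: mult_single add.commute ind_keys_add)
      moreover have "single (ind (keys m)) 1 \<in> ?G"
        using p that by (auto simp: SR_def)
      ultimately show ?thesis by (simp only: span_scale[OF span_base])
    qed
    then have "(\<Sum>m\<in>keys p. single m (lookup p m)) \<in> span ?G"
      by (rule span_sum)
    then show "p \<in> span ?G" by (simp add: sum_single_keys)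
  qed
  moreover have "?G \<subseteq> SR \<Delta>"
    by (auto simp: SR_def)
  then have "span ?G \<subseteq> SR \<Delta>"
    using subspace_SR[OF assms] by (rule span_minimal)
  ultimately have "SR \<Delta> = span ?G" by blast
  moreover have "\<forall>m\<in>?M. squarefree_exponent m"
    by (auto simp: squarefree_exponent_def lookup_ind)
  ultimately show ?thesis
    unfolding squarefree_monomial_ideal_def by blast
qed

lemma squarefree_monomial_ideal_imp_SR:
  assumes "squarefree_monomial_ideal (J :: ('n::finite, 'k::field) pring set)"
  obtains \<Delta> where "down_closed \<Delta>" "J = SR \<Delta>"
proof -
  interpret module "(*) :: ('n, 'k) pring \<Rightarrow> _" by (rule module_pring)
  obtain M where M: "\<forall>m\<in>M. squarefree_exponent m"
    and J: "J = span ((\<lambda>m. single m 1) ` M)"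
    using assms unfolding squarefree_monomial_ideal_def by blast
  let ?G = "(\<lambda>m. single m 1) ` M :: ('n, 'k) pring set"
  \<comment> \<open>Faces are the supports of monomials that no generator divides: a squarefree g
    divides m exactly when its support is contained in that of m.\<close>
  define \<Delta> where "\<Delta> = {F. \<not> (\<exists>g\<in>M. keys g \<subseteq> F)}"
  have dc: "down_closed \<Delta>" by (auto simp: down_closed_def \<Delta>_def)
  have "SR \<Delta> \<subseteq> span ?G"
  proof
    fix p :: "('n, 'k) pring" assume p: "p \<in> SR \<Delta>"
    have "single m (lookup p m) \<in> span ?G" if "m \<in> keys p" for m
    proof -
      from p that obtain g where g: "g \<in> M" "keys g \<subseteq> keys m"
        by (auto simp: SR_def \<Delta>_def)
      have le: "lookup g v \<le> lookup m v" for v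
      proof (cases "lookup g v = 0")
        case False
        then have "lookup m v \<noteq> 0"
          using g(2) by (metis in_keys_iff subsetD)
        moreover have "lookup g v \<le> 1"
          using M g(1) by (auto simp: squarefree_exponent_def)
        ultimately show ?thesis by linarith
      qed simp
      have "(m - g) + g = m"
        by (intro poly_mapping_eqI) (simp add: lookup_add lookup_minus le)
      then have "single m (lookup p m) = single (m - g) (lookup p m) * single g 1"
        by (simp add: mult_single)
      moreover have "single g 1 \<in> ?G" using g by blast
      ultimately show ?thesis by (simp only: span_scale[OF span_base])
    qed
    then have "(\<Sum>m\<in>keys p. single m (lookup p m)) \<in> span ?G"
      by (rule span_sum)
    then show "p \<in> span ?G" by (simp add: sum_single_keys)
  qed
  moreover have "?G \<subseteq> SR \<Delta>"
    by (auto simp: SR_def \<Delta>_def)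
  then have "span ?G \<subseteq> SR \<Delta>"
    using subspace_SR[OF dc] by (rule span_minimal)
  ultimately have "J = SR \<Delta>" using J by blast
  with dc that show ?thesis by blast
qed

section \<open>Fine-graded strands of the Koszul complex\<close>

definition idx :: "'n::finite \<Rightarrow> nat" where
  "idx = (SOME f. inj f)"

lemma inj_idx: "inj (idx :: 'n::finite \<Rightarrow> nat)"
proof -
  obtain f :: "'n \<Rightarrow> nat" where "inj f"
    using finite_imp_inj_to_nat_seg[OF finite_class.finite_UNIV] by blast
  then show ?thesis unfolding idx_def by (rule someI[of inj])
qed

text \<open>The sign that sorts v into A in the exterior algebra: for v outside A, e_v times e_A is
  \<open>sg v A\<close> times the basis element of \<open>insert v A\<close>.\<close>

definition sg :: "'n::finite \<Rightarrow> 'n set \<Rightarrow> 'k::field" where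
  "sg v A = (- 1) ^ card {y \<in> A. idx y < idx v}"

lemma sg_sq [simp]: "sg v A * sg v A = (1 :: 'k::field)"
  by (simp add: sg_def flip: power_add mult_2)

lemma sg_sq_left [simp]: "sg v A * (sg v A * x) = (x :: 'k::field)"
  by (simp flip: mult.assoc)

lemma sg_insert:
  assumes "v \<notin> B"
  shows "sg x (insert v B) = (if idx v < idx x then - sg x B else (sg x B :: 'k::field))"
proof (cases "idx v < idx x")
  case True
  then have "{y \<in> insert v B. idx y < idx x} = insert v {y \<in> B. idx y < idx x}" by auto
  with True assms show ?thesis by (simp add: sg_def)
next
  case False
  then have "{y \<in> insert v B. idx y < idx x} = {y \<in> B. idx y < idx x}" by auto
  with False show ?thesis by (simp add: sg_def)
qed

text \<open>Exactly one of x and v precedes the other in the order, so exactly one of the two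
  insertions changes its sign: anticommutativity of the exterior product.\<close>

lemma sg_swap:
  assumes "x \<noteq> v" "x \<notin> B" "v \<notin> B"
  shows "sg x (insert v B) * sg v (insert x B) = - (sg v B * sg x B :: 'k::field)"
proof -
  have "idx x \<noteq> idx v" using assms(1) inj_idx by (auto dest: injD)
  then show ?thesis using assms by (auto simp: sg_insert)
qed

lemma sg_swap':
  assumes "x \<noteq> v" "x \<notin> B" "v \<notin> B"
  shows "sg x B * sg v (insert x B) = - (sg v B * sg x (insert v B) :: 'k::field)"
proof -
  have "idx x \<noteq> idx v" using assms(1) inj_idx by (auto dest: injD)
  then show ?thesis using assms by (auto simp: sg_insert)
qed

text \<open>
  Exactness at homological position \<open>i\<close> and multidegree \<open>u\<close> of the Koszul complex of the
  variables on \<open>R/SR \<Delta>\<close>: the strand has a basis indexed by the \<open>A \<subseteq> keys u\<close> such that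
  the monomial with exponent \<open>u - ind A\<close> does not lie in the ideal.
\<close>

definition exact_at :: "'k::field itself \<Rightarrow> 'n::finite set set \<Rightarrow> ('n \<Rightarrow>\<^sub>0 nat) \<Rightarrow> nat \<Rightarrow> bool" where
  "exact_at _ \<Delta> u i \<longleftrightarrow>
     (\<forall>a :: 'n set \<Rightarrow> 'k.
        (\<forall>B. card B + 1 = i \<and> B \<subseteq> keys u \<and> keys (u - ind B) \<in> \<Delta> \<longrightarrow>
             (\<Sum>v\<in>keys u - B. sg v B * a (insert v B)) = 0) \<longrightarrow>
        (\<exists>b. \<forall>A. card A = i \<and> A \<subseteq> keys u \<and> keys (u - ind A) \<in> \<Delta> \<longrightarrow>
             a A = (\<Sum>v\<in>keys u - A. sg v A * b (insert v A))))"

text \<open>The contracting homotopy is exterior multiplication by the Koszul generator of \<open>v\<close>.\<close>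

lemma exact_at_contract:
  assumes v: "v \<in> keys u"
    and \<Delta>: "\<And>A. card A = i \<Longrightarrow> v \<in> A \<Longrightarrow> A \<subseteq> keys u \<Longrightarrow> keys (u - ind A) \<in> \<Delta> \<Longrightarrow>
                 keys (u - ind (A - {v})) \<in> \<Delta>"
  shows "exact_at TYPE('k::field) \<Delta> u i"
  unfolding exact_at_def
proof (intro allI impI)
  fix a :: "'a set \<Rightarrow> 'k"
  assume cyc: "\<forall>B. card B + 1 = i \<and> B \<subseteq> keys u \<and> keys (u - ind B) \<in> \<Delta> \<longrightarrow>
             (\<Sum>v\<in>keys u - B. sg v B * a (insert v B)) = 0"
  define b where "b D = (if v \<in> D then sg v (D - {v}) * a (D - {v}) else 0)" for D
  have "a A = (\<Sum>x\<in>keys u - A. sg x A * b (insert x A))"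
    if A: "card A = i" "A \<subseteq> keys u" "keys (u - ind A) \<in> \<Delta>" for A
  proof (cases "v \<in> A")
    case False
    then have "(\<Sum>x\<in>keys u - A. sg x A * b (insert x A)) =
        (\<Sum>x\<in>keys u - A. if x = v then sg x A * b (insert x A) else 0)"
      by (intro sum.cong) (auto simp: b_def)
    also have "\<dots> = sg v A * b (insert v A)"
      using v False by simp
    also have "\<dots> = a A"
      using False by (simp add: b_def)
    finally show ?thesis by simp
  next
    case True
    \<comment> \<open>The hypothesis on faces makes \<open>A - {v}\<close> an index of the strand,
      so the cycle condition there is available and can be solved for \<open>a A\<close>.\<close>
    define B where "B = A - {v}"
    have AB: "A = insert v B" "v \<notin> B" using True by (auto simp: B_def)
    have "card A = card B + 1" using AB by simp
    then have "(\<Sum>x\<in>keys u - B. sg x B * a (insert x B)) = 0"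
      using cyc[rule_format, of B] \<Delta>[OF A(1) True A(2,3)] A unfolding B_def[symmetric]
      using AB by auto
    moreover have "keys u - B = insert v (keys u - A)" using v AB by auto
    ultimately have 1: "sg v B * a A = - (\<Sum>x\<in>keys u - A. sg x B * a (insert x B))"
      using AB by (simp add: eq_neg_iff_add_eq_0)
    have "a A = sg v B * (sg v B * a A)" by simp
    also have "\<dots> = (\<Sum>x\<in>keys u - A. - (sg v B * sg x B) * a (insert x B))"
      by (subst 1) (simp add: sum_distrib_left sum_negf mult.assoc)
    also have "\<dots> = (\<Sum>x\<in>keys u - A. sg x A * b (insert x A))"
    proof (rule sum.cong)
      fix x assume x: "x \<in> keys u - A"
      then have "x \<noteq> v" "x \<notin> B" using AB by auto
      then have "- (sg v B * sg x B) = (sg x A * sg v (insert x B) :: 'k)"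
        using AB by (simp add: sg_swap)
      moreover have "insert x A - {v} = insert x B"
        using x AB by auto
      ultimately show "- (sg v B * sg x B) * a (insert x B) = sg x A * b (insert x A)"
        using True by (simp add: b_def mult.assoc)
    qed simp
    finally show ?thesis .
  qed
  then show "\<exists>b. \<forall>A. card A = i \<and> A \<subseteq> keys u \<and> keys (u - ind A) \<in> \<Delta> \<longrightarrow>
             a A = (\<Sum>v\<in>keys u - A. sg v A * b (insert v A))"
    by blast
qed

lemma exact_at_no_faces:
  assumes "\<And>A. card A = i \<Longrightarrow> A \<subseteq> keys u \<Longrightarrow> keys (u - ind A) \<notin> \<Delta>"
  shows "exact_at TYPE('k::field) \<Delta> u i"
  using assms unfolding exact_at_def by blast

text \<open>The Koszul complex of R resolves K, and the excluded case is K itself. With all sets as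
  faces, any variable in the support contracts the strand.\<close>

lemma exact_at_UNIV:
  assumes "i = 0 \<longrightarrow> u \<noteq> 0"
  shows "exact_at TYPE('k::field) UNIV u i"
proof (cases "u = 0")
  case True
  with assms show ?thesis by (intro exact_at_no_faces) auto
next
  case False
  then obtain v where "v \<in> keys u" by (metis keys_eq_empty_iff ex_in_conv)
  then show ?thesis by (rule exact_at_contract) auto
qed

text \<open>Dividing once by a variable that occurs at least twice leaves the support unchanged, so
  contraction along it never leaves the strand.\<close>

lemma exact_at_not_squarefree:
  assumes "lookup u v \<ge> 2"
  shows "exact_at TYPE('k::field) \<Delta> u i"
proof (rule exact_at_contract)
  show "v \<in> keys u" using assms by (simp add: in_keys_iff)
  fix A assume "v \<in> A" "keys (u - ind A) \<in> \<Delta>"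
  moreover from this assms have "keys (u - ind (A - {v})) = keys (u - ind A)"
    by (auto simp: in_keys_iff lookup_minus lookup_ind split: if_splits)
  ultimately show "keys (u - ind (A - {v})) \<in> \<Delta>" by simp
qed

text \<open>The passage to cochains: in the squarefree degree U the index A stands for the face
  \<open>U - A\<close>, and enlarging A shrinks the face. The cycle condition of
  \<open>exact_at\<close> is thus the cocycle condition on faces inside U, and its conclusion asks
  for a coboundary.\<close>

lemma keys_ind_diff: "keys (ind U - ind A) = U - A"
  by (auto simp: in_keys_iff lookup_minus lookup_ind split: if_splits)

lemma exact_atI_squarefree:
  fixes \<Delta> :: "'n::finite set set"
  assumes "\<And>U. card U = mdeg u \<Longrightarrow> u = ind U \<Longrightarrow> exact_at TYPE('k::field) \<Delta> (ind U) i"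
  shows "exact_at TYPE('k) \<Delta> u i"
proof (cases "\<exists>v. lookup u v \<ge> 2")
  case True
  then show ?thesis using exact_at_not_squarefree by blast
next
  case False
  then have "u = ind (keys u)" by (intro squarefree_eq_ind) (simp add: not_le)
  then show ?thesis using assms[of "keys u"] by (metis mdeg_ind)
qed

section \<open>Exactness for complexes of dimension at most one\<close>

definition graph_complex :: "'n::finite set set \<Rightarrow> bool" where
  "graph_complex \<Delta> \<longleftrightarrow> down_closed \<Delta> \<and> (\<forall>v. {v} \<in> \<Delta>) \<and> (\<forall>F\<in>\<Delta>. card F \<le> 2)"

lemma graph_complex_empty: "graph_complex \<Delta> \<Longrightarrow> {} \<in> \<Delta>"
  unfolding graph_complex_def by (meson down_closedD empty_subsetI)

text \<open>The faces \<open>U - A\<close> in question would have at least three vertices.\<close>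

lemma exact_at_graph_high:
  fixes \<Delta> :: "'n::finite set set"
  assumes "graph_complex \<Delta>" "mdeg u \<ge> i + 3"
  shows "exact_at TYPE('k::field) \<Delta> u i"
proof (rule exact_atI_squarefree)
  fix U :: "'n set" assume U: "card U = mdeg u"
  show "exact_at TYPE('k) \<Delta> (ind U) i"
  proof (rule exact_at_no_faces)
    fix A assume A: "card A = i" "A \<subseteq> keys (ind U)"
    then have "card (U - A) \<ge> 3" using U assms(2) by (simp add: card_Diff_subset)
    then show "keys (ind U - ind A) \<notin> \<Delta>"
      using assms(1) by (force simp: keys_ind_diff graph_complex_def)
  qed
qed

text \<open>Fewer than i vertices leave no index A, and exactly i leave only \<open>A = U\<close>,
  the empty face. Any vertex of U then contracts the strand, and \<open>0 < i\<close> ensures that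
  there is one.\<close>

lemma exact_at_graph_low:
  fixes \<Delta> :: "'n::finite set set"
  assumes "graph_complex \<Delta>" "mdeg u \<le> i" "0 < i"
  shows "exact_at TYPE('k::field) \<Delta> u i"
proof (rule exact_atI_squarefree)
  fix U :: "'n set" assume U: "card U = mdeg u"
  show "exact_at TYPE('k) \<Delta> (ind U) i"
  proof (cases "card U = i")
    case False
    show ?thesis
    proof (rule exact_at_no_faces)
      fix A assume "card A = i" "A \<subseteq> keys (ind U)"
      then have "i \<le> card U" by (metis card_mono finite keys_ind)
      with False U assms(2) show "keys (ind U - ind A) \<notin> \<Delta>" by simp
    qed
  next
    case True
    then obtain v where v: "v \<in> U" using assms(3) by (metis card.empty ex_in_conv less_numeral_extra(3))
    show ?thesis
    proof (rule exact_at_contract)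
      show "v \<in> keys (ind U)" using v by simp
      fix A assume A: "card A = i" "v \<in> A" "A \<subseteq> keys (ind U)"
      then have "A = U" using True by (metis card_subset_eq finite keys_ind)
      then have "keys (ind U - ind (A - {v})) = {v}" using v by (auto simp: keys_ind_diff)
      then show "keys (ind U - ind (A - {v})) \<in> \<Delta>"
        using assms(1) by (simp add: graph_complex_def)
    qed
  qed
qed

section \<open>Stars and cycles\<close>

definition star :: "'n::finite \<Rightarrow> 'n set \<Rightarrow> 'n set set" where
  "star s L = {F. F = {} \<or> (\<exists>v. F = {v}) \<or> (\<exists>l\<in>L. F = {s, l})}"

text \<open>Every edge contains s. If U does too, contraction at s has a vacuous hypothesis, since
  no two-element face \<open>U - A\<close> has \<open>s \<in> A\<close>; otherwise U contains no
  edge.\<close>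

lemma exact_at_star:
  fixes s :: "'n::finite"
  assumes "mdeg u = i + 2"
  shows "exact_at TYPE('k::field) (star s L) u i"
proof (rule exact_atI_squarefree)
  fix U :: "'n set" assume U: "card U = mdeg u"
  have face: "s \<in> U - A" if "card A = i" "A \<subseteq> U" "U - A \<in> star s L" for A
  proof -
    have "card (U - A) = 2" using that U assms by (simp add: card_Diff_subset)
    moreover have "U - A = {} \<or> (\<exists>v. U - A = {v}) \<or> (\<exists>l. U - A = {s, l})"
      using that(3) by (auto simp only: star_def)
    ultimately have "\<exists>l. U - A = {s, l}" by (metis card.empty card_1_singleton_iff One_nat_def numeral_eq_one_iff semiring_norm(83) zero_neq_numeral)
    then show ?thesis by blast
  qed
  show "exact_at TYPE('k) (star s L) (ind U) i"
  proof (cases "s \<in> U")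
    case True
    show ?thesis
      by (rule exact_at_contract[of s]) (use True face in \<open>auto simp: keys_ind_diff\<close>)
  next
    case False
    show ?thesis
      by (rule exact_at_no_faces) (use False face in \<open>auto simp: keys_ind_diff\<close>)
  qed
qed

text \<open>The enumeration is meant to be periodic (\<open>cyclic_enum\<close>), so that the edge
  closing the cycle needs no separate clause.\<close>

definition cycle :: "(nat \<Rightarrow> 'n::finite) \<Rightarrow> 'n set set" where
  "cycle e = {F. F = {} \<or> (\<exists>v. F = {v}) \<or> (\<exists>t. F = {e t, e (Suc t)})}"

definition cyclic_enum :: "(nat \<Rightarrow> 'n::finite) \<Rightarrow> bool" where
  "cyclic_enum e \<longleftrightarrow> (\<forall>t. e (t + CARD('n)) = e t) \<and> surj e"

lemma cyclic_enum_exists: "\<exists>e :: nat \<Rightarrow> 'n::finite. cyclic_enum e"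
proof -
  obtain h where h: "bij_betw h {0..<CARD('n)} (UNIV :: 'n set)"
    using ex_bij_betw_nat_finite[OF finite_class.finite_UNIV] by blast
  define e where "e t = h (t mod CARD('n))" for t
  have "x \<in> range e" for x
  proof -
    obtain t where "t < CARD('n)" "h t = x"
      using h by (metis UNIV_I atLeastLessThan_iff bij_betw_def imageE)
    then have "e t = x" by (simp add: e_def)
    then show ?thesis by blast
  qed
  then have "cyclic_enum e" by (auto simp: cyclic_enum_def e_def)
  then show ?thesis by blast
qed

context
  fixes e :: "nat \<Rightarrow> 'n::finite"
  assumes e: "cyclic_enum e"
begin

lemma cyclic_enum_add: "e (t + CARD('n) * c) = e t"
proof (induction c)
  case (Suc c)
  have "e (t + CARD('n) * Suc c) = e (t + CARD('n) * c + CARD('n))"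
    by (simp add: algebra_simps)
  with Suc e show ?case by (simp add: cyclic_enum_def)
qed simp

lemma cyclic_enum_surj: "e ` {r..<r + CARD('n)} = UNIV"
proof -
  have "x \<in> e ` {r..<r + CARD('n)}" for x
  proof -
    obtain t where t: "e t = x" using e by (metis cyclic_enum_def surjD)
    define N where "N = CARD('n)"
    have N: "N > 0" by (simp add: N_def)
    \<comment> \<open>The residue of t - r modulo N; adding \<open>(N - 1) * r\<close> replaces
      subtracting r in the natural numbers.\<close>
    define s where "s = (t + (N - 1) * r) mod N"
    have "e (r + s) = x"
    proof -
      have "e (r + s) = e (r + s + N * ((t + (N - 1) * r) div N))"
        by (simp add: N_def cyclic_enum_add)
      also have "r + s + N * ((t + (N - 1) * r) div N) = r + (t + (N - 1) * r)"
        unfolding s_def by (simp add: add.assoc)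
      also have "\<dots> = t + N * r"
        using N by (cases N) auto
      finally show ?thesis by (simp add: N_def cyclic_enum_add t)
    qed
    moreover have "s < N" using N by (simp add: s_def)
    ultimately show ?thesis by (force simp: N_def)
  qed
  then show ?thesis by blast
qed

lemma cyclic_enum_inj: "inj_on e {r..<r + CARD('n)}"
  by (rule eq_card_imp_inj_on) (simp_all add: cyclic_enum_surj)

lemma cyclic_enum_mod: "e t = e (t mod CARD('n))"
proof -
  have "e (t mod CARD('n)) = e (t mod CARD('n) + CARD('n) * (t div CARD('n)))"
    by (simp only: cyclic_enum_add)
  then show ?thesis by simp
qed

text \<open>Makes the next vertex on the cycle a function of the vertex rather than of its index,
  because \<open>e\<close> is injective on one period.\<close>

lemma cyclic_enum_eqD:
  assumes "e s = e t"
  shows "e (Suc s) = e (Suc t)"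
proof -
  have "e (s mod CARD('n)) = e (t mod CARD('n))"
    using assms cyclic_enum_mod by simp
  then have "s mod CARD('n) = t mod CARD('n)"
    using cyclic_enum_inj[of 0] by (auto dest: inj_onD)
  then have "Suc s mod CARD('n) = Suc t mod CARD('n)"
    by (metis mod_Suc_eq)
  then show ?thesis by (metis cyclic_enum_mod)
qed

lemma cyclic_enum_Suc_neq:
  assumes "CARD('n) \<ge> 2"
  shows "e t \<noteq> e (Suc t)"
  using cyclic_enum_inj[of t] assms by (auto dest: inj_onD)

lemma cycle_edge:
  assumes "F \<in> cycle e" "card F = 2"
  obtains t where "F = {e t, e (Suc t)}" "e t \<noteq> e (Suc t)"
proof -
  from assms obtain t where t: "F = {e t, e (Suc t)}"
    unfolding cycle_def by auto
  with assms have "e t \<noteq> e (Suc t)" by auto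
  with t that show ?thesis by blast
qed

text \<open>A proper induced subgraph of a cycle is a union of paths, along which a potential of any
  edge cochain is obtained by summation.\<close>

lemma exact_at_cycle_proper:
  assumes "mdeg u = i + 2" "mdeg u \<noteq> CARD('n)"
  shows "exact_at TYPE('k::field) (cycle e) u i"
proof (rule exact_atI_squarefree)
  fix U :: "'n set" assume U: "card U = mdeg u"
  then have "U \<noteq> UNIV" using assms(2) by auto
  then obtain w where w: "w \<notin> U" by blast
  obtain r where r: "e r = w" using e by (metis cyclic_enum_def surjD)
  \<comment> \<open>The cycle is cut open at the missing vertex w: \<open>T x\<close> is the index
    of x in a period that begins at w.\<close>
  have "\<exists>t. t \<in> {r..<r + CARD('n)} \<and> e t = x" for x
    using cyclic_enum_surj[of r] by (metis UNIV_I imageE)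
  then obtain T where T: "\<And>x. T x \<in> {r..<r + CARD('n)}" "\<And>x. e (T x) = x" by metis
  show "exact_at TYPE('k) (cycle e) (ind U) i"
    unfolding exact_at_def keys_ind keys_ind_diff
  proof (intro allI impI)
    fix a :: "'n set \<Rightarrow> 'k"
    \<comment> \<open>With \<open>b (U - {q}) = sg q (U - {q}) * g q\<close>, the coboundary
      equation at the edge {p, q} becomes \<open>g q - g p = \<eta> p q\<close>, by
      \<open>sg_swap'\<close>.\<close>
    define \<eta> where "\<eta> p q = sg p (U - {p, q}) * sg q (U - {q}) * a (U - {p, q})" for p q
    \<comment> \<open>Partial sums from w onwards. Increments along pairs not inside U may be
      anything, since only differences across edges inside U are compared.\<close>
    define G where "G = rec_nat 0 (\<lambda>s y. y + \<eta> (e (r + s)) (e (r + Suc s)))"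
    have G: "G (Suc s) = G s + \<eta> (e (r + s)) (e (r + Suc s))" for s
      by (simp add: G_def)
    define g where "g x = G (T x - r)" for x
    define b where "b D = (let q = (THE q. U - D = {q}) in sg q D * g q)" for D
    have b: "b (U - {q}) = sg q (U - {q}) * g q" if "q \<in> U" for q
    proof -
      have "(THE x. U - (U - {q}) = {x}) = q"
        using that by (intro the_equality) auto
      then show ?thesis by (simp add: b_def)
    qed
    have "a A = (\<Sum>v\<in>U - A. sg v A * b (insert v A))"
      if A: "card A = i" "A \<subseteq> U" "U - A \<in> cycle e" for A
    proof -
      have "card (U - A) = 2" using A U assms by (simp add: card_Diff_subset)
      then obtain t where t: "U - A = {e t, e (Suc t)}" "e t \<noteq> e (Suc t)"
        using A(3) cycle_edge by blast
      define p q where "p = e t" and "q = e (Suc t)"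
      have pq: "U - A = {p, q}" "p \<noteq> q" using t by (simp_all add: p_def q_def)
      then have pqU: "p \<in> U" "q \<in> U" and AU: "A = U - {p, q}" using A(2) by auto
      have "e (Suc (T p)) = q"
        using cyclic_enum_eqD[of "T p" t] T(2)[of p] by (simp add: p_def q_def)
      moreover have "e (r + CARD('n)) = w"
        using r cyclic_enum_add[of r 1] by simp
      \<comment> \<open>Indices wrap around only on the edge that returns to w, and this edge is not
        inside U.\<close>
      ultimately have "Suc (T p) \<noteq> r + CARD('n)" using pqU w by metis
      then have "Suc (T p) \<in> {r..<r + CARD('n)}" using T(1)[of p] by simp
      then have Tq: "T q = Suc (T p)"
        using cyclic_enum_inj[of r] T \<open>e (Suc (T p)) = q\<close> by (meson inj_onD)
      have Tp: "T p \<ge> r" using T(1)[of p] by simp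
      have "G (Suc (T p - r)) = G (T p - r) + \<eta> (e (r + (T p - r))) (e (r + Suc (T p - r)))"
        by (rule G)
      then have gq: "g q = g p + \<eta> p q"
        using Tp T(2)[of p] \<open>e (Suc (T p)) = q\<close> by (simp add: g_def Tq Suc_diff_le)
      have ins: "insert p A = U - {q}" "insert q A = U - {p}"
        using AU pq pqU by auto
      have "(\<Sum>v\<in>U - A. sg v A * b (insert v A)) = sg p A * b (U - {q}) + sg q A * b (U - {p})"
        using pq ins by simp
      also have "\<dots> = sg p A * sg q (U - {q}) * g q + sg q A * sg p (U - {p}) * g p"
        using pqU by (simp add: b mult.assoc)
      also have "sg q A * sg p (U - {p}) = - (sg p A * sg q (U - {q}) :: 'k)"
        using sg_swap'[of q p A] pq ins AU by auto
      also have "sg p A * sg q (U - {q}) * g q + - (sg p A * sg q (U - {q})) * g p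
                 = sg p A * sg q (U - {q}) * \<eta> p q"
        by (simp add: gq algebra_simps)
      also have "\<dots> = (sg p A * sg p A) * (sg q (U - {q}) * sg q (U - {q})) * a A"
        unfolding \<eta>_def AU[symmetric] by (simp only: mult.assoc mult.commute mult.left_commute)
      also have "\<dots> = a A" by simp
      finally show ?thesis by simp
    qed
    then show "\<exists>b. \<forall>A. card A = i \<and> A \<subseteq> U \<and> U - A \<in> cycle e \<longrightarrow>
        a A = (\<Sum>v\<in>U - A. sg v A * b (insert v A))"
      by blast
  qed
qed

text \<open>This is reduced H^0 of the whole cycle. Up to signs a cocycle is a function on vertices
  that agrees at both ends of each edge; going around the cycle it is constant, hence the coboundary
  of a constant on the empty face.\<close>

lemma exact_at_cycle_top:
  assumes "mdeg u = CARD('n)" "i + 1 = CARD('n)" "CARD('n) \<ge> 2"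
  shows "exact_at TYPE('k::field) (cycle e) u i"
proof (rule exact_atI_squarefree)
  fix U :: "'n set" assume U: "card U = mdeg u"
  then have [simp]: "U = UNIV" using assms(1) by (metis card_subset_eq finite subset_UNIV)
  show "exact_at TYPE('k) (cycle e) (ind U) i"
    unfolding exact_at_def keys_ind keys_ind_diff
  proof (intro allI impI)
    fix a :: "'n set \<Rightarrow> 'k"
    assume cyc: "\<forall>B. card B + 1 = i \<and> B \<subseteq> U \<and> U - B \<in> cycle e \<longrightarrow>
             (\<Sum>v\<in>U - B. sg v B * a (insert v B)) = 0"
    define g where "g q = sg q (U - {q}) * a (U - {q})" for q
    have a: "a (U - {q}) = sg q (U - {q}) * g q" for q by (simp add: g_def)
    have step: "g (e (Suc t)) = g (e t)" for t
    proof -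
      define p q where "p = e t" and "q = e (Suc t)"
      have pq: "p \<noteq> q" using cyclic_enum_Suc_neq assms(3) by (simp add: p_def q_def)
      define B where "B = U - {p, q}"
      have UB: "U - B = {p, q}" by (auto simp: B_def)
      then have "U - B \<in> cycle e" by (auto simp: cycle_def p_def q_def)
      moreover have "card (U - {p, q}) = CARD('n) - 2"
        using pq by (subst card_Diff_subset) auto
      then have "card B + 1 = i" using assms by (simp add: B_def)
      ultimately have "(\<Sum>v\<in>U - B. sg v B * a (insert v B)) = 0" using cyc by auto
      moreover have ins: "insert p B = U - {q}" "insert q B = U - {p}"
        using pq by (auto simp: B_def)
      ultimately have "sg p B * a (U - {q}) + sg q B * a (U - {p}) = 0"
        using pq UB by simp
      then have "sg p B * sg q (U - {q}) * g q + sg q B * sg p (U - {p}) * g p = 0"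
        by (simp only: a mult.assoc)
      moreover have "sg q B * sg p (U - {p}) = - (sg p B * sg q (U - {q}) :: 'k)"
        using sg_swap'[of q p B] pq ins by (auto simp: B_def)
      ultimately have "sg p B * sg q (U - {q}) * (g q - g p) = 0"
        by (simp add: algebra_simps)
      moreover have "sg p B \<noteq> (0 :: 'k)" "sg q (U - {q}) \<noteq> (0 :: 'k)"
        by (simp_all add: sg_def)
      ultimately show ?thesis by (simp add: p_def q_def)
    qed
    have const: "g (e t) = g (e 0)" for t by (induction t) (simp_all add: step)
    have "a A = (\<Sum>v\<in>U - A. sg v A * g (e 0))" if "card A = i" for A
    proof -
      have "card (UNIV - A) = 1" using that assms(2) by (subst card_Diff_subset) auto
      then obtain q where q: "UNIV - A = {q}" by (auto simp: card_1_singleton_iff)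
      then have A: "A = U - {q}" by auto
      obtain t where "e t = q" using e by (metis cyclic_enum_def surjD)
      then have "g q = g (e 0)" using const by auto
      then show ?thesis using q a[of q] by (simp add: A)
    qed
    then show "\<exists>b. \<forall>A. card A = i \<and> A \<subseteq> U \<and> U - A \<in> cycle e \<longrightarrow>
        a A = (\<Sum>v\<in>U - A. sg v A * b (insert v A))"
      by (intro exI[of _ "\<lambda>_. g (e 0)"]) blast
  qed
qed

end

lemma graph_complex_star: "graph_complex (star s L)"
  by (auto simp: graph_complex_def down_closed_def star_def subset_singleton_iff subset_insert_iff
      card_insert_if)

lemma graph_complex_cycle: "graph_complex (cycle e)"
  by (auto simp: graph_complex_def down_closed_def cycle_def subset_singleton_iff subset_insert_iff
      card_insert_if)

section \<open>The Koszul differential on polynomials\<close>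

text \<open>The coefficient at A of the Koszul boundary of the chain with coefficients c. One
  function carries all homological positions; statements select a position by the cardinality of
  A.\<close>

definition kz :: "('n::finite set \<Rightarrow> ('n, 'k::field) pring) \<Rightarrow> 'n set \<Rightarrow> ('n, 'k) pring" where
  "kz c A = (\<Sum>v\<in>- A. (const (sg v A) * X v) * c (insert v A))"

lemma lookup_kz:
  "lookup (kz c A) m = (\<Sum>v\<in>keys m - A. sg v A * lookup (c (insert v A)) (m - ind {v}))"
proof -
  have "lookup (kz c A) m =
      (\<Sum>v\<in>- A. if v \<in> keys m then sg v A * lookup (c (insert v A)) (m - ind {v}) else 0)"
    unfolding kz_def lookup_sum
    by (intro sum.cong) (auto simp: lookup_const_mult lookup_X_mult mult.assoc)
  also have "\<dots> = (\<Sum>v\<in>keys m - A. sg v A * lookup (c (insert v A)) (m - ind {v}))"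
    by (rule sum.mono_neutral_cong_right) auto
  finally show ?thesis .
qed

text \<open>The pairs (v, w) and (w, v) contribute opposite terms by \<open>sg_swap'\<close>;
  splitting by \<open>idx\<close> matches them up.\<close>

lemma kz_kz: "kz (kz c) A = 0"
proof -
  define f where "f v w = (const (sg v A) * X v) * ((const (sg w (insert v A)) * X w) * c (insert w (insert v A)))"
    for v w
  have neq: "v \<noteq> w \<longleftrightarrow> idx v < idx w \<or> idx w < idx v" for v w :: 'a
    using inj_eq[OF inj_idx, of v w] by (metis neq_iff)
  define T where "T = {(v, w). v \<notin> A \<and> w \<notin> A \<and> v \<noteq> w}"
  define T1 where "T1 = {(v, w). v \<notin> A \<and> w \<notin> A \<and> idx v < idx w}"
  define T2 where "T2 = {(v, w). v \<notin> A \<and> w \<notin> A \<and> idx w < idx v}"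
  have "kz (kz c) A = (\<Sum>v\<in>- A. \<Sum>w\<in>- insert v A. f v w)"
    by (simp add: kz_def f_def sum_distrib_left)
  also have "\<dots> = (\<Sum>(v, w)\<in>Sigma (- A) (\<lambda>v. - insert v A). f v w)"
    by (rule sum.Sigma) auto
  also have "Sigma (- A) (\<lambda>v. - insert v A) = T"
    by (auto simp: T_def)
  also have "T = T1 \<union> T2"
    unfolding T_def T1_def T2_def neq by auto
  also have "(\<Sum>(v, w)\<in>T1 \<union> T2. f v w) = (\<Sum>(v, w)\<in>T1. f v w) + (\<Sum>(v, w)\<in>T2. f v w)"
    by (rule sum.union_disjoint) (auto simp: T1_def T2_def intro: finite_subset[OF subset_UNIV])
  also have "(\<Sum>(v, w)\<in>T2. f v w) = (\<Sum>(v, w)\<in>T1. f w v)"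
    by (rule sum.reindex_bij_witness[of _ prod.swap prod.swap]) (auto simp: T1_def T2_def)
  also have "\<dots> = (\<Sum>(v, w)\<in>T1. - f v w)"
  proof (rule sum.cong)
    fix x assume "x \<in> T1"
    then obtain v w where x: "x = (v, w)" "v \<notin> A" "w \<notin> A" "v \<noteq> w"
      by (auto simp: T1_def)
    have "sg w A * sg v (insert w A) = (- (sg v A * sg w (insert v A)) :: 'b)"
      using x by (intro sg_swap') auto
    then have "const (sg w A) * const (sg v (insert w A)) =
        (- (const (sg v A) * const (sg w (insert v A))) :: ('a, 'b) pring)"
      by (simp add: const_def mult_single single_uminus)
    then have "(const (sg w A) * const (sg v (insert w A))) * (X v * X w * c (insert w (insert v A))) =
        - (const (sg v A) * const (sg w (insert v A))) * (X v * X w * c (insert w (insert v A)))"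
      by simp
    then have "f w v = - f v w"
      by (simp add: f_def insert_commute mult_ac)
    then show "(case x of (v, w) \<Rightarrow> f w v) = (case x of (v, w) \<Rightarrow> - f v w)"
      using x by simp
  qed simp
  finally show ?thesis by (simp add: sum_negf case_prod_beta)
qed

lemma diff_ind_insert: "v \<notin> B \<Longrightarrow> u - ind B - ind {v} = u - ind (insert v B)"
  by (rule poly_mapping_eqI) (auto simp: lookup_minus lookup_ind)

lemma keys_diff_ind: "keys (u - ind B) - B = keys u - B"
  by (auto simp: in_keys_iff lookup_minus lookup_ind)

text \<open>Differential and ideal respect multidegrees, so the coefficients of \<open>c A\<close>
  at \<open>u - ind A\<close> form a chain in the strand of u. The strands of total degree j are
  solved one by one and glued; there are finitely many of them, so the result consists of
  polynomials. The degree of w is recorded for dimension shifting.\<close>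

lemma koszul_homology_vanishing:
  fixes c :: "'n::finite set \<Rightarrow> ('n, 'k::field) pring"
  assumes ex: "\<And>u. mdeg u = j \<Longrightarrow> exact_at TYPE('k) \<Delta> u i"
    and hom: "\<And>A m. card A = i \<Longrightarrow> m \<in> keys (c A) \<Longrightarrow> mdeg m + i = j"
    and cyc: "\<And>B. card B + 1 = i \<Longrightarrow> kz c B \<in> SR \<Delta>"
  shows "\<exists>w. (\<forall>A. card A = i \<longrightarrow> c A - kz w A \<in> SR \<Delta>) \<and>
             (\<forall>A m. m \<in> keys (w A) \<longrightarrow> mdeg m + card A = j)"
proof -
  have "\<exists>b. \<forall>A. card A = i \<and> A \<subseteq> keys u \<and> keys (u - ind A) \<in> \<Delta> \<longrightarrow>
          lookup (c A) (u - ind A) = (\<Sum>v\<in>keys u - A. sg v A * b (insert v A))"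
    if u: "mdeg u = j" for u
  proof -
    have "(\<Sum>v\<in>keys u - B. sg v B * lookup (c (insert v B)) (u - ind (insert v B))) = 0"
      if B: "card B + 1 = i" "B \<subseteq> keys u" "keys (u - ind B) \<in> \<Delta>" for B
    proof -
      have "(\<Sum>v\<in>keys u - B. sg v B * lookup (c (insert v B)) (u - ind (insert v B)))
          = lookup (kz c B) (u - ind B)"
        by (auto simp: lookup_kz keys_diff_ind diff_ind_insert intro!: sum.cong)
      also have "\<dots> = 0" using cyc[OF B(1)] B(3) by (simp add: mem_SR_iff)
      finally show ?thesis .
    qed
    then show ?thesis
      using ex[OF u, unfolded exact_at_def, THEN spec, of "\<lambda>A. lookup (c A) (u - ind A)"] by simp
  qed
  then have "\<forall>u. \<exists>b. mdeg u = j \<longrightarrow> (\<forall>A. card A = i \<and> A \<subseteq> keys u \<and> keys (u - ind A) \<in> \<Delta> \<longrightarrow>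
          lookup (c A) (u - ind A) = (\<Sum>v\<in>keys u - A. sg v A * b (insert v A)))"
    by blast
  from choice[OF this] obtain b where
    b: "\<And>u A. mdeg u = j \<Longrightarrow> card A = i \<Longrightarrow> A \<subseteq> keys u \<Longrightarrow> keys (u - ind A) \<in> \<Delta> \<Longrightarrow>
          lookup (c A) (u - ind A) = (\<Sum>v\<in>keys u - A. sg v A * b u (insert v A))"
    by blast
  \<comment> \<open>The coefficient at m belongs to multidegree \<open>m + ind A\<close>, as the
    Koszul basis element of A has degree \<open>ind A\<close>.\<close>
  define w where "w A = Abs_poly_mapping (\<lambda>m. if mdeg m + card A = j then b (m + ind A) A else 0)" for A
  have "finite {m. (if mdeg m + card A = j then b (m + ind A) A else 0) \<noteq> 0}" for A
    by (rule finite_subset[OF _ finite_mdeg[of "j - card A"]]) auto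
  then have w: "lookup (w A) m = (if mdeg m + card A = j then b (m + ind A) A else 0)" for A m
    by (simp add: w_def)
  have "lookup (c A - kz w A) m = 0" if A: "card A = i" and m: "keys m \<in> \<Delta>" for A m
  proof -
    have deg: "mdeg (m - ind {v}) + card (insert v A) = mdeg m + i" if "v \<in> keys m - A" for v
      using mdeg_diff_ind[of "{v}" m] that A by simp
    have kzw: "lookup (kz w A) m =
        (\<Sum>v\<in>keys m - A. if mdeg m + i = j then sg v A * b (m + ind A) (insert v A) else 0)"
      unfolding lookup_kz
    proof (rule sum.cong)
      fix v assume v: "v \<in> keys m - A"
      have "m - ind {v} + ind (insert v A) = m + ind A"
        using v by (intro poly_mapping_eqI) (auto simp: lookup_add lookup_minus lookup_ind in_keys_iff)
      with deg[OF v] show "sg v A * lookup (w (insert v A)) (m - ind {v}) =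
          (if mdeg m + i = j then sg v A * b (m + ind A) (insert v A) else 0)"
        by (simp add: w)
    qed simp
    show ?thesis
    proof (cases "mdeg m + i = j")
      case True
      have "lookup (c A) (m + ind A - ind A) =
          (\<Sum>v\<in>keys (m + ind A) - A. sg v A * b (m + ind A) (insert v A))"
        using True A m by (intro b) (auto simp: mdeg_add keys_add_nat)
      moreover have "keys (m + ind A) - A = keys m - A" by (auto simp: keys_add_nat)
      ultimately show ?thesis using True by (simp add: kzw lookup_minus)
    next
      case False
      then have "lookup (c A) m = 0" using hom[OF A, of m] by (auto simp: in_keys_iff)
      with False show ?thesis by (simp add: kzw lookup_minus)
    qed
  qed
  then have "c A - kz w A \<in> SR \<Delta>" if "card A = i" for A
    using that by (simp add: mem_SR_iff)
  moreover have "mdeg m + card A = j" if "m \<in> keys (w A)" for A m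
    using that by (simp add: in_keys_iff w split: if_splits)
  ultimately show ?thesis by blast
qed

section \<open>Graded free modules\<close>

lemma lookup_vscale: "lookup (vscale r v) e = r * lookup v e"
  by (simp add: vscale_def Poly_Mapping.map.rep_eq when_def)

lemma mem_free_module_iff: "v \<in> free_module b \<longleftrightarrow> (\<forall>j l. lookup v (j, l) \<noteq> 0 \<longrightarrow> l < b j)"
  by (auto simp: free_module_def in_keys_iff)

lemma free_module_zero [simp]: "0 \<in> free_module b"
  by (simp add: mem_free_module_iff)

lemma free_module_add: "u \<in> free_module b \<Longrightarrow> v \<in> free_module b \<Longrightarrow> u + v \<in> free_module b"
  by (auto simp: mem_free_module_iff lookup_add) (metis add.right_neutral)

lemma free_module_diff: "u \<in> free_module b \<Longrightarrow> v \<in> free_module b \<Longrightarrow> u - v \<in> free_module b"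
  by (auto simp: mem_free_module_iff lookup_minus) (metis diff_zero)

lemma free_module_vscale: "v \<in> free_module b \<Longrightarrow> vscale r v \<in> free_module b"
  by (simp add: mem_free_module_iff lookup_vscale) (metis mult_zero_right)

lemma free_module_sum: "(\<And>x. x \<in> S \<Longrightarrow> f x \<in> free_module b) \<Longrightarrow> sum f S \<in> free_module b"
  by (induction S rule: infinite_finite_induct) (auto intro: free_module_add)

lemma free_module_single: "l < b j \<Longrightarrow> single (j, l) p \<in> free_module b"
  by (auto simp: mem_free_module_iff lookup_single when_def split: if_splits)

lemma vscale_zero [simp]: "vscale r 0 = 0"
  by (rule poly_mapping_eqI) (simp add: lookup_vscale)

lemma module_vscale: "module (vscale :: ('n::finite, 'k::field) pring \<Rightarrow> _)"
  by standard (auto intro!: poly_mapping_eqI simp: lookup_vscale lookup_add algebra_simps)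

context
  fixes b :: "nat \<Rightarrow> nat" and scale :: "('n::finite, 'k::field) pring \<Rightarrow> 'm::ab_group_add \<Rightarrow> 'm"
    and hom \<phi>
  assumes lin: "graded_linear_on (free_module b) scale hom \<phi>"
begin

lemma graded_linear_add:
  "u \<in> free_module b \<Longrightarrow> v \<in> free_module b \<Longrightarrow> \<phi> (u + v) = \<phi> u + \<phi> v"
  using lin by (auto simp: graded_linear_on_def)

lemma graded_linear_scale: "v \<in> free_module b \<Longrightarrow> \<phi> (vscale r v) = scale r (\<phi> v)"
  using lin by (auto simp: graded_linear_on_def)

lemma graded_linear_hom: "v \<in> free_module b \<Longrightarrow> vhomogeneous d v \<Longrightarrow> hom d (\<phi> v)"
  using lin by (auto simp: graded_linear_on_def)

lemma graded_linear_zero: "\<phi> 0 = 0"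
  using graded_linear_add[of 0 0] by simp

lemma graded_linear_diff:
  assumes "u \<in> free_module b" "v \<in> free_module b"
  shows "\<phi> (u - v) = \<phi> u - \<phi> v"
  using graded_linear_add[OF free_module_diff[OF assms] assms(2)] by simp

lemma graded_linear_sum:
  "(\<And>x. x \<in> S \<Longrightarrow> f x \<in> free_module b) \<Longrightarrow> \<phi> (sum f S) = (\<Sum>x\<in>S. \<phi> (f x))"
  by (induction S rule: infinite_finite_induct)
     (auto simp: graded_linear_zero graded_linear_add free_module_sum)

end

section \<open>The Koszul differential on free modules\<close>

definition vkz :: "('n::finite set \<Rightarrow> ('n, 'k::field) fvec) \<Rightarrow> 'n set \<Rightarrow> ('n, 'k) fvec" where
  "vkz c A = (\<Sum>v\<in>- A. vscale (const (sg v A) * X v) (c (insert v A)))"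

lemma lookup_vkz: "lookup (vkz c A) e = kz (\<lambda>A. lookup (c A) e) A"
  by (simp add: vkz_def kz_def lookup_sum lookup_vscale)

lemma vkz_vkz: "vkz (vkz c) A = 0"
  by (rule poly_mapping_eqI) (simp add: lookup_vkz kz_kz)

lemma vkz_diff: "vkz (\<lambda>A. c A - d A) A = vkz c A - vkz d A"
  by (rule poly_mapping_eqI)
     (simp add: lookup_vkz kz_def lookup_minus right_diff_distrib sum_subtractf)

lemma vkz_cong: "(\<And>v. v \<notin> A \<Longrightarrow> c (insert v A) = d (insert v A)) \<Longrightarrow> vkz c A = vkz d A"
  unfolding vkz_def by (rule sum.cong) auto

lemma free_module_vkz: "(\<And>A. c A \<in> free_module b) \<Longrightarrow> vkz c A \<in> free_module b"
  unfolding vkz_def by (intro free_module_sum free_module_vscale)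

lemma graded_linear_vkz:
  assumes "graded_linear_on (free_module b) vscale hom \<phi>" "\<And>A. c A \<in> free_module b"
  shows "\<phi> (vkz c A) = vkz (\<lambda>A. \<phi> (c A)) A"
  unfolding vkz_def using assms
  by (simp add: graded_linear_sum[OF assms(1)] graded_linear_scale[OF assms(1)] free_module_vscale)

lemma graded_linear_kz:
  assumes "graded_linear_on (free_module b) (*) hom \<phi>" "\<And>A. c A \<in> free_module b"
  shows "\<phi> (vkz c A) = kz (\<lambda>A. \<phi> (c A)) A"
  unfolding vkz_def kz_def using assms
  by (simp add: graded_linear_sum[OF assms(1)] graded_linear_scale[OF assms(1)] free_module_vscale)

text \<open>Homogeneity of degree \<open>j - p\<close>, meaning that the vector is zero if \<open>j < p\<close>.\<close>

definition vhom_shift :: "nat \<Rightarrow> nat \<Rightarrow> ('n::finite, 'k::field) fvec \<Rightarrow> bool" where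
  "vhom_shift j p v \<longleftrightarrow> (\<forall>e m. m \<in> keys (lookup v e) \<longrightarrow> mdeg m + fst e + p = j)"

lemma vhomogeneous_iff: "vhomogeneous d v \<longleftrightarrow> (\<forall>e m. m \<in> keys (lookup v e) \<longrightarrow> mdeg m + fst e = d)"
  by (fastforce simp: vhomogeneous_def in_keys_iff)

lemma fvec_eq_0_iff: "v = 0 \<longleftrightarrow> (\<forall>e m. m \<notin> keys (lookup v e))"
  by (auto simp: in_keys_iff intro!: poly_mapping_eqI)

text \<open>Graded maps preserve \<open>vhomogeneous\<close>, but \<open>j - p\<close> truncates;
  the alternative \<open>v = 0\<close> covers negative degrees.\<close>

lemma vhom_shift_iff: "vhom_shift j p v \<longleftrightarrow> v = 0 \<or> (p \<le> j \<and> vhomogeneous (j - p) v)"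
proof (cases "p \<le> j")
  case True
  then have "a + p = j \<longleftrightarrow> a = j - p" for a :: nat by linarith
  then have "vhom_shift j p v \<longleftrightarrow> vhomogeneous (j - p) v"
    unfolding vhom_shift_def vhomogeneous_iff by presburger
  moreover have "vhomogeneous (j - p) 0" by (simp add: vhomogeneous_iff)
  ultimately show ?thesis using True by blast
next
  case False
  then have "a + p \<noteq> j" for a :: nat by linarith
  then show ?thesis using False unfolding vhom_shift_def fvec_eq_0_iff by simp
qed

text \<open>A free module is a sum of shifted copies of R, so each coordinate is handled by the
  exactness of the Koszul complex of R. Only constants in position 0 could obstruct, and
  \<open>const\<close> excludes them.\<close>

lemma vkz_exact:
  fixes z :: "'n::finite set \<Rightarrow> ('n, 'k::field) fvec"
  assumes z: "\<And>A. card A = p \<Longrightarrow> z A \<in> free_module b" "\<And>A. card A = p \<Longrightarrow> vhom_shift j p (z A)"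
    and cyc: "\<And>B. card B + 1 = p \<Longrightarrow> vkz z B = 0"
    and const: "\<And>A e. card A = p \<Longrightarrow> lookup (lookup (z A) e) 0 = 0"
  obtains c where "\<And>A. c A \<in> free_module b" "\<And>A. card A = Suc p \<Longrightarrow> vhom_shift j (Suc p) (c A)"
    "\<And>A. card A = p \<Longrightarrow> z A = vkz c A"
proof -
  have "\<exists>w. (\<forall>A. card A = p \<longrightarrow> lookup (z A) e = kz w A) \<and>
            (\<forall>A m. m \<in> keys (w A) \<longrightarrow> mdeg m + fst e + card A = j)" for e
  proof (cases "\<exists>A m. card A = p \<and> m \<in> keys (lookup (z A) e)")
    case False
    then have "lookup (z A) e = 0" if "card A = p" for A
      using that by (metis keys_eq_empty all_not_in_conv)
    then show ?thesis
      by (intro exI[of _ "\<lambda>_. 0"]) (simp add: kz_def)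
  next
    case True
    then obtain A0 m0 where A0: "card A0 = p" "m0 \<in> keys (lookup (z A0) e)" by blast
    then have "mdeg m0 + fst e + p = j"
      using z(2)[OF A0(1)] unfolding vhom_shift_def by blast
    then have m0: "mdeg m0 + p = j - fst e" "fst e \<le> j" by auto
    \<comment> \<open>A nonzero coordinate without constant term has positive degree, away from the
      one place where the complex of R is not exact.\<close>
    have "m0 \<noteq> 0" using A0 const[OF A0(1), of e] by (metis in_keys_iff)
    then have "mdeg m0 > 0" using mdeg_eq_0_iff[of m0] by simp
    with m0 have pos: "j - fst e > 0" by linarith
    have ex: "exact_at TYPE('k) UNIV u p" if "mdeg u = j - fst e" for u :: "'n \<Rightarrow>\<^sub>0 nat"
      using that pos by (intro exact_at_UNIV) auto
    have hom: "mdeg m + p = j - fst e" if "card A = p" "m \<in> keys (lookup (z A) e)" for A m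
    proof -
      have "mdeg m + fst e + p = j"
        using z(2)[OF that(1)] that(2) unfolding vhom_shift_def by blast
      then show ?thesis by simp
    qed
    have cyc': "kz (\<lambda>A. lookup (z A) e) B \<in> SR UNIV" if "card B + 1 = p" for B
      using cyc[OF that] lookup_vkz[of z B e] by simp
    have "\<exists>w. (\<forall>A. card A = p \<longrightarrow> lookup (z A) e - kz w A \<in> SR UNIV) \<and>
        (\<forall>A m. m \<in> keys (w A) \<longrightarrow> mdeg m + card A = j - fst e)"
      by (rule koszul_homology_vanishing; fact ex hom cyc')
    then obtain w where "\<And>A. card A = p \<Longrightarrow> lookup (z A) e - kz w A \<in> SR UNIV"
      and "\<And>A m. m \<in> keys (w A) \<Longrightarrow> mdeg m + card A = j - fst e" by blast
    with m0(2) show ?thesis by (intro exI[of _ w]) (fastforce simp: SR_UNIV)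
  qed
  then obtain w where w: "\<And>e A. card A = p \<Longrightarrow> lookup (z A) e = kz (w e) A"
    "\<And>e A m. m \<in> keys (w e A) \<Longrightarrow> mdeg m + fst e + card A = j"
    by metis
  \<comment> \<open>Keeping only basis elements that occur in some \<open>z A\<close> makes
    \<open>c A\<close> finitely supported and puts it into the free module.\<close>
  define E where "E = (\<Union>A\<in>{A. card A = p}. keys (z A))"
  have fE: "finite E" by (auto simp: E_def)
  define c where "c A = (\<Sum>e\<in>E. single e (w e A))" for A
  have c: "lookup (c A) e = (if e \<in> E then w e A else 0)" for A e
    using fE by (simp add: c_def lookup_sum lookup_single when_def)
  show thesis
  proof
    show "c A \<in> free_module b" for A
      unfolding mem_free_module_iff
    proof (intro allI impI)
      fix j l assume "lookup (c A) (j, l) \<noteq> 0"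
      then have "(j, l) \<in> E" by (auto simp: c split: if_splits)
      then show "l < b j" using z(1) unfolding E_def by (force simp: free_module_def)
    qed
    show "vhom_shift j (Suc p) (c A)" if "card A = Suc p" for A
      using that w(2) unfolding vhom_shift_def by (fastforce simp: c split: if_splits)
    show "z A = vkz c A" if "card A = p" for A
    proof (rule poly_mapping_eqI)
      fix e show "lookup (z A) e = lookup (vkz c A) e"
      proof (cases "e \<in> E")
        case True
        then show ?thesis using w(1)[OF that] by (simp add: lookup_vkz c)
      next
        case False
        then have "e \<notin> keys (z A)" using that by (auto simp: E_def)
        then show ?thesis using False by (simp add: lookup_vkz c in_keys_iff kz_def)
      qed
    qed
  qed
qed

section \<open>Vanishing of Betti numbers\<close>

text \<open>Vanishing of the Koszul homology of \<open>F / Z\<close> at homological position \<open>p\<close> in degree \<open>j\<close>,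
  for the free module \<open>F\<close> given by \<open>b\<close>.\<close>

definition koszul_acyclic ::
  "(nat \<Rightarrow> nat) \<Rightarrow> ('n::finite, 'k::field) fvec set \<Rightarrow> nat \<Rightarrow> nat \<Rightarrow> bool" where
  "koszul_acyclic b Z p j \<longleftrightarrow>
     (\<forall>c. (\<forall>A. c A \<in> free_module b) \<longrightarrow> (\<forall>A. card A = p \<longrightarrow> vhom_shift j p (c A)) \<longrightarrow>
          (\<forall>B. card B + 1 = p \<longrightarrow> vkz c B \<in> Z) \<longrightarrow>
          (\<exists>d. (\<forall>A. d A \<in> free_module b) \<and> (\<forall>A. card A = p \<longrightarrow> c A - vkz d A \<in> Z)))"

text \<open>\<open>\<epsilon>\<close> identifies F / Z with \<open>R / SR \<Delta>\<close>: a cycle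
  is pushed down, solved there, and the solution is lifted through \<open>surj\<close>. The lifting
  error lies in the ideal, and so does its boundary.\<close>

lemma koszul_acyclic_base:
  fixes \<epsilon> :: "('n::finite, 'k::field) fvec \<Rightarrow> ('n, 'k) pring"
  assumes lin: "graded_linear_on (free_module b) (*) homogeneous \<epsilon>"
    and surj: "\<And>p. \<exists>v\<in>free_module b. p - \<epsilon> v \<in> SR \<Delta>"
    and ex: "\<And>u. mdeg u = j \<Longrightarrow> exact_at TYPE('k) \<Delta> u i"
    and dc: "down_closed \<Delta>"
  shows "koszul_acyclic b {v \<in> free_module b. \<epsilon> v \<in> SR \<Delta>} i j"
  unfolding koszul_acyclic_def
proof (intro allI impI)
  fix c :: "'n set \<Rightarrow> ('n, 'k) fvec"
  assume "\<forall>A. c A \<in> free_module b" and "\<forall>A. card A = i \<longrightarrow> vhom_shift j i (c A)"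
    and "\<forall>B. card B + 1 = i \<longrightarrow> vkz c B \<in> {v \<in> free_module b. \<epsilon> v \<in> SR \<Delta>}"
  then have c: "\<And>A. c A \<in> free_module b" and hom: "\<And>A. card A = i \<Longrightarrow> vhom_shift j i (c A)"
    and cyc: "\<And>B. card B + 1 = i \<Longrightarrow> \<epsilon> (vkz c B) \<in> SR \<Delta>" by auto
  have hom': "mdeg m + i = j" if "card A = i" "m \<in> keys (\<epsilon> (c A))" for A m
  proof -
    have "c A \<noteq> 0" using that(2) graded_linear_zero[OF lin] by auto
    then have "i \<le> j" "vhomogeneous (j - i) (c A)" using hom[OF that(1)] by (auto simp: vhom_shift_iff)
    then have "homogeneous (j - i) (\<epsilon> (c A))" using graded_linear_hom[OF lin c] by blast
    with that(2) \<open>i \<le> j\<close> show ?thesis by (auto simp: homogeneous_def)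
  qed
  have cyc': "kz (\<lambda>A. \<epsilon> (c A)) B \<in> SR \<Delta>" if "card B + 1 = i" for B
    using cyc[OF that] graded_linear_kz[OF lin c] by simp
  have "\<exists>w. (\<forall>A. card A = i \<longrightarrow> \<epsilon> (c A) - kz w A \<in> SR \<Delta>) \<and>
      (\<forall>A m. m \<in> keys (w A) \<longrightarrow> mdeg m + card A = j)"
    by (rule koszul_homology_vanishing; fact ex hom' cyc')
  then obtain w where w: "\<And>A. card A = i \<Longrightarrow> \<epsilon> (c A) - kz w A \<in> SR \<Delta>" by blast
  from surj have "\<forall>A. \<exists>v\<in>free_module b. w A - \<epsilon> v \<in> SR \<Delta>" by blast
  then obtain d where d: "\<And>A. d A \<in> free_module b" "\<And>A. w A - \<epsilon> (d A) \<in> SR \<Delta>" by metis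
  have "c A - vkz d A \<in> {v \<in> free_module b. \<epsilon> v \<in> SR \<Delta>}" if A: "card A = i" for A
  proof -
    have F: "vkz d A \<in> free_module b" using d(1) by (rule free_module_vkz)
    have "\<epsilon> (c A - vkz d A) = \<epsilon> (c A) - kz (\<lambda>A. \<epsilon> (d A)) A"
      by (simp add: graded_linear_diff[OF lin c F] graded_linear_kz[OF lin d(1)])
    also have "\<dots> = (\<epsilon> (c A) - kz w A) + (kz w A - kz (\<lambda>A. \<epsilon> (d A)) A)" by simp
    also have "\<dots> = (\<epsilon> (c A) - kz w A) + kz (\<lambda>A. w A - \<epsilon> (d A)) A"
      by (simp add: kz_def right_diff_distrib sum_subtractf)
    also have "\<dots> \<in> SR \<Delta>"
      using w[OF A] d(2) by (intro SR_add) (auto simp: kz_def intro: SR_sum SR_mult[OF dc])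
    finally show ?thesis using free_module_diff[OF c F] by simp
  qed
  then show "\<exists>d. (\<forall>A. d A \<in> free_module b) \<and>
      (\<forall>A. card A = i \<longrightarrow> c A - vkz d A \<in> {v \<in> free_module b. \<epsilon> v \<in> SR \<Delta>})"
    using d(1) by blast
qed

text \<open>Dimension shifting: \<open>\<phi>\<close> identifies the new quotient with \<open>Z\<close>, the kernel of \<open>F \<rightarrow> F / Z\<close>, and \<open>F\<close>
  has no Koszul homology in positive positions; minimality kills the map from position 0.\<close>

lemma koszul_acyclic_step:
  fixes \<phi> :: "('n::finite, 'k::field) fvec \<Rightarrow> ('n, 'k) fvec"
  assumes lin: "graded_linear_on (free_module b') vscale vhomogeneous \<phi>"
    and im: "\<phi> ` free_module b' = Z" and Z: "Z \<subseteq> free_module b"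
    and const: "\<And>v e. v \<in> free_module b' \<Longrightarrow> lookup (lookup (\<phi> v) e) 0 = 0"
    and ac: "koszul_acyclic b Z (Suc p) j"
  shows "koszul_acyclic b' {v \<in> free_module b'. \<phi> v = 0} p j"
  unfolding koszul_acyclic_def
proof (intro allI impI)
  fix c :: "'n set \<Rightarrow> ('n, 'k) fvec"
  assume "\<forall>A. c A \<in> free_module b'" and "\<forall>A. card A = p \<longrightarrow> vhom_shift j p (c A)"
    and "\<forall>B. card B + 1 = p \<longrightarrow> vkz c B \<in> {v \<in> free_module b'. \<phi> v = 0}"
  then have c: "\<And>A. c A \<in> free_module b'" and hom: "\<And>A. card A = p \<Longrightarrow> vhom_shift j p (c A)"
    and cyc: "\<And>B. card B + 1 = p \<Longrightarrow> \<phi> (vkz c B) = 0" by auto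
  have zZ: "\<phi> (c A) \<in> Z" for A using c im by blast
  have z1: "\<phi> (c A) \<in> free_module b" for A using zZ Z by blast
  have z2: "vhom_shift j p (\<phi> (c A))" if "card A = p" for A
    using hom[OF that] graded_linear_hom[OF lin c] graded_linear_zero[OF lin]
    by (auto simp: vhom_shift_iff)
  have z3: "vkz (\<lambda>A. \<phi> (c A)) B = 0" if "card B + 1 = p" for B
    using cyc[OF that] graded_linear_vkz[OF lin c] by simp
  obtain c' where c': "\<And>A. c' A \<in> free_module b"
    "\<And>A. card A = Suc p \<Longrightarrow> vhom_shift j (Suc p) (c' A)"
    "\<And>A. card A = p \<Longrightarrow> \<phi> (c A) = vkz c' A"
    using vkz_exact[of p "\<lambda>A. \<phi> (c A)" b j, OF z1 z2 z3 const[OF c]] by blast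
  \<comment> \<open>At sets of size p the boundary of \<open>c'\<close> is
    \<open>\<phi> (c B)\<close>, an element of Z; so \<open>c'\<close> is a cycle of F / Z one
    position higher, where \<open>ac\<close> applies.\<close>
  have "vkz c' B \<in> Z" if "card B + 1 = Suc p" for B
    using c'(3)[of B] that zZ[of B] by simp
  then obtain d' where d': "\<And>A. d' A \<in> free_module b" "\<And>A. card A = Suc p \<Longrightarrow> c' A - vkz d' A \<in> Z"
    using ac[unfolded koszul_acyclic_def, rule_format, of c'] c' by blast
  \<comment> \<open>Lifting \<open>c' - vkz d'\<close> along \<open>\<phi>\<close> gives d. As
    \<open>vkz\<close> squares to zero, the boundary of d maps to that of \<open>c'\<close>, which
    is the image of c; hence c and \<open>vkz d\<close> differ by a kernel element.\<close>
  have "\<forall>A. \<exists>v\<in>free_module b'. card A = Suc p \<longrightarrow> \<phi> v = c' A - vkz d' A"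
    using d'(2) im by (metis free_module_zero imageE)
  then obtain d where d: "\<And>A. d A \<in> free_module b'" "\<And>A. card A = Suc p \<Longrightarrow> \<phi> (d A) = c' A - vkz d' A"
    by metis
  have "c A - vkz d A \<in> {v \<in> free_module b'. \<phi> v = 0}" if A: "card A = p" for A
  proof -
    have F: "vkz d A \<in> free_module b'" using d(1) by (rule free_module_vkz)
    have "\<phi> (vkz d A) = vkz (\<lambda>A. \<phi> (d A)) A" using lin d(1) by (rule graded_linear_vkz)
    also have "\<dots> = vkz (\<lambda>A. c' A - vkz d' A) A"
      using A by (intro vkz_cong d(2)) simp
    also have "\<dots> = \<phi> (c A)" by (simp add: vkz_diff vkz_vkz c'(3)[OF A])
    finally show ?thesis
      using free_module_diff[OF c F] graded_linear_diff[OF lin c F] by simp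
  qed
  then show "\<exists>d. (\<forall>A. d A \<in> free_module b') \<and>
      (\<forall>A. card A = p \<longrightarrow> c A - vkz d A \<in> {v \<in> free_module b'. \<phi> v = 0})"
    using d(1) by blast
qed

text \<open>In position 0 a basis vector of degree j would be a boundary modulo Z. Boundaries have
  coefficients in the irrelevant ideal, and so has Z by \<open>const\<close>, while a basis vector
  has coefficient 1.\<close>

lemma koszul_acyclic_imp_no_generators:
  assumes ac: "koszul_acyclic b (Z :: ('n::finite, 'k::field) fvec set) 0 j"
    and const: "\<And>v e. v \<in> Z \<Longrightarrow> lookup (lookup v e) 0 = 0"
  shows "b j = 0"
proof (rule ccontr)
  assume "b j \<noteq> 0"
  then have F: "single (j, 0) 1 \<in> free_module b" by (intro free_module_single) simp
  have "vhom_shift j 0 (single (j, 0) 1)"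
    by (auto simp: vhom_shift_def in_keys_iff lookup_single lookup_one when_def split: if_splits)
  with F obtain d where "single (j, 0) 1 - vkz d {} \<in> Z"
    using ac[unfolded koszul_acyclic_def, rule_format, of "\<lambda>_. single (j, 0) 1"] by auto
  then have "lookup (lookup (single (j, 0) 1 - vkz d {}) (j, 0)) 0 = 0" by (rule const)
  then show False by (simp add: lookup_minus lookup_vkz lookup_kz)
qed

text \<open>Acyclicity at position i for \<open>R / SR \<Delta>\<close> becomes acyclicity at
  position 0 for the i-th syzygy module, whose minimal generators of degree j are then
  absent.\<close>

lemma betti_vanishing:
  fixes \<epsilon> :: "('n::finite, 'k::field) fvec \<Rightarrow> ('n, 'k) pring"
  assumes res: "minimal_graded_free_resolution (SR \<Delta>) b \<epsilon> \<phi>"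
    and dc: "down_closed \<Delta>"
    and ex: "\<And>u. mdeg u = j \<Longrightarrow> exact_at TYPE('k) \<Delta> u i"
    and const: "{} \<in> \<Delta>"
  shows "b i j = 0"
proof -
  have r: "graded_free_resolution (SR \<Delta>) b \<epsilon> \<phi>"
    and "\<forall>i. \<forall>v\<in>free_module (b (Suc i)). \<forall>e. lookup (lookup (\<phi> i v) e) 0 = 0"
    using res unfolding minimal_graded_free_resolution_def by (rule conjunct1, rule conjunct2)
  then have min': "\<And>i v e. v \<in> free_module (b (Suc i)) \<Longrightarrow> lookup (lookup (\<phi> i v) e) 0 = 0"
    by blast
  have lin0: "graded_linear_on (free_module (b 0)) (*) homogeneous \<epsilon>"
    and lin: "\<And>i. graded_linear_on (free_module (b (Suc i))) vscale vhomogeneous (\<phi> i)"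
    and surj: "\<And>p. \<exists>v\<in>free_module (b 0). p - \<epsilon> v \<in> SR \<Delta>"
    and im0: "\<phi> 0 ` free_module (b 1) = {v \<in> free_module (b 0). \<epsilon> v \<in> SR \<Delta>}"
    and im: "\<And>i. \<phi> (Suc i) ` free_module (b (Suc (Suc i))) = {v \<in> free_module (b (Suc i)). \<phi> i v = 0}"
    using r unfolding graded_free_resolution_def by simp_all
  define Z where "Z q = \<phi> q ` free_module (b (Suc q))" for q
  have min: "lookup (lookup v e) 0 = 0" if "v \<in> Z q" for q v e
  proof -
    from that obtain u where "u \<in> free_module (b (Suc q))" "v = \<phi> q u" unfolding Z_def by (rule imageE)
    then show ?thesis using min' by simp
  qed
  have Z0: "Z 0 = {v \<in> free_module (b 0). \<epsilon> v \<in> SR \<Delta>}" using im0 by (simp add: Z_def)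
  have ZS: "Z (Suc q) = {v \<in> free_module (b (Suc q)). \<phi> q v = 0}" for q using im by (simp add: Z_def)
  have ZF: "Z q \<subseteq> free_module (b q)" for q by (cases q) (auto simp: Z0 ZS)
  \<comment> \<open>The q-th free module modulo \<open>Z q\<close> is the q-th syzygy module up to
    isomorphism; each step along the resolution lowers the Koszul position by one.\<close>
  have "koszul_acyclic (b q) (Z q) (i - q) j" if "q \<le> i" for q
    using that
  proof (induction q)
    case 0
    then show ?case
      unfolding Z0 using koszul_acyclic_base[OF lin0 surj ex dc] by simp
  next
    case (Suc q)
    then have "koszul_acyclic (b q) (Z q) (Suc (i - Suc q)) j" by (simp add: Suc_diff_Suc)
    then show ?case
      unfolding ZS by (intro koszul_acyclic_step[OF lin Z_def[symmetric] ZF min'])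
  qed
  from this[of i] show ?thesis using min by (intro koszul_acyclic_imp_no_generators[of "b i" "Z i"]) auto
qed

section \<open>Linear algebra\<close>

text \<open>Applied with Q a kernel basis in rank-nullity and with Q a basis of the decomposable
  elements for minimal generators: B stays independent modulo \<open>span Q\<close>.\<close>

lemma (in vector_space) independent_Un_coeff_zero:
  assumes ind: "independent (Q \<union> B)" and disj: "Q \<inter> B = {}" and fin: "finite Q" "finite B"
    and sum: "(\<Sum>x\<in>B. scale (c x) x) \<in> span Q" and x: "x \<in> B"
  shows "c x = 0"
proof -
  from sum fin obtain r where r: "(\<Sum>x\<in>B. scale (c x) x) = (\<Sum>x\<in>Q. scale (r x) x)"
    by (auto simp: span_finite)
  define s where "s x = (if x \<in> B then c x else - r x)" for x
  have "(\<Sum>x\<in>Q \<union> B. scale (s x) x) = (\<Sum>x\<in>Q. scale (s x) x) + (\<Sum>x\<in>B. scale (s x) x)"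
    using fin disj by (intro sum.union_disjoint)
  also have "(\<Sum>x\<in>Q. scale (s x) x) = (\<Sum>x\<in>Q. - scale (r x) x)"
    using disj by (intro sum.cong) (auto simp: s_def)
  also have "(\<Sum>x\<in>B. scale (s x) x) = (\<Sum>x\<in>B. scale (c x) x)"
    by (intro sum.cong) (auto simp: s_def)
  finally have "(\<Sum>x\<in>Q \<union> B. scale (s x) x) = 0"
    by (simp add: r sum_negf)
  then have "s x = 0"
    using x fin by (intro independentD[OF ind, of "Q \<union> B"]) auto
  then show ?thesis using x by (simp add: s_def)
qed

lemma (in vector_space) subspace_sum_scale:
  "subspace V \<Longrightarrow> C \<subseteq> V \<Longrightarrow> (\<Sum>x\<in>C. scale (r x) x) \<in> V"
  by (intro subspace_sum subspace_scale) auto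

text \<open>Relations are indexed by the family and not by its image, so a coincidence
  \<open>f x = f y\<close> is itself a relation, with coefficients 1 and -1.\<close>

lemma (in vector_space) independent_image:
  assumes "finite C" and coeff: "\<And>r x. (\<Sum>x\<in>C. scale (r x) (f x)) = 0 \<Longrightarrow> x \<in> C \<Longrightarrow> r x = 0"
  shows "inj_on f C" and "independent (f ` C)"
proof -
  show inj: "inj_on f C"
  proof (rule inj_onI, rule ccontr)
    fix x y assume xy: "x \<in> C" "y \<in> C" "f x = f y" "x \<noteq> y"
    define r where "r z = (if z = x then 1 else if z = y then - 1 else 0 :: 'a)" for z
    have "(\<Sum>z\<in>C. scale (r z) (f z)) = (\<Sum>z\<in>{x, y}. scale (r z) (f z))"
      using xy assms(1) by (intro sum.mono_neutral_right) (auto simp: r_def)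
    also have "\<dots> = 0" using xy by (simp add: r_def)
    finally have "r x = 0" using xy(1) by (rule coeff)
    then show False by (simp add: r_def)
  qed
  show "independent (f ` C)"
  proof (rule independent_if_scalars_zero)
    fix r y assume r: "(\<Sum>x\<in>f ` C. scale (r x) x) = 0" "y \<in> f ` C"
    then have "(\<Sum>x\<in>C. scale (r (f x)) (f x)) = 0" by (simp add: sum.reindex[OF inj])
    with coeff[of "\<lambda>x. r (f x)"] r(2) show "r y = 0" by auto
  qed (use assms in auto)
qed

text \<open>Linearity is assumed only on V, because maps of a resolution are controlled only on
  their free modules. A kernel basis is extended to a basis of V, and the added vectors map to a
  basis of the image.\<close>

lemma rank_nullity:
  fixes s1 :: "'k::field \<Rightarrow> 'v::ab_group_add \<Rightarrow> 'v" and s2 :: "'k \<Rightarrow> 'w::ab_group_add \<Rightarrow> 'w"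
  assumes vs1: "vector_space s1" and vs2: "vector_space s2"
    and V: "module.subspace s1 V" "V \<subseteq> module.span s1 T" "finite T"
    and add: "\<And>u v. u \<in> V \<Longrightarrow> v \<in> V \<Longrightarrow> f (u + v) = f u + f v"
    and scale: "\<And>c v. v \<in> V \<Longrightarrow> f (s1 c v) = s2 c (f v)"
  shows "vector_space.dim s1 V = vector_space.dim s2 (f ` V) + vector_space.dim s1 {v \<in> V. f v = 0}"
proof -
  interpret V1: vector_space s1 by fact
  interpret V2: vector_space s2 by fact
  have f0: "f 0 = 0" using scale[of 0 0] V1.subspace_0[OF V(1)] by simp
  have fsum: "f (\<Sum>x\<in>C. s1 (r x) x) = (\<Sum>x\<in>C. s2 (r x) (f x))" if "C \<subseteq> V" for C r
    using that
    by (induction C rule: infinite_finite_induct)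
       (auto simp: f0 add scale V1.subspace_scale[OF V(1)] V1.subspace_sum_scale[OF V(1)])
  define K where "K = {v \<in> V. f v = 0}"
  have K: "K \<subseteq> V" "\<And>v. v \<in> K \<Longrightarrow> f v = 0" by (auto simp: K_def)
  obtain Q where Q: "Q \<subseteq> K" "V1.independent Q" "K \<subseteq> V1.span Q" "card Q = V1.dim K"
    using V1.basis_exists by blast
  obtain B where B: "Q \<subseteq> B" "B \<subseteq> V" "V1.independent B" "V \<subseteq> V1.span B"
    using V1.maximal_independent_subset_extend[OF subset_trans[OF Q(1) K(1)] Q(2)] by blast
  have finB: "finite B"
    using V1.independent_span_bound[OF V(3) B(3)] B(2) V(2) by blast
  define C where "C = B - Q"
  have C: "B = Q \<union> C" "Q \<inter> C = {}" "finite C" "finite Q" "C \<subseteq> V"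
    using B finB by (auto simp: C_def intro: finite_subset)
  have coeff: "r x = 0" if "(\<Sum>x\<in>C. s2 (r x) (f x)) = 0" "x \<in> C" for r x
  proof (rule V1.independent_Un_coeff_zero)
    show "V1.independent (Q \<union> C)" using B(3) C(1) by simp
    have "(\<Sum>x\<in>C. s1 (r x) x) \<in> K"
      using that(1) fsum[OF C(5)] V1.subspace_sum_scale[OF V(1) C(5)] by (simp add: K_def)
    then show "(\<Sum>x\<in>C. s1 (r x) x) \<in> V1.span Q" using Q(3) by blast
  qed (use C that in auto)
  have inj: "inj_on f C" and indep: "V2.independent (f ` C)"
    using V2.independent_image[OF C(3), of f] coeff by blast+
  have span: "f ` V \<subseteq> V2.span (f ` C)"
  proof safe
    fix v assume "v \<in> V"
    then obtain r where "v = (\<Sum>x\<in>B. s1 (r x) x)"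
      using B(4) by (auto simp: V1.span_finite[OF finB])
    then have "f v = (\<Sum>x\<in>B. s2 (r x) (f x))" by (simp add: fsum[OF B(2)])
    also have "\<dots> = (\<Sum>x\<in>C. s2 (r x) (f x))"
      using C Q(1) K(2) finB by (intro sum.mono_neutral_right) auto
    also have "\<dots> \<in> V2.span (f ` C)"
      by (intro V2.span_sum V2.span_scale V2.span_base) auto
    finally show "f v \<in> V2.span (f ` C)" .
  qed
  have "V2.dim (f ` V) = card (f ` C)"
    using V2.basis_card_eq_dim[OF _ span indep] image_mono[OF C(5), of f] by simp
  also have "\<dots> = card C" using inj by (rule card_image)
  finally have "V2.dim (f ` V) = card C" .
  moreover have "V1.dim V = card B"
    using V1.basis_card_eq_dim[OF B(2,4,3)] by simp
  moreover have "card B = card Q + card C"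
    using C by (simp add: card_Un_disjoint)
  ultimately show ?thesis using Q(4) by (simp add: K_def)
qed

section \<open>Degree components\<close>

declare split_paired_All [simp del] split_paired_Ex [simp del]

definition kscale :: "'k \<Rightarrow> ('n::finite, 'k::field) fvec \<Rightarrow> ('n, 'k) fvec" where
  "kscale c v = vscale (const c) v"

lemma lookup_kscale: "lookup (lookup (kscale c v) e) m = c * lookup (lookup v e) m"
  by (simp add: kscale_def lookup_vscale lookup_const_mult)

lemma fvec_eqI: "(\<And>e m. lookup (lookup u e) m = lookup (lookup v e) m) \<Longrightarrow> u = v"
  by (intro poly_mapping_eqI) auto

interpretation fv: vector_space "kscale :: 'k::field \<Rightarrow> ('n::finite, 'k) fvec \<Rightarrow> _"
  by standard (auto intro!: fvec_eqI simp: lookup_kscale lookup_add algebra_simps)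

definition restrict_keys :: "('a \<Rightarrow> bool) \<Rightarrow> ('a \<Rightarrow>\<^sub>0 'b::comm_monoid_add) \<Rightarrow> 'a \<Rightarrow>\<^sub>0 'b" where
  "restrict_keys P p = (\<Sum>m\<in>{m \<in> keys p. P m}. single m (lookup p m))"

lemma lookup_restrict_keys: "lookup (restrict_keys P p) m = (if P m then lookup p m else 0)"
  by (auto simp: restrict_keys_def lookup_sum lookup_single when_def in_keys_iff)

definition hcomp :: "nat \<Rightarrow> ('n::finite, 'k::field) fvec \<Rightarrow> ('n, 'k) fvec" where
  "hcomp d v = (\<Sum>e\<in>keys v. single e (restrict_keys (\<lambda>m. mdeg m + fst e = d) (lookup v e)))"

lemma lookup_hcomp':
  fixes v :: "('n::finite, 'k::field) fvec"
  shows "lookup (hcomp d v) e = restrict_keys (\<lambda>m. mdeg m + fst e = d) (lookup v e)"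
proof -
  have "lookup (hcomp d v) e =
      (if e \<in> keys v then restrict_keys (\<lambda>m. mdeg m + fst e = d) (lookup v e) else 0)"
    by (simp add: hcomp_def lookup_sum lookup_single when_def)
  moreover have "restrict_keys (\<lambda>m. mdeg m + fst e = d) (0 :: ('n, 'k) pring) = 0"
    by (simp add: restrict_keys_def)
  ultimately show ?thesis by (auto simp: in_keys_iff)
qed

lemma lookup_hcomp:
  "lookup (lookup (hcomp d v) e) m = (if mdeg m + fst e = d then lookup (lookup v e) m else 0)"
  by (simp add: lookup_hcomp' lookup_restrict_keys)

lemma vhomogeneous_iff': "vhomogeneous d v \<longleftrightarrow> (\<forall>e m. lookup (lookup v e) m \<noteq> 0 \<longrightarrow> mdeg m + fst e = d)"
  by (simp add: vhomogeneous_iff in_keys_iff)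

lemma vhomogeneous_hcomp: "vhomogeneous d (hcomp d v)"
  by (simp add: vhomogeneous_iff' lookup_hcomp)

lemma hcomp_vhomogeneous: "vhomogeneous d' v \<Longrightarrow> hcomp d v = (if d = d' then v else 0)"
  by (rule fvec_eqI) (auto simp: lookup_hcomp vhomogeneous_iff')

lemma hcomp_zero [simp]: "hcomp d 0 = 0"
  by (rule fvec_eqI) (simp add: lookup_hcomp)

lemma hcomp_add: "hcomp d (u + v) = hcomp d u + hcomp d v"
  by (rule fvec_eqI) (simp add: lookup_hcomp lookup_add)

lemma hcomp_sum: "hcomp d (sum f S) = (\<Sum>x\<in>S. hcomp d (f x))"
  by (induction S rule: infinite_finite_induct) (auto simp: hcomp_add)

lemma free_module_hcomp:
  assumes "v \<in> free_module b"
  shows "hcomp d v \<in> free_module b"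
proof -
  have "lookup (hcomp d v) e = 0" if "lookup v e = 0" for e
    using that by (simp add: lookup_hcomp' restrict_keys_def)
  with assms show ?thesis by (auto simp: mem_free_module_iff)
qed

definition vdegs :: "('n::finite, 'k::field) fvec \<Rightarrow> nat set" where
  "vdegs v = (\<Union>e\<in>keys v. (\<lambda>m. mdeg m + fst e) ` keys (lookup v e))"

lemma finite_vdegs: "finite (vdegs v)"
  by (simp add: vdegs_def)

text \<open>Any finite superset of the occurring degrees is allowed, so that a prescribed degree can
  be adjoined.\<close>

lemma sum_hcomp:
  assumes "finite D" "vdegs v \<subseteq> D"
  shows "(\<Sum>d\<in>D. hcomp d v) = v"
proof (rule fvec_eqI)
  fix e m
  have "lookup (lookup (\<Sum>d\<in>D. hcomp d v) e) m
      = (\<Sum>d\<in>D. if d = mdeg m + fst e then lookup (lookup v e) m else 0)"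
    by (auto simp: lookup_sum lookup_hcomp intro!: sum.cong)
  also have "\<dots> = (if mdeg m + fst e \<in> D then lookup (lookup v e) m else 0)"
    using assms(1) by simp
  also have "\<dots> = lookup (lookup v e) m"
  proof (cases "lookup (lookup v e) m = 0")
    case False
    then have "m \<in> keys (lookup v e)" "e \<in> keys v" by (auto simp: in_keys_iff)
    then have "mdeg m + fst e \<in> vdegs v" by (auto simp: vdegs_def)
    with assms show ?thesis by auto
  qed simp
  finally show "lookup (lookup (\<Sum>d\<in>D. hcomp d v) e) m = lookup (lookup v e) m" .
qed

text \<open>The image of the component of degree d' is again homogeneous of degree d', so only
  \<open>d' = d\<close> contributes to the component of degree d.\<close>

lemma graded_linear_hcomp:
  fixes \<phi> :: "('n::finite, 'k::field) fvec \<Rightarrow> ('n, 'k) fvec"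
  assumes lin: "graded_linear_on (free_module b) vscale vhomogeneous \<phi>" and v: "v \<in> free_module b"
  shows "\<phi> (hcomp d v) = hcomp d (\<phi> v)"
proof -
  define D where "D = insert d (vdegs v)"
  have D: "finite D" "d \<in> D" by (simp_all add: D_def finite_vdegs)
  have "\<phi> v = \<phi> (\<Sum>d\<in>D. hcomp d v)"
    by (subst sum_hcomp) (auto simp: D_def finite_vdegs)
  also have "\<dots> = (\<Sum>d\<in>D. \<phi> (hcomp d v))"
    using v by (intro graded_linear_sum[OF lin] free_module_hcomp)
  finally have "hcomp d (\<phi> v) = (\<Sum>d'\<in>D. hcomp d (\<phi> (hcomp d' v)))" by (simp add: hcomp_sum)
  also have "\<dots> = (\<Sum>d'\<in>D. if d' = d then \<phi> (hcomp d' v) else 0)"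
  proof (rule sum.cong)
    fix d'
    have "vhomogeneous d' (\<phi> (hcomp d' v))"
      using graded_linear_hom[OF lin] free_module_hcomp[OF v] vhomogeneous_hcomp by blast
    then show "hcomp d (\<phi> (hcomp d' v)) = (if d' = d then \<phi> (hcomp d' v) else 0)"
      by (auto simp: hcomp_vhomogeneous)
  qed simp
  also have "\<dots> = \<phi> (hcomp d v)" using D by simp
  finally show ?thesis by simp
qed

section \<open>Graded submodules and their finite-dimensional degree parts\<close>

definition graded_submodule :: "(nat \<Rightarrow> nat) \<Rightarrow> ('n::finite, 'k::field) fvec set \<Rightarrow> bool" where
  "graded_submodule b Z \<longleftrightarrow> Z \<subseteq> free_module b \<and> module.subspace vscale Z \<and> (\<forall>d. \<forall>v\<in>Z. hcomp d v \<in> Z)"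

lemmas vscale_subspace_def = module.subspace_def[OF module_vscale]

lemma graded_submodule_kernel:
  fixes \<phi> :: "('n::finite, 'k::field) fvec \<Rightarrow> ('n, 'k) fvec"
  assumes lin: "graded_linear_on (free_module b) vscale vhomogeneous \<phi>"
  shows "graded_submodule b {v \<in> free_module b. \<phi> v = 0}"
  by (auto simp: graded_submodule_def vscale_subspace_def free_module_add free_module_vscale
      free_module_hcomp graded_linear_add[OF lin] graded_linear_scale[OF lin]
      graded_linear_hcomp[OF lin] graded_linear_zero[OF lin])

definition monomial_indices :: "(nat \<Rightarrow> nat) \<Rightarrow> nat \<Rightarrow> ((nat \<times> nat) \<times> ('n::finite \<Rightarrow>\<^sub>0 nat)) set" where
  "monomial_indices b d = {((j, l), m). j \<le> d \<and> l < b j \<and> mdeg m + j = d}"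

definition monomial_vectors :: "(nat \<Rightarrow> nat) \<Rightarrow> nat \<Rightarrow> ('n::finite, 'k::field) fvec set" where
  "monomial_vectors b d = (\<lambda>(e, m). single e (single m 1)) ` monomial_indices b d"

lemma monomial_indices_Sigma:
  "monomial_indices b d = (SIGMA e:(SIGMA j:{..d}. {..<b j}). {m. mdeg m = d - fst e})"
  by (auto simp: monomial_indices_def)

lemma finite_monomial_indices: "finite (monomial_indices b d)"
  unfolding monomial_indices_Sigma by (intro finite_SigmaI) (auto simp: finite_mdeg)

lemma finite_monomial_vectors: "finite (monomial_vectors b d)"
  by (simp add: monomial_vectors_def finite_monomial_indices)

definition degree_part :: "('n::finite, 'k::field) fvec set \<Rightarrow> nat \<Rightarrow> ('n, 'k) fvec set" where
  "degree_part Z d = {v \<in> Z. vhomogeneous d v}"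

lemma degree_part_subset_span:
  fixes Z :: "('n::finite, 'k::field) fvec set"
  assumes "Z \<subseteq> free_module b"
  shows "degree_part Z d \<subseteq> fv.span (monomial_vectors b d)"
proof
  fix v assume "v \<in> degree_part Z d"
  then have v: "v \<in> free_module b" "vhomogeneous d v" using assms by (auto simp: degree_part_def)
  have "single e (lookup v e) \<in> fv.span (monomial_vectors b d)" if "e \<in> keys v" for e
  proof -
    have "single e (single m (lookup (lookup v e) m)) \<in> fv.span (monomial_vectors b d)"
      if "m \<in> keys (lookup v e)" for m
    proof -
      have "mdeg m + fst e = d" using v(2) that unfolding vhomogeneous_iff by blast
      moreover have "snd e < b (fst e)"
        using v(1) \<open>e \<in> keys v\<close> by (auto simp: free_module_def)
      ultimately have "(e, m) \<in> monomial_indices b d"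
        by (cases e) (auto simp: monomial_indices_def)
      then have "single e (single m (1 :: 'k)) \<in> monomial_vectors b d"
        by (force simp: monomial_vectors_def)
      moreover have "single e (single m (lookup (lookup v e) m))
          = kscale (lookup (lookup v e) m) (single e (single m 1))"
        by (rule fvec_eqI) (auto simp: lookup_kscale lookup_single when_def)
      ultimately show ?thesis by (metis fv.span_base fv.span_scale)
    qed
    then have "(\<Sum>m\<in>keys (lookup v e). single e (single m (lookup (lookup v e) m)))
        \<in> fv.span (monomial_vectors b d)"
      by (rule fv.span_sum)
    moreover have "(\<Sum>m\<in>keys (lookup v e). single e (single m (lookup (lookup v e) m)))
        = single e (\<Sum>m\<in>keys (lookup v e). single m (lookup (lookup v e) m))"
      by (rule poly_mapping_eqI) (auto simp: lookup_sum lookup_single when_def)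
    ultimately show ?thesis by (simp add: sum_single_keys)
  qed
  then have "(\<Sum>e\<in>keys v. single e (lookup v e)) \<in> fv.span (monomial_vectors b d)"
    by (rule fv.span_sum)
  then show "v \<in> fv.span (monomial_vectors b d)" by (simp add: sum_single_keys)
qed

lemma vhomogeneous_add: "vhomogeneous d u \<Longrightarrow> vhomogeneous d v \<Longrightarrow> vhomogeneous d (u + v)"
  unfolding vhomogeneous_iff' by (metis add.right_neutral lookup_add)

lemma vhomogeneous_kscale: "vhomogeneous d v \<Longrightarrow> vhomogeneous d (kscale c v)"
  by (auto simp: vhomogeneous_iff' lookup_kscale)

lemma vhomogeneous_zero: "vhomogeneous d 0"
  by (simp add: vhomogeneous_iff')

lemma subspace_degree_part:
  assumes "module.subspace vscale Z"
  shows "fv.subspace (degree_part Z d)"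
  using assms unfolding fv.subspace_def vscale_subspace_def degree_part_def
  by (auto simp: vhomogeneous_add vhomogeneous_kscale vhomogeneous_zero) (auto simp: kscale_def)

section \<open>Existence of minimal resolutions\<close>

lemma vhomogeneous_vscale:
  assumes "vhomogeneous d' v" "\<And>m. m \<in> keys p \<Longrightarrow> mdeg m + d' = d"
  shows "vhomogeneous d (vscale p v)"
  unfolding vhomogeneous_iff
proof (intro allI impI)
  fix e m assume "m \<in> keys (lookup (vscale p v) e)"
  then obtain a c where "m = a + c" "a \<in> keys p" "c \<in> keys (lookup v e)"
    using keys_mult[of p "lookup v e"] by (auto simp: lookup_vscale)
  with assms show "mdeg m + fst e = d"
    unfolding vhomogeneous_iff by (metis add.assoc mdeg_add)
qed

lemma vscale_assoc: "vscale p (vscale q v) = vscale (p * q) v"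
  by (rule poly_mapping_eqI) (simp add: lookup_vscale mult.assoc)

lemma vscale_add_left: "vscale (p + q) v = vscale p v + vscale q v"
  by (rule poly_mapping_eqI) (simp add: lookup_vscale lookup_add algebra_simps)

lemma vscale_add_right: "vscale p (u + v) = vscale p u + vscale p v"
  by (rule poly_mapping_eqI) (simp add: lookup_vscale lookup_add algebra_simps)

lemma vscale_zero_left [simp]: "vscale 0 v = 0"
  by (rule poly_mapping_eqI) (simp add: lookup_vscale)

lemma vscale_one [simp]: "vscale 1 v = v"
  by (rule poly_mapping_eqI) (simp add: lookup_vscale)

lemma vscale_sum_left: "vscale (sum f S) v = (\<Sum>x\<in>S. vscale (f x) v)"
  by (induction S rule: infinite_finite_induct) (auto simp: vscale_add_left)

lemma vscale_sum_right: "vscale p (sum f S) = (\<Sum>x\<in>S. vscale p (f x))"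
  by (induction S rule: infinite_finite_induct) (auto simp: vscale_add_right)

text \<open>For graded Z, a K-spanning set of the degree d part of the irrelevant ideal times Z;
  \<open>d = Suc d'\<close> makes it empty in degree 0.\<close>

definition decomposables :: "('n::finite, 'k::field) fvec set \<Rightarrow> nat \<Rightarrow> ('n, 'k) fvec set" where
  "decomposables Z d = {vscale (X x) z | x z. z \<in> Z \<and> (\<exists>d'. d = Suc d' \<and> vhomogeneous d' z)}"

lemma decomposables_subset:
  assumes "module.subspace vscale Z"
  shows "decomposables Z d \<subseteq> degree_part Z d"
proof
  fix v assume "v \<in> decomposables Z d"
  then obtain x z d' where v: "v = vscale (X x) z" "z \<in> Z" "d = Suc d'" "vhomogeneous d' z"
    by (auto simp: decomposables_def)
  have "vhomogeneous d v"
    unfolding v(1) by (rule vhomogeneous_vscale[OF v(4)]) (simp add: X_def v(3))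
  then show "v \<in> degree_part Z d"
    using assms v unfolding vscale_subspace_def by (auto simp: degree_part_def)
qed

text \<open>Every monomial m of p is divisible by a variable x, and m g is x times the element (m /
  x) g of Z.\<close>

lemma vscale_in_span_decomposables:
  fixes Z :: "('n::finite, 'k::field) fvec set"
  assumes Z: "module.subspace vscale Z" and g: "g \<in> Z" "vhomogeneous d' g"
    and p: "\<And>m. m \<in> keys p \<Longrightarrow> mdeg m + d' = d" "lookup p 0 = 0"
  shows "vscale p g \<in> fv.span (decomposables Z d)"
proof -
  have "vscale (single m (lookup p m)) g \<in> fv.span (decomposables Z d)" if m: "m \<in> keys p" for m
  proof -
    have "m \<noteq> 0" using m p(2) by (auto simp: in_keys_iff)
    then obtain x where x: "x \<in> keys m" by (metis keys_eq_empty_iff ex_in_conv)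
    then have mx: "ind {x} + (m - ind {x}) = m"
      using diff_ind_add[of "{x}" m] by (simp add: add.commute)
    define z where "z = vscale (single (m - ind {x}) 1) g"
    have "z \<in> Z" using Z g(1) by (simp add: z_def vscale_subspace_def)
    moreover have "mdeg (m - ind {x}) + 1 + d' = d"
      using mdeg_diff_ind[of "{x}" m] x p(1)[OF m] by simp
    then have "d = Suc (mdeg (m - ind {x}) + d')" by simp
    moreover have "vhomogeneous (mdeg (m - ind {x}) + d') z"
      unfolding z_def by (rule vhomogeneous_vscale[OF g(2)]) simp
    ultimately have "vscale (X x) z \<in> decomposables Z d"
      unfolding decomposables_def by blast
    moreover have "vscale (single m (lookup p m)) g = kscale (lookup p m) (vscale (X x) z)"
      by (simp add: kscale_def z_def vscale_assoc const_def X_def mult_single mx)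
    ultimately show ?thesis by (simp only: fv.span_scale[OF fv.span_base])
  qed
  then have "(\<Sum>m\<in>keys p. vscale (single m (lookup p m)) g) \<in> fv.span (decomposables Z d)"
    by (rule fv.span_sum)
  then show ?thesis by (simp add: sum_single_keys flip: vscale_sum_left)
qed

text \<open>Graded Nakayama data: Q is a basis of the span of the decomposables, and g completes it
  to a basis of the degree part, so g represents a basis of Z modulo the irrelevant ideal times Z in
  degree d.\<close>

definition minimal_generators ::
  "('n::finite, 'k::field) fvec set \<Rightarrow> nat \<Rightarrow> ('n, 'k) fvec set \<Rightarrow> (nat \<Rightarrow> ('n, 'k) fvec) \<Rightarrow> nat \<Rightarrow> bool" where
  "minimal_generators Z d Q g n \<longleftrightarrow>
     Q \<subseteq> decomposables Z d \<and> decomposables Z d \<subseteq> fv.span Q \<and> finite Q \<and>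
     inj_on g {..<n} \<and> Q \<inter> g ` {..<n} = {} \<and> fv.independent (Q \<union> g ` {..<n}) \<and>
     g ` {..<n} \<subseteq> degree_part Z d \<and> degree_part Z d \<subseteq> fv.span (Q \<union> g ` {..<n})"

lemma minimal_generators_exist:
  fixes Z :: "('n::finite, 'k::field) fvec set"
  assumes gs: "graded_submodule b Z"
  shows "\<exists>Q g n. minimal_generators Z d Q g n"
proof -
  have Z: "Z \<subseteq> free_module b" "module.subspace vscale Z"
    using gs by (auto simp: graded_submodule_def)
  obtain Q where Q: "Q \<subseteq> decomposables Z d" "fv.independent Q" "decomposables Z d \<subseteq> fv.span Q"
    using fv.maximal_independent_subset by blast
  have "Q \<subseteq> degree_part Z d" using Q(1) decomposables_subset[OF Z(2)] by blast
  then obtain B where B: "Q \<subseteq> B" "B \<subseteq> degree_part Z d" "fv.independent B" "degree_part Z d \<subseteq> fv.span B"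
    using fv.maximal_independent_subset_extend Q(2) by blast
  have "B \<subseteq> fv.span (monomial_vectors b d)"
    using B(2) degree_part_subset_span[OF Z(1)] by blast
  then have fB: "finite B"
    using fv.independent_span_bound[OF finite_monomial_vectors B(3)] by blast
  then obtain g where g: "bij_betw g {..<card (B - Q)} (B - Q)"
    using ex_bij_betw_nat_finite[of "B - Q"] by (auto simp: atLeast0LessThan)
  then have im: "g ` {..<card (B - Q)} = B - Q" and inj: "inj_on g {..<card (B - Q)}"
    by (auto simp: bij_betw_def)
  have "Q \<union> (B - Q) = B" using B(1) by blast
  then show ?thesis
    unfolding minimal_generators_def using Q B fB inj by (intro exI[of _ Q] exI[of _ g] exI[of _ "card (B - Q)"])
      (auto simp: im intro: finite_subset)
qed

text \<open>Such representatives in all degrees generate Z, by induction on the degree. A kernel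
  element with a nonzero constant coefficient would give a linear relation between representatives
  of one degree modulo decomposables, against their independence.\<close>

lemma minimal_cover_exists:
  fixes Z :: "('n::finite, 'k::field) fvec set"
  assumes gs: "graded_submodule b Z"
  obtains b' \<phi> where "graded_linear_on (free_module b') vscale vhomogeneous \<phi>"
    "\<phi> ` free_module b' = Z"
    "\<And>v e. v \<in> free_module b' \<Longrightarrow> \<phi> v = 0 \<Longrightarrow> lookup (lookup v e) 0 = 0"
proof -
  have Z: "Z \<subseteq> free_module b" "module.subspace vscale Z"
    and Zh: "\<And>d v. v \<in> Z \<Longrightarrow> hcomp d v \<in> Z"
    using gs by (auto simp: graded_submodule_def)
  have Zv: "vscale p v \<in> Z" if "v \<in> Z" for p v
    using Z(2) that by (simp add: vscale_subspace_def)
  have Zs: "sum f S \<in> Z" if "\<And>x. x \<in> S \<Longrightarrow> f x \<in> Z" for f :: "nat \<times> nat \<Rightarrow> _" and S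
    using that by (rule module.subspace_sum[OF module_vscale Z(2)])
  have "\<forall>d. \<exists>Q g n. minimal_generators Z d Q g n"
    using minimal_generators_exist[OF gs] by blast
  then obtain Q g b' where gens: "\<And>d. minimal_generators Z d (Q d) (g d) (b' d)"
    by metis
  then have Q: "\<And>d. Q d \<subseteq> decomposables Z d" "\<And>d. decomposables Z d \<subseteq> fv.span (Q d)" "\<And>d. finite (Q d)"
    and g: "\<And>d. inj_on (g d) {..<b' d}" "\<And>d. Q d \<inter> g d ` {..<b' d} = {}"
      "\<And>d. fv.independent (Q d \<union> g d ` {..<b' d})" "\<And>d. g d ` {..<b' d} \<subseteq> degree_part Z d"
      "\<And>d. degree_part Z d \<subseteq> fv.span (Q d \<union> g d ` {..<b' d})"
    by (simp_all add: minimal_generators_def)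
  have gZ: "g d l \<in> Z" "vhomogeneous d (g d l)" if "l < b' d" for d l
    using g(4)[of d] that by (auto simp: degree_part_def)
  define \<phi> where "\<phi> v = (\<Sum>e\<in>keys v. vscale (lookup v e) (g (fst e) (snd e)))" for v :: "('n, 'k) fvec"
  have \<phi>_sup: "\<phi> v = (\<Sum>e\<in>T. vscale (lookup v e) (g (fst e) (snd e)))" if "finite T" "keys v \<subseteq> T" for v :: "('n, 'k) fvec" and T
    unfolding \<phi>_def using that by (intro sum.mono_neutral_left) (auto simp: in_keys_iff)
  have \<phi>_add: "\<phi> (u + v) = \<phi> u + \<phi> v" for u v :: "('n, 'k) fvec"
  proof -
    have "keys (u + v) \<subseteq> keys u \<union> keys v" by (auto simp: in_keys_iff lookup_add)
    then show ?thesis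
      by (simp add: \<phi>_sup[of "keys u \<union> keys v"] lookup_add vscale_add_left sum.distrib)
  qed
  have \<phi>_scale: "\<phi> (vscale r v) = vscale r (\<phi> v)" for r and v :: "('n, 'k) fvec"
  proof -
    have "keys (vscale r v) \<subseteq> keys v" by (auto simp: in_keys_iff lookup_vscale)
    then show ?thesis
      by (simp add: \<phi>_sup[of "keys v"] lookup_vscale vscale_sum_right vscale_assoc)
  qed
  have snd_less: "snd e < b' (fst e)" if "v \<in> free_module b'" "e \<in> keys v" for v :: "('n, 'k) fvec" and e
    using that by (auto simp: free_module_def)
  have lin: "graded_linear_on (free_module b') vscale vhomogeneous \<phi>"
    unfolding graded_linear_on_def
  proof (intro conjI allI ballI impI)
    fix d and v :: "('n, 'k) fvec" assume v: "v \<in> free_module b'" "vhomogeneous d v"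
    have "vhomogeneous d (vscale (lookup v e) (g (fst e) (snd e)))" if "e \<in> keys v" for e
      by (rule vhomogeneous_vscale[OF gZ(2)[OF snd_less[OF v(1) that]]])
         (use v(2) in \<open>auto simp: vhomogeneous_iff\<close>)
    then show "vhomogeneous d (\<phi> v)"
      unfolding \<phi>_def vhomogeneous_iff' lookup_sum by (metis (no_types, lifting) sum.neutral)
  qed (simp_all add: \<phi>_add \<phi>_scale)
  have im_sub: "\<phi> ` free_module b' \<subseteq> Z"
  proof (rule image_subsetI)
    fix v :: "('n, 'k) fvec" assume v: "v \<in> free_module b'"
    show "\<phi> v \<in> Z" unfolding \<phi>_def by (intro Zs Zv gZ(1) snd_less[OF v])
  qed
  define I where "I = \<phi> ` free_module b'"
  have I_add: "u + v \<in> I" if "u \<in> I" "v \<in> I" for u v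
  proof -
    from that obtain u' v' where "u = \<phi> u'" "v = \<phi> v'" "u' \<in> free_module b'" "v' \<in> free_module b'"
      unfolding I_def by blast
    then show ?thesis unfolding I_def by (intro image_eqI[of _ _ "u' + v'"]) (simp_all add: \<phi>_add free_module_add)
  qed
  have I_scale: "vscale r v \<in> I" if "v \<in> I" for r v
  proof -
    from that obtain v' where "v = \<phi> v'" "v' \<in> free_module b'"
      unfolding I_def by blast
    then show ?thesis unfolding I_def by (intro image_eqI[of _ _ "vscale r v'"]) (simp_all add: \<phi>_scale free_module_vscale)
  qed
  have I_zero: "0 \<in> I" unfolding I_def \<phi>_def by (rule image_eqI[of _ _ 0]) auto
  have I_sub: "fv.subspace I"
    unfolding fv.subspace_def using I_zero I_add I_scale by (simp add: kscale_def)
  have I_sum: "sum f S \<in> I" if "\<And>x. x \<in> S \<Longrightarrow> f x \<in> I" for f :: "nat \<Rightarrow> _" and S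
    using that by (rule fv.subspace_sum[OF I_sub])
  have g_I: "g d l \<in> I" if "l < b' d" for d l
  proof -
    have "\<phi> (single (d, l) 1) = (\<Sum>e\<in>{(d, l)}. vscale (lookup (single (d, l) 1) e) (g (fst e) (snd e)))"
      by (rule \<phi>_sup) (auto simp: in_keys_iff lookup_single when_def split: if_splits)
    then have "g d l = \<phi> (single (d, l) 1)" by simp
    moreover have "single (d, l) 1 \<in> free_module b'" using that by (rule free_module_single)
    ultimately show ?thesis unfolding I_def by (rule image_eqI)
  qed
  have deg_I: "degree_part Z d \<subseteq> I" for d
  proof (induction d)
    case (0)
    have "decomposables Z 0 = {}" by (simp add: decomposables_def)
    then have "Q 0 \<union> g 0 ` {..<b' 0} \<subseteq> I" using Q(1)[of 0] g_I by auto
    then show ?case using g(5)[of 0] fv.span_minimal[OF _ I_sub] by blast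
  next
    case (Suc d)
    have "decomposables Z (Suc d) \<subseteq> I"
      using Suc I_scale by (auto simp: decomposables_def degree_part_def)
    then have "Q (Suc d) \<union> g (Suc d) ` {..<b' (Suc d)} \<subseteq> I" using Q(1)[of "Suc d"] g_I by auto
    then show ?case using g(5)[of "Suc d"] fv.span_minimal[OF _ I_sub] by blast
  qed
  have "Z \<subseteq> I"
  proof
    fix z assume z: "z \<in> Z"
    have "hcomp d z \<in> I" for d
      using deg_I[of d] Zh[OF z] vhomogeneous_hcomp by (auto simp: degree_part_def)
    then have "(\<Sum>d\<in>vdegs z. hcomp d z) \<in> I" by (rule I_sum)
    then show "z \<in> I" by (simp add: sum_hcomp finite_vdegs)
  qed
  then have im: "\<phi> ` free_module b' = Z" using im_sub by (auto simp: I_def)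
  have min: "lookup (lookup v e) 0 = 0" if v: "v \<in> free_module b'" "\<phi> v = 0" for v e
  proof (cases "lookup v e = 0")
    case False
    obtain d l where e: "e = (d, l)" by fastforce
    have l: "l < b' d" using False v(1) by (auto simp: e mem_free_module_iff)
    \<comment> \<open>In the component of degree d, coefficients at basis elements of degree d are
      constants, and those at basis elements of other degrees have no constant term.\<close>
    define u where "u = hcomp d v"
    have u: "u \<in> free_module b'" "vhomogeneous d u"
      using v(1) by (auto simp: u_def free_module_hcomp vhomogeneous_hcomp)
    have "\<phi> u = 0"
      unfolding u_def using graded_linear_hcomp[OF lin v(1)] v(2) by simp
    define D where "D = (\<lambda>l. (d, l)) ` {..<b' d}"
    define c where "c l = lookup (lookup u (d, l)) 0" for l
    have const_part: "lookup u (d, l') = const (c l')" for l'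
    proof (rule poly_mapping_eqI)
      fix m
      have "lookup (lookup u (d, l')) m \<noteq> 0 \<Longrightarrow> mdeg m = 0"
        using u(2) unfolding vhomogeneous_iff' by fastforce
      then show "lookup (lookup u (d, l')) m = lookup (const (c l')) m"
        by (auto simp: c_def const_def lookup_single when_def mdeg_eq_0_iff)
    qed
    have "\<phi> u = (\<Sum>e\<in>keys u \<union> D. vscale (lookup u e) (g (fst e) (snd e)))"
      by (rule \<phi>_sup) (auto simp: D_def)
    also have "\<dots> = (\<Sum>e\<in>D. vscale (lookup u e) (g (fst e) (snd e))) +
        (\<Sum>e\<in>keys u - D. vscale (lookup u e) (g (fst e) (snd e)))"
      by (subst sum.union_disjoint[symmetric]) (auto simp: D_def Un_commute)
    also have "(\<Sum>e\<in>D. vscale (lookup u e) (g (fst e) (snd e))) = (\<Sum>l<b' d. kscale (c l) (g d l))"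
      unfolding D_def by (subst sum.reindex) (auto simp: inj_on_def const_part kscale_def)
    finally have "(\<Sum>l<b' d. kscale (c l) (g d l)) =
        - (\<Sum>e\<in>keys u - D. vscale (lookup u e) (g (fst e) (snd e)))"
      using \<open>\<phi> u = 0\<close> by (simp add: eq_neg_iff_add_eq_0)
    also have "\<dots> \<in> fv.span (decomposables Z d)"
    proof (intro fv.span_neg fv.span_sum)
      fix e assume e: "e \<in> keys u - D"
      then have snd: "snd e < b' (fst e)" using snd_less[OF u(1)] by blast
      have "lookup (lookup u e) 0 = 0"
      proof (rule ccontr)
        assume "lookup (lookup u e) 0 \<noteq> 0"
        then have "fst e = d" using u(2) unfolding vhomogeneous_iff' by fastforce
        then have "e \<in> D"
          unfolding D_def using snd by (intro image_eqI[of _ _ "snd e"]) auto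
        with e show False by simp
      qed
      then show "vscale (lookup u e) (g (fst e) (snd e)) \<in> fv.span (decomposables Z d)"
        using u(2) by (intro vscale_in_span_decomposables[OF Z(2) gZ[OF snd]])
          (auto simp: vhomogeneous_iff)
    qed
    also have "\<dots> \<subseteq> fv.span (Q d)" using Q(2)[of d] by (rule fv.span_minimal) simp
    finally have "(\<Sum>l<b' d. kscale (c l) (g d l)) \<in> fv.span (Q d)" .
    \<comment> \<open>\<open>independent_Un_coeff_zero\<close> speaks of sets, so the coefficients
      are moved from indices to generators.\<close>
    moreover have "(\<Sum>x\<in>g d ` {..<b' d}. kscale (c (the_inv_into {..<b' d} (g d) x)) x) =
        (\<Sum>l<b' d. kscale (c l) (g d l))"
      using g(1)[of d] by (subst sum.reindex) (auto simp: the_inv_into_f_f)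
    ultimately have "c (the_inv_into {..<b' d} (g d) (g d l)) = 0"
      using l Q(3) g(2) g(3)
      by (intro fv.independent_Un_coeff_zero[of "Q d" "g d ` {..<b' d}"
            "\<lambda>x. c (the_inv_into {..<b' d} (g d) x)"]) auto
    then have "c l = 0" using g(1)[of d] l by (simp add: the_inv_into_f_f)
    then show ?thesis by (simp add: c_def u_def lookup_hcomp e)
  qed simp
  show ?thesis using that[OF lin im min] .
qed

text \<open>Minimal covers are iterated, each kernel being covered next. The start is the cover of
  the quotient by R, which is minimal because \<open>ne\<close> keeps 1 out of the ideal.\<close>

lemma minimal_resolution_exists:
  fixes \<Delta> :: "'n::finite set set"
  assumes dc: "down_closed \<Delta>" and ne: "{} \<in> \<Delta>"
  shows "\<exists>b \<epsilon> \<phi>. minimal_graded_free_resolution (SR \<Delta> :: ('n, 'k::field) pring set) b \<epsilon> \<phi>"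
proof -
  define b0 where "b0 j = (if j = 0 then 1 else 0 :: nat)" for j :: nat
  define \<epsilon> where "\<epsilon> v = lookup v (0, 0)" for v :: "('n, 'k) fvec"
  define Z0 where "Z0 = {v \<in> free_module b0. \<epsilon> v \<in> SR \<Delta>}"
  have lin0: "graded_linear_on (free_module b0) (*) homogeneous \<epsilon>"
    by (auto simp: graded_linear_on_def \<epsilon>_def lookup_add lookup_vscale vhomogeneous_iff homogeneous_def) force
  have gs0: "graded_submodule b0 Z0"
    unfolding graded_submodule_def vscale_subspace_def Z0_def
    by (auto simp: \<epsilon>_def SR_zero SR_add SR_mult[OF dc] lookup_add lookup_vscale free_module_add
        free_module_vscale free_module_hcomp mem_SR_iff[of "lookup (hcomp _ _) _"] lookup_hcomp)
       (auto simp: mem_SR_iff)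
  have min0: "lookup (lookup v e) 0 = 0" if "v \<in> Z0" for v e
  proof (cases "e = (0, 0)")
    case True
    then show ?thesis using that ne by (auto simp: Z0_def \<epsilon>_def mem_SR_iff)
  next
    case False
    then have "\<not> snd e < b0 (fst e)" by (cases e) (auto simp: b0_def)
    then have "lookup v e = 0"
      using that by (cases e) (auto simp: Z0_def mem_free_module_iff)
    then show ?thesis by simp
  qed
  \<comment> \<open>A state pairs the ranks of the current free module with the submodule still to
    be covered; the absence of constant coefficients is minimality.\<close>
  define P where "P s \<longleftrightarrow> graded_submodule (fst s) (snd s) \<and>
      (\<forall>v\<in>snd s. \<forall>e. lookup (lookup v e) 0 = 0)"
    for s :: "(nat \<Rightarrow> nat) \<times> ('n, 'k) fvec set"
  define R where "R s s' \<longleftrightarrow> (\<exists>\<phi>. graded_linear_on (free_module (fst s')) vscale vhomogeneous \<phi> \<and>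
      \<phi> ` free_module (fst s') = snd s \<and> snd s' = {v \<in> free_module (fst s'). \<phi> v = 0})"
    for s s' :: "(nat \<Rightarrow> nat) \<times> ('n, 'k) fvec set"
  have step: "\<exists>s'. P s' \<and> R s s'" if "P s" for s
  proof -
    from that have "graded_submodule (fst s) (snd s)" by (simp add: P_def)
    then obtain b' \<phi> where \<phi>: "graded_linear_on (free_module b') vscale vhomogeneous \<phi>"
      "\<phi> ` free_module b' = snd s"
      "\<And>v e. v \<in> free_module b' \<Longrightarrow> \<phi> v = 0 \<Longrightarrow> lookup (lookup v e) 0 = 0"
      by (rule minimal_cover_exists) blast
    define s' where "s' = (b', {v \<in> free_module b'. \<phi> v = 0})"
    have "P s'" using \<phi>(3) graded_submodule_kernel[OF \<phi>(1)] by (auto simp: P_def s'_def)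
    moreover have "R s s'" using \<phi> by (auto simp: R_def s'_def)
    ultimately show ?thesis by blast
  qed
  have "P (b0, Z0)" using gs0 min0 by (simp add: P_def)
  define S where "S = rec_nat (b0, Z0) (\<lambda>_ s. SOME s'. P s' \<and> R s s')"
  have S0: "S 0 = (b0, Z0)" and SS: "\<And>n. S (Suc n) = (SOME s'. P s' \<and> R (S n) s')"
    by (simp_all add: S_def)
  have PS: "P (S n)" for n
  proof (induction n)
    case 0
    then show ?case using \<open>P (b0, Z0)\<close> by (simp add: S0)
  next
    case (Suc n)
    show ?case using someI_ex[OF step[OF Suc]] by (simp add: SS)
  qed
  have RS: "R (S n) (S (Suc n))" for n
    using someI_ex[OF step[OF PS]] by (simp add: SS)
  define b where "b n = fst (S n)" for n
  define Z where "Z n = snd (S n)" for n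
  \<comment> \<open>States do not record the covering maps, which are therefore chosen
    afterwards.\<close>
  define T where "T n \<phi> \<longleftrightarrow> graded_linear_on (free_module (b (Suc n))) vscale vhomogeneous \<phi> \<and>
      \<phi> ` free_module (b (Suc n)) = Z n \<and> Z (Suc n) = {v \<in> free_module (b (Suc n)). \<phi> v = 0}" for n \<phi>
  have "\<forall>n. \<exists>\<phi>. T n \<phi>"
    using RS by (simp add: T_def R_def b_def Z_def)
  then obtain \<phi> where "\<And>n. T n (\<phi> n)" by metis
  then have \<phi>: "\<And>n. graded_linear_on (free_module (b (Suc n))) vscale vhomogeneous (\<phi> n)"
    "\<And>n. \<phi> n ` free_module (b (Suc n)) = Z n"
    "\<And>n. Z (Suc n) = {v \<in> free_module (b (Suc n)). \<phi> n v = 0}"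
    by (simp_all only: T_def)
  have b0: "b 0 = b0" and Z0: "Z 0 = Z0" by (simp_all add: b_def Z_def S0)
  have "\<exists>v\<in>free_module b0. p - \<epsilon> v \<in> SR \<Delta>" for p
    by (rule bexI[of _ "single (0, 0) p"]) (simp_all add: \<epsilon>_def SR_zero free_module_single b0_def)
  then have "graded_free_resolution (SR \<Delta>) b \<epsilon> \<phi>"
    using lin0 \<phi>(1) \<phi>(2)[of 0] \<phi>(2)[of "Suc _"]
    unfolding graded_free_resolution_def \<phi>(3) b0 Z0 Z0_def One_nat_def by blast
  moreover have "lookup (lookup (\<phi> i v) e) 0 = 0" if "v \<in> free_module (b (Suc i))" for i v e
  proof -
    have "\<phi> i v \<in> Z i" using \<phi>(2) that by blast
    then show ?thesis using PS[of i] by (simp add: P_def Z_def)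
  qed
  ultimately show ?thesis
    unfolding minimal_graded_free_resolution_def by blast
qed

lemma minimal_resolution_betti:
  fixes \<Delta> :: "'n::finite set set"
  assumes "down_closed \<Delta>" "{} \<in> \<Delta>"
  obtains \<epsilon> \<phi> where "minimal_graded_free_resolution (SR \<Delta> :: ('n, 'k::field) pring set) (betti (SR \<Delta> :: ('n, 'k) pring set)) \<epsilon> \<phi>"
proof -
  have "\<exists>\<epsilon> \<phi>. minimal_graded_free_resolution (SR \<Delta> :: ('n, 'k) pring set) (betti (SR \<Delta> :: ('n, 'k) pring set)) \<epsilon> \<phi>"
    unfolding betti_def by (rule someI_ex[OF minimal_resolution_exists[OF assms]])
  then show ?thesis using that by blast
qed

section \<open>Hilbert functions\<close>

definition std_monomials :: "'n::finite set set \<Rightarrow> nat \<Rightarrow> ('n \<Rightarrow>\<^sub>0 nat) set" where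
  "std_monomials \<Delta> d = {m. mdeg m = d \<and> keys m \<in> \<Delta>}"

lemma finite_std_monomials: "finite (std_monomials \<Delta> d)"
  by (rule finite_subset[OF _ finite_mdeg[of d]]) (auto simp: std_monomials_def)

definition pscale :: "'k \<Rightarrow> ('n::finite, 'k::field) pring \<Rightarrow> ('n, 'k) pring" where
  "pscale c p = const c * p"

lemma lookup_pscale: "lookup (pscale c p) m = c * lookup p m"
  by (simp add: pscale_def lookup_const_mult)

interpretation pv: vector_space "pscale :: 'k::field \<Rightarrow> ('n::finite, 'k) pring \<Rightarrow> _"
  by standard (auto intro!: poly_mapping_eqI simp: lookup_pscale lookup_add algebra_simps)

text \<open>The K-linear projection onto standard monomials, with kernel \<open>SR \<Delta>\<close>;
  it realises the quotient as a subspace of R, where dimensions can be taken.\<close>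

definition normal_form :: "'n::finite set set \<Rightarrow> ('n, 'k::field) pring \<Rightarrow> ('n, 'k) pring" where
  "normal_form \<Delta> = restrict_keys (\<lambda>m. keys m \<in> \<Delta>)"

lemma lookup_normal_form: "lookup (normal_form \<Delta> p) m = (if keys m \<in> \<Delta> then lookup p m else 0)"
  by (simp add: normal_form_def lookup_restrict_keys)

lemma diff_in_SR_iff: "p - q \<in> SR \<Delta> \<longleftrightarrow> normal_form \<Delta> p = normal_form \<Delta> q"
  by (auto simp: mem_SR_iff lookup_minus lookup_normal_form poly_mapping_eq_iff fun_eq_iff)

lemma normal_form_eq_0_iff: "normal_form \<Delta> p = 0 \<longleftrightarrow> p \<in> SR \<Delta>"
  by (auto simp: mem_SR_iff lookup_normal_form poly_mapping_eq_iff fun_eq_iff)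

lemma normal_form_add: "normal_form \<Delta> (p + q) = normal_form \<Delta> p + normal_form \<Delta> q"
  by (rule poly_mapping_eqI) (simp add: lookup_normal_form lookup_add)

lemma normal_form_pscale: "normal_form \<Delta> (pscale c p) = pscale c (normal_form \<Delta> p)"
  by (rule poly_mapping_eqI) (simp add: lookup_normal_form lookup_pscale)

lemma normal_form_sum_pscale: "normal_form \<Delta> (\<Sum>x\<in>S. const (c x) * f x) = (\<Sum>x\<in>S. pscale (c x) (normal_form \<Delta> (f x)))"
  by (rule poly_mapping_eqI) (simp add: lookup_normal_form lookup_sum lookup_pscale lookup_const_mult)

lemma homogeneous_zero: "homogeneous d 0"
  by (simp add: homogeneous_def)

lemma homogeneous_add:
  assumes "homogeneous d p" "homogeneous d q"
  shows "homogeneous d (p + q)"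
proof -
  have "keys (p + q) \<subseteq> keys p \<union> keys q" by (auto simp: in_keys_iff lookup_add)
  with assms show ?thesis by (auto simp: homogeneous_def)
qed

lemma homogeneous_pscale: "homogeneous d p \<Longrightarrow> homogeneous d (pscale c p)"
  by (auto simp: homogeneous_def in_keys_iff lookup_pscale)

definition std_span :: "'n::finite set set \<Rightarrow> nat \<Rightarrow> ('n, 'k::field) pring set" where
  "std_span \<Delta> d = pv.span ((\<lambda>m. single m 1) ` std_monomials \<Delta> d)"

lemma std_span_eq: "std_span \<Delta> d = {p. homogeneous d p \<and> normal_form \<Delta> p = p}"
proof (intro equalityI subsetI)
  fix p :: "('a, 'b) pring" assume p: "p \<in> std_span \<Delta> d"
  have "pv.subspace {p :: ('a, 'b) pring. homogeneous d p \<and> normal_form \<Delta> p = p}"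
    unfolding pv.subspace_def
    by (auto simp: normal_form_add normal_form_pscale normal_form_eq_0_iff SR_zero homogeneous_zero homogeneous_add homogeneous_pscale)
  moreover have "(\<lambda>m. single m 1) ` std_monomials \<Delta> d
      \<subseteq> {p :: ('a, 'b) pring. homogeneous d p \<and> normal_form \<Delta> p = p}"
    by (auto simp: std_monomials_def homogeneous_def lookup_normal_form lookup_single when_def
        intro!: poly_mapping_eqI)
  ultimately have "std_span \<Delta> d \<subseteq> {p :: ('a, 'b) pring. homogeneous d p \<and> normal_form \<Delta> p = p}"
    unfolding std_span_def by (rule pv.span_minimal[rotated])
  with p show "p \<in> {p. homogeneous d p \<and> normal_form \<Delta> p = p}" by blast
next
  fix p :: "('a, 'b) pring" assume p: "p \<in> {p. homogeneous d p \<and> normal_form \<Delta> p = p}"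
  have "single m (lookup p m) \<in> std_span \<Delta> d" if m: "m \<in> keys p" for m
  proof -
    have "lookup (normal_form \<Delta> p) m \<noteq> 0" using p m by (simp add: in_keys_iff)
    then have "keys m \<in> \<Delta>" by (auto simp: lookup_normal_form split: if_splits)
    then have "m \<in> std_monomials \<Delta> d" using p m by (auto simp: std_monomials_def homogeneous_def)
    moreover have "single m (lookup p m) = pscale (lookup p m) (single m 1)"
      by (simp add: pscale_def const_def mult_single)
    ultimately show ?thesis unfolding std_span_def by (simp add: pv.span_scale pv.span_base)
  qed
  then have "(\<Sum>m\<in>keys p. single m (lookup p m)) \<in> std_span \<Delta> d"
    unfolding std_span_def by (rule pv.span_sum)
  then show "p \<in> std_span \<Delta> d" by (simp add: sum_single_keys)
qed

lemma dim_std_span: "pv.dim (std_span \<Delta> d :: ('n::finite, 'k::field) pring set) = card (std_monomials \<Delta> d)"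
proof -
  have coeff: "r x = 0" if "(\<Sum>x\<in>std_monomials \<Delta> d. pscale (r x) (single x (1 :: 'k))) = 0"
    "x \<in> std_monomials \<Delta> d" for r x
  proof -
    have "lookup (\<Sum>x\<in>std_monomials \<Delta> d. pscale (r x) (single x (1 :: 'k))) x = r x"
      using that(2) by (simp add: lookup_sum lookup_pscale lookup_single when_def finite_std_monomials
        if_distrib cong: if_cong)
    then show ?thesis using that(1) by simp
  qed
  have inj: "inj_on (\<lambda>m. single m (1 :: 'k)) (std_monomials \<Delta> d)"
    and ind: "pv.independent ((\<lambda>m. single m (1 :: 'k)) ` std_monomials \<Delta> d)"
    using pv.independent_image[OF finite_std_monomials, where f = "\<lambda>m. single m (1 :: 'k)"] coeff
    by blast+
  show ?thesis
    unfolding std_span_def using pv.dim_span_eq_card_independent[OF ind] inj by (simp add: card_image)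
qed

text \<open>Normal forms carry a residue basis to a basis of \<open>std_span \<Delta> d\<close>, so
  its size is independent of the choice in \<open>hilbert_function\<close>.\<close>

lemma residue_basis_card:
  fixes B :: "('n::finite, 'k::field) pring set"
  assumes B: "residue_basis (SR \<Delta>) d B"
  shows "card B = card (std_monomials \<Delta> d)"
proof -
  have fin: "finite B" and hom: "\<And>b. b \<in> B \<Longrightarrow> homogeneous d b"
    and ex1: "\<And>p. homogeneous d p \<Longrightarrow>
        \<exists>!c. (\<forall>b. b \<notin> B \<longrightarrow> c b = 0) \<and> p - (\<Sum>b\<in>B. const (c b) * b) \<in> SR \<Delta>"
    using B unfolding residue_basis_def by blast+
  have coeff: "r x = 0" if r: "(\<Sum>b\<in>B. pscale (r b) (normal_form \<Delta> b)) = 0" and x: "x \<in> B" for r x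
  proof -
    \<comment> \<open>Uniqueness in \<open>residue_basis\<close> concerns functions vanishing off B,
      so r is cut down to B and compared with the zero function.\<close>
    define c where "c b = (if b \<in> B then r b else 0)" for b
    have "(\<Sum>b\<in>B. pscale (c b) (normal_form \<Delta> b)) = (\<Sum>b\<in>B. pscale (r b) (normal_form \<Delta> b))"
      by (intro sum.cong) (auto simp: c_def)
    with r have "0 - (\<Sum>b\<in>B. const (c b) * b) \<in> SR \<Delta>"
      by (simp only: diff_in_SR_iff normal_form_sum_pscale) (simp add: normal_form_eq_0_iff SR_zero)
    moreover have "(0 :: ('n, 'k) pring) - (\<Sum>b\<in>B. const 0 * b) \<in> SR \<Delta>"
      by (simp add: const_def SR_zero)
    moreover have "homogeneous d (0 :: ('n, 'k) pring)" by (simp add: homogeneous_def)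
    ultimately have "c = (\<lambda>_. 0)" using ex1[of 0] by (auto simp: c_def)
    then show ?thesis using x by (metis c_def)
  qed
  have inj: "inj_on (normal_form \<Delta>) B" and ind: "pv.independent (normal_form \<Delta> ` B)"
    using pv.independent_image[OF fin, where f = "normal_form \<Delta>"] coeff by blast+
  have "normal_form \<Delta> ` B \<subseteq> std_span \<Delta> d"
    using hom by (auto simp: std_span_eq homogeneous_def in_keys_iff lookup_normal_form
        intro!: poly_mapping_eqI split: if_splits)
  moreover have "std_span \<Delta> d \<subseteq> pv.span (normal_form \<Delta> ` B)"
  proof
    fix p :: "('n, 'k) pring" assume "p \<in> std_span \<Delta> d"
    then have p: "homogeneous d p" "normal_form \<Delta> p = p" by (auto simp: std_span_eq)
    obtain c where "p - (\<Sum>b\<in>B. const (c b) * b) \<in> SR \<Delta>" using ex1[OF p(1)] by blast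
    then have "p = (\<Sum>b\<in>B. pscale (c b) (normal_form \<Delta> b))"
      using p(2) by (simp add: diff_in_SR_iff normal_form_sum_pscale)
    also have "\<dots> \<in> pv.span (normal_form \<Delta> ` B)"
      by (intro pv.span_sum pv.span_scale pv.span_base) auto
    finally show "p \<in> pv.span (normal_form \<Delta> ` B)" .
  qed
  ultimately have "pv.dim (std_span \<Delta> d :: ('n, 'k) pring set) = card (normal_form \<Delta> ` B)"
    using ind by (intro pv.dim_unique) auto
  then show ?thesis by (simp add: dim_std_span card_image[OF inj])
qed

lemma residue_basis_monomials:
  "residue_basis (SR \<Delta> :: ('n::finite, 'k::field) pring set) d ((\<lambda>m. single m 1) ` std_monomials \<Delta> d)"
  unfolding residue_basis_def
proof (intro conjI ballI allI impI)
  let ?s = "\<lambda>m. single m 1 :: ('n, 'k) pring"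
  have inj: "inj_on ?s (std_monomials \<Delta> d)"
    by (rule inj_onI) (metis keys_single zero_neq_one singleton_inject)
  show "finite (?s ` std_monomials \<Delta> d)" by (simp add: finite_std_monomials)
  show "homogeneous d b" if "b \<in> ?s ` std_monomials \<Delta> d" for b
    using that by (auto simp: homogeneous_def std_monomials_def)
  fix p :: "('n, 'k) pring" assume p: "homogeneous d p"
  have look: "lookup (\<Sum>b\<in>?s ` std_monomials \<Delta> d. const (c b) * b) m =
      (if m \<in> std_monomials \<Delta> d then c (?s m) else 0)" for c m
  proof -
    have "lookup (\<Sum>b\<in>?s ` std_monomials \<Delta> d. const (c b) * b) m =
        (\<Sum>m'\<in>std_monomials \<Delta> d. if m' = m then c (?s m') else 0)"
      by (auto simp: sum.reindex[OF inj] lookup_sum lookup_const_mult lookup_single when_def intro!: sum.cong)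
    then show ?thesis by (simp add: finite_std_monomials)
  qed
  have iff: "p - (\<Sum>b\<in>?s ` std_monomials \<Delta> d. const (c b) * b) \<in> SR \<Delta> \<longleftrightarrow>
      (\<forall>m\<in>std_monomials \<Delta> d. c (?s m) = lookup p m)" for c
  proof
    assume L: "p - (\<Sum>b\<in>?s ` std_monomials \<Delta> d. const (c b) * b) \<in> SR \<Delta>"
    show "\<forall>m\<in>std_monomials \<Delta> d. c (?s m) = lookup p m"
    proof
      fix m assume m: "m \<in> std_monomials \<Delta> d"
      then have "keys m \<in> \<Delta>" by (simp add: std_monomials_def)
      then have "lookup (p - (\<Sum>b\<in>?s ` std_monomials \<Delta> d. const (c b) * b)) m = 0"
        using L unfolding mem_SR_iff by blast
      then show "c (?s m) = lookup p m" using m by (simp add: lookup_minus look)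
    qed
  next
    assume R: "\<forall>m\<in>std_monomials \<Delta> d. c (?s m) = lookup p m"
    have "lookup p m = 0" if "keys m \<in> \<Delta>" "m \<notin> std_monomials \<Delta> d" for m
      using that p by (auto simp: std_monomials_def homogeneous_def in_keys_iff)
    with R show "p - (\<Sum>b\<in>?s ` std_monomials \<Delta> d. const (c b) * b) \<in> SR \<Delta>"
      unfolding mem_SR_iff by (simp add: lookup_minus look)
  qed
  define c0 where "c0 b = (if b \<in> ?s ` std_monomials \<Delta> d then lookup p (THE m. b = ?s m) else 0)" for b
  have the: "(THE m'. ?s m = ?s m') = m" for m
    by (rule the_equality) (auto, metis keys_single zero_neq_one singleton_inject)
  show "\<exists>!c. (\<forall>b. b \<notin> ?s ` std_monomials \<Delta> d \<longrightarrow> c b = 0) \<and>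
      p - (\<Sum>b\<in>?s ` std_monomials \<Delta> d. const (c b) * b) \<in> SR \<Delta>"
  proof (rule ex1I[of _ c0])
    show "(\<forall>b. b \<notin> ?s ` std_monomials \<Delta> d \<longrightarrow> c0 b = 0) \<and>
        p - (\<Sum>b\<in>?s ` std_monomials \<Delta> d. const (c0 b) * b) \<in> SR \<Delta>"
      unfolding iff by (simp add: c0_def the)
  next
    fix c assume c: "(\<forall>b. b \<notin> ?s ` std_monomials \<Delta> d \<longrightarrow> c b = 0) \<and>
        p - (\<Sum>b\<in>?s ` std_monomials \<Delta> d. const (c b) * b) \<in> SR \<Delta>"
    show "c = c0"
    proof
      fix b show "c b = c0 b"
        using c unfolding iff by (cases "b \<in> ?s ` std_monomials \<Delta> d") (auto simp: c0_def the)
    qed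
  qed
qed

lemma hilbert_function_SR:
  "hilbert_function (SR \<Delta> :: ('n::finite, 'k::field) pring set) d = card (std_monomials \<Delta> d)"
  unfolding hilbert_function_def
  by (rule residue_basis_card, rule someI, rule residue_basis_monomials)

section \<open>Euler characteristics\<close>

definition monomials_count :: "'n::finite itself \<Rightarrow> nat \<Rightarrow> nat" where
  "monomials_count _ d = card {m :: 'n \<Rightarrow>\<^sub>0 nat. mdeg m = d}"

lemma monomials_count_0: "monomials_count TYPE('n::finite) 0 = 1"
  by (simp add: monomials_count_def mdeg_eq_0_iff)

lemma dim_free_module:
  "fv.dim (degree_part (free_module b :: ('n::finite, 'k::field) fvec set) d) =
     (\<Sum>j\<le>d. b j * monomials_count TYPE('n) (d - j))"
proof -
  let ?f = "\<lambda>(e, m). single e (single m 1) :: ('n, 'k) fvec"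
  let ?I = "monomial_indices b d :: ((nat \<times> nat) \<times> ('n \<Rightarrow>\<^sub>0 nat)) set"
  have coeff: "r x = 0" if r: "(\<Sum>x\<in>?I. kscale (r x) (?f x)) = 0" and x: "x \<in> ?I" for r x
  proof -
    obtain e m where em: "x = (e, m)" by fastforce
    have "lookup (lookup (\<Sum>x\<in>?I. kscale (r x) (?f x)) e) m = (\<Sum>y\<in>?I. if y = x then r y else 0)"
      unfolding lookup_sum
      by (rule sum.cong) (auto simp: em lookup_kscale lookup_single when_def split: if_splits)
    also have "\<dots> = r x" using x by (simp add: finite_monomial_indices)
    finally show ?thesis using r by simp
  qed
  have inj: "inj_on ?f ?I" and ind: "fv.independent (?f ` ?I)"
    using fv.independent_image[OF finite_monomial_indices, where f = ?f] coeff by blast+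
  have "?f ` ?I \<subseteq> degree_part (free_module b) d"
    by (auto simp: monomial_indices_def degree_part_def free_module_single vhomogeneous_iff'
        lookup_single when_def split: if_splits)
  then have "fv.dim (degree_part (free_module b :: ('n, 'k) fvec set) d) = card (?f ` ?I)"
    using ind degree_part_subset_span[OF subset_refl, of b d]
    by (intro fv.dim_unique) (auto simp: monomial_vectors_def)
  also have "\<dots> = card ?I" using inj by (rule card_image)
  also have "\<dots> = (\<Sum>e\<in>(SIGMA j:{..d}. {..<b j}). monomials_count TYPE('n) (d - fst e))"
    unfolding monomial_indices_Sigma monomials_count_def
    by (rule card_SigmaI) (auto simp: finite_mdeg)
  also have "\<dots> = (\<Sum>j\<le>d. \<Sum>l<b j. monomials_count TYPE('n) (d - j))"
    by (subst sum.Sigma) (auto simp: case_prod_beta)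
  finally show ?thesis by simp
qed

lemma subspace_free_module: "module.subspace vscale (free_module b)"
  by (auto simp: vscale_subspace_def free_module_add free_module_vscale)

lemma subspace_degree_part_free_module: "fv.subspace (degree_part (free_module b) d)"
  by (rule subspace_degree_part[OF subspace_free_module])

lemma degree_part_free_module_subset_span:
  "degree_part (free_module b) d \<subseteq> fv.span (monomial_vectors b d)"
  by (rule degree_part_subset_span[OF subset_refl])

lemma rank_nullity_degree_part:
  fixes \<phi> :: "('n::finite, 'k::field) fvec \<Rightarrow> ('n, 'k) fvec"
  assumes lin: "graded_linear_on (free_module b) vscale vhomogeneous \<phi>"
  shows "fv.dim (degree_part (free_module b :: ('n, 'k) fvec set) d) =
    fv.dim (degree_part (\<phi> ` free_module b) d) + fv.dim (degree_part {v \<in> free_module b. \<phi> v = 0} d)"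
proof -
  \<comment> \<open>A homogeneous element of the image has a homogeneous preimage, namely the
    component \<open>hcomp d\<close> of any preimage.\<close>
  have "\<phi> ` degree_part (free_module b) d = degree_part (\<phi> ` free_module b) d"
  proof
    show "\<phi> ` degree_part (free_module b) d \<subseteq> degree_part (\<phi> ` free_module b) d"
      using graded_linear_hom[OF lin] by (auto simp: degree_part_def)
    show "degree_part (\<phi> ` free_module b) d \<subseteq> \<phi> ` degree_part (free_module b) d"
    proof
      fix z assume "z \<in> degree_part (\<phi> ` free_module b) d"
      then obtain v where v: "v \<in> free_module b" "z = \<phi> v" "vhomogeneous d z" by (auto simp: degree_part_def)
      then have "\<phi> (hcomp d v) = z"
        using graded_linear_hcomp[OF lin v(1), of d] by (simp add: hcomp_vhomogeneous)
      then show "z \<in> \<phi> ` degree_part (free_module b) d"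
        using v(1) by (auto simp: degree_part_def free_module_hcomp vhomogeneous_hcomp intro!: image_eqI[of _ _ "hcomp d v"])
    qed
  qed
  moreover have "{v \<in> degree_part (free_module b) d. \<phi> v = 0} = degree_part {v \<in> free_module b. \<phi> v = 0} d"
    by (auto simp: degree_part_def)
  moreover have "fv.dim (degree_part (free_module b :: ('n, 'k) fvec set) d) = fv.dim (\<phi> ` degree_part (free_module b) d) +
      fv.dim {v \<in> degree_part (free_module b) d. \<phi> v = 0}"
    by (rule rank_nullity[OF fv.vector_space_axioms fv.vector_space_axioms
          subspace_degree_part_free_module degree_part_free_module_subset_span finite_monomial_vectors])
       (auto simp: degree_part_def kscale_def graded_linear_add[OF lin] graded_linear_scale[OF lin])
  ultimately show ?thesis by simp
qed

lemma rank_nullity_augmentation: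
  fixes \<epsilon> :: "('n::finite, 'k::field) fvec \<Rightarrow> ('n, 'k) pring"
  assumes lin: "graded_linear_on (free_module b) (*) homogeneous \<epsilon>"
    and surj: "\<And>p. \<exists>v\<in>free_module b. p - \<epsilon> v \<in> SR \<Delta>"
  shows "fv.dim (degree_part (free_module b :: ('n, 'k) fvec set) d) =
    card (std_monomials \<Delta> d) + fv.dim (degree_part {v \<in> free_module b. \<epsilon> v \<in> SR \<Delta>} d)"
proof -
  define f where "f v = normal_form \<Delta> (\<epsilon> v)" for v
  have hom: "homogeneous d (\<epsilon> v)" if "v \<in> free_module b" "vhomogeneous d v" for v d
    using graded_linear_hom[OF lin that] .
  \<comment> \<open>The counterpart of \<open>graded_linear_hcomp\<close> for the target R.\<close>
  have comp: "lookup (\<epsilon> (hcomp (mdeg m) v)) m = lookup (\<epsilon> v) m" if v: "v \<in> free_module b" for v m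
  proof -
    define D where "D = insert (mdeg m) (vdegs v)"
    have D: "finite D" "mdeg m \<in> D" by (simp_all add: D_def finite_vdegs)
    have "\<epsilon> v = \<epsilon> (\<Sum>d\<in>D. hcomp d v)"
      by (subst sum_hcomp) (auto simp: D_def finite_vdegs)
    also have "\<dots> = (\<Sum>d\<in>D. \<epsilon> (hcomp d v))"
      using v by (intro graded_linear_sum[OF lin] free_module_hcomp)
    finally have "lookup (\<epsilon> v) m = (\<Sum>d\<in>D. lookup (\<epsilon> (hcomp d v)) m)" by (simp add: lookup_sum)
    also have "\<dots> = (\<Sum>d\<in>D. if d = mdeg m then lookup (\<epsilon> (hcomp d v)) m else 0)"
    proof (rule sum.cong)
      fix d' show "lookup (\<epsilon> (hcomp d' v)) m = (if d' = mdeg m then lookup (\<epsilon> (hcomp d' v)) m else 0)"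
        using hom[OF free_module_hcomp[OF v] vhomogeneous_hcomp, of d'] by (auto simp: homogeneous_def in_keys_iff)
    qed simp
    also have "\<dots> = lookup (\<epsilon> (hcomp (mdeg m) v)) m" using D by simp
    finally show ?thesis by simp
  qed
  have "f ` degree_part (free_module b) d = std_span \<Delta> d"
  proof
    show "f ` degree_part (free_module b) d \<subseteq> std_span \<Delta> d"
    proof (rule image_subsetI)
      fix v :: "('n, 'k) fvec" assume "v \<in> degree_part (free_module b) d"
      then have "homogeneous d (\<epsilon> v)" using hom by (simp add: degree_part_def)
      then show "f v \<in> std_span \<Delta> d"
        by (auto simp: std_span_eq f_def homogeneous_def in_keys_iff lookup_normal_form
          intro!: poly_mapping_eqI split: if_splits)
    qed
    show "std_span \<Delta> d \<subseteq> f ` degree_part (free_module b) d"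
    proof
      fix w :: "('n, 'k) pring" assume "w \<in> std_span \<Delta> d"
      then have w: "homogeneous d w" "normal_form \<Delta> w = w" by (auto simp: std_span_eq)
      obtain v where v: "v \<in> free_module b" "w - \<epsilon> v \<in> SR \<Delta>" using surj by blast
      have "w = f (hcomp d v)"
      proof (rule poly_mapping_eqI)
        fix m
        show "lookup w m = lookup (f (hcomp d v)) m"
        proof (cases "keys m \<in> \<Delta>")
          case False
          have "lookup (normal_form \<Delta> w) m = 0" using False by (simp add: lookup_normal_form)
          then show ?thesis using False w(2) by (simp add: f_def lookup_normal_form)
        next
          case True
          show ?thesis
          proof (cases "mdeg m = d")
            case d: True
            have "lookup w m = lookup (\<epsilon> v) m" using v(2) True by (simp add: mem_SR_iff lookup_minus)
            also have "\<dots> = lookup (f (hcomp d v)) m" using comp[OF v(1), of m] d True by (simp add: f_def lookup_normal_form)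
            finally show ?thesis .
          next
            case d: False
            then have "lookup w m = 0" "lookup (\<epsilon> (hcomp d v)) m = 0"
              using w(1) hom[OF free_module_hcomp[OF v(1)] vhomogeneous_hcomp, of d]
              by (auto simp: homogeneous_def in_keys_iff)
            then show ?thesis by (simp add: f_def lookup_normal_form)
          qed
        qed
      qed
      then show "w \<in> f ` degree_part (free_module b) d"
        using v(1) by (auto simp: degree_part_def free_module_hcomp vhomogeneous_hcomp)
    qed
  qed
  moreover have "{v \<in> degree_part (free_module b) d. f v = 0} = degree_part {v \<in> free_module b. \<epsilon> v \<in> SR \<Delta>} d"
    by (auto simp: degree_part_def f_def normal_form_eq_0_iff)
  moreover have "fv.dim (degree_part (free_module b :: ('n, 'k) fvec set) d) = pv.dim (f ` degree_part (free_module b) d) +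
      fv.dim {v \<in> degree_part (free_module b) d. f v = 0}"
    by (rule rank_nullity[OF fv.vector_space_axioms pv.vector_space_axioms
          subspace_degree_part_free_module degree_part_free_module_subset_span finite_monomial_vectors])
       (auto simp: degree_part_def kscale_def f_def graded_linear_add[OF lin] graded_linear_scale[OF lin]
          normal_form_add normal_form_pscale[unfolded pscale_def] pscale_def)
  ultimately show ?thesis by (simp add: dim_std_span)
qed

text \<open>In terms of series: the Hilbert series of the quotient is that of R times the series of
  alternating Betti sums.\<close>

lemma euler_characteristic:
  fixes \<epsilon> :: "('n::finite, 'k::field) fvec \<Rightarrow> ('n, 'k) pring"
  assumes res: "graded_free_resolution (SR \<Delta>) b \<epsilon> \<phi>"
    and low: "\<And>i j. j < i \<Longrightarrow> b i j = 0"
  shows "(\<Sum>j\<le>d. (\<Sum>i\<le>j. (- 1) ^ i * int (b i j)) * int (monomials_count TYPE('n) (d - j))) =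
    int (card (std_monomials \<Delta> d))"
proof -
  have lin0: "graded_linear_on (free_module (b 0)) (*) homogeneous \<epsilon>"
    and lin: "\<And>i. graded_linear_on (free_module (b (Suc i))) vscale vhomogeneous (\<phi> i)"
    and surj: "\<And>p. \<exists>v\<in>free_module (b 0). p - \<epsilon> v \<in> SR \<Delta>"
    and im0: "{v \<in> free_module (b 0). \<epsilon> v \<in> SR \<Delta>} = \<phi> 0 ` free_module (b (Suc 0))"
    and im: "\<And>i. {v \<in> free_module (b (Suc i)). \<phi> i v = 0} = \<phi> (Suc i) ` free_module (b (Suc (Suc i)))"
    using res unfolding graded_free_resolution_def by simp_all
  define F where "F i = fv.dim (degree_part (free_module (b i) :: ('n, 'k) fvec set) d)" for i
  define z where "z i = fv.dim (degree_part (\<phi> i ` free_module (b (Suc i))) d)" for i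
  have F: "F i = (\<Sum>j\<le>d. b i j * monomials_count TYPE('n) (d - j))" for i
    by (simp add: F_def dim_free_module)
  have F0: "F 0 = card (std_monomials \<Delta> d) + z 0"
    using rank_nullity_augmentation[OF lin0 surj, of d] by (simp add: F_def z_def im0)
  have FS: "F (Suc i) = z i + z (Suc i)" for i
    using rank_nullity_degree_part[OF lin, of i d] by (simp add: F_def z_def im)
  \<comment> \<open>Telescoping along the short exact sequences of syzygies. The remainder vanishes
    at N = d, as by \<open>low\<close> the next free module starts in degree d + 1.\<close>
  have tele: "(\<Sum>i\<le>N. (- 1) ^ i * int (F i)) = int (card (std_monomials \<Delta> d)) + (- 1) ^ N * int (z N)" for N
    by (induction N) (simp_all add: F0 FS algebra_simps)
  have "F (Suc d) = 0" by (simp add: F low)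
  then have "z d = 0" using FS[of d] by simp
  with tele[of d] have "int (card (std_monomials \<Delta> d)) = (\<Sum>i\<le>d. (- 1) ^ i * int (F i))" by simp
  also have "\<dots> = (\<Sum>i\<le>d. \<Sum>j\<le>d. (- 1) ^ i * int (b i j) * int (monomials_count TYPE('n) (d - j)))"
    by (simp add: F sum_distrib_left mult.assoc)
  also have "\<dots> = (\<Sum>j\<le>d. (\<Sum>i\<le>d. (- 1) ^ i * int (b i j)) * int (monomials_count TYPE('n) (d - j)))"
    by (subst sum.swap) (simp add: sum_distrib_right)
  also have "\<dots> = (\<Sum>j\<le>d. (\<Sum>i\<le>j. (- 1) ^ i * int (b i j)) * int (monomials_count TYPE('n) (d - j)))"
  proof (rule sum.cong)
    fix j assume "j \<in> {..d}"
    then have "(\<Sum>i\<le>d. (- 1) ^ i * int (b i j)) = (\<Sum>i\<le>j. (- 1) ^ i * int (b i j))"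
      by (intro sum.mono_neutral_right) (auto simp: low)
    then show "(\<Sum>i\<le>d. (- 1) ^ i * int (b i j)) * int (monomials_count TYPE('n) (d - j)) =
        (\<Sum>i\<le>j. (- 1) ^ i * int (b i j)) * int (monomials_count TYPE('n) (d - j))" by simp
  qed simp
  finally show ?thesis by simp
qed

text \<open>A power series with constant term 1 can be cancelled; this recovers the alternating
  Betti sums from the Hilbert function.\<close>

lemma convolution_inject:
  fixes x y :: "nat \<Rightarrow> int"
  assumes "h 0 = 1" and eq: "\<And>d. (\<Sum>j\<le>d. x j * h (d - j)) = (\<Sum>j\<le>d. y j * h (d - j))"
  shows "x d = y d"
proof (induction d rule: less_induct)
  case (less d)
  have split: "(\<Sum>j\<le>d. w j * h (d - j)) = (\<Sum>j<d. w j * h (d - j)) + w d" for w :: "nat \<Rightarrow> int"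
    using assms(1) by (simp flip: lessThan_Suc_atMost)
  have "(\<Sum>j<d. x j * h (d - j)) = (\<Sum>j<d. y j * h (d - j))"
    using less by (intro sum.cong) auto
  then show ?case using eq[of d] by (simp add: split)
qed

section \<open>Hilbert functions of graphs\<close>

definition monomials_supported :: "nat \<Rightarrow> 'n::finite set \<Rightarrow> ('n \<Rightarrow>\<^sub>0 nat) set" where
  "monomials_supported d F = {m. mdeg m = d \<and> keys m = F}"

lemma finite_monomials_supported: "finite (monomials_supported d F)"
  by (rule finite_subset[OF _ finite_mdeg[of d]]) (auto simp: monomials_supported_def)

lemma card_std_monomials: "card (std_monomials \<Delta> d) = (\<Sum>F\<in>\<Delta>. card (monomials_supported d F))"
proof -
  have "std_monomials \<Delta> d = (\<Union>F\<in>\<Delta>. monomials_supported d F)"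
    by (auto simp: std_monomials_def monomials_supported_def)
  then show ?thesis
    using finite_monomials_supported
    by (simp only:) (intro card_UN_disjoint, auto simp: monomials_supported_def)
qed

lemma card_monomials_supported_empty:
  "card (monomials_supported d ({} :: 'n::finite set)) = (if d = 0 then 1 else 0)"
proof -
  have "monomials_supported d ({} :: 'n set) = (if d = 0 then {0} else {})"
    by (auto simp: monomials_supported_def keys_eq_empty_iff)
  then show ?thesis by simp
qed

lemma card_monomials_supported_large: "d < card F \<Longrightarrow> card (monomials_supported d F) = 0"
proof -
  assume "d < card F"
  then have "monomials_supported d F = {}"
    using card_keys_le_mdeg by (force simp: monomials_supported_def not_less[symmetric])
  then show ?thesis by simp
qed

lemma card_monomials_supported_same: "card F = d \<Longrightarrow> card (monomials_supported d F) \<ge> 1"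
proof -
  assume "card F = d"
  then have "ind F \<in> monomials_supported d F" by (simp add: monomials_supported_def)
  then show ?thesis using finite_monomials_supported[of d F]
    by (metis One_nat_def Suc_leI card_gt_0_iff empty_iff)
qed

lemma mdeg_keys: "mdeg m = (\<Sum>x\<in>keys m. lookup m x)"
  unfolding mdeg_def by (rule sum.mono_neutral_right) (auto simp: in_keys_iff)

lemma card_monomials_supported_1:
  assumes "d \<ge> 1"
  shows "card (monomials_supported d {v}) = 1"
proof -
  have "monomials_supported d {v} = {single v d}"
  proof (intro equalityI subsetI)
    fix m assume m: "m \<in> monomials_supported d {v}"
    then have k: "keys m = {v}" and "lookup m v = d"
      using mdeg_keys[of m] by (auto simp: monomials_supported_def)
    moreover have "lookup m x = 0" if "x \<noteq> v" for x
      using k that by (metis in_keys_iff singletonD)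
    ultimately show "m \<in> {single v d}"
      by (auto simp: lookup_single when_def intro!: poly_mapping_eqI)
  next
    fix m assume "m \<in> {single v d}"
    then show "m \<in> monomials_supported d {v}"
      using assms mdeg_keys[of m] by (simp add: monomials_supported_def)
  qed
  then show ?thesis by simp
qed

lemma card_monomials_supported_2:
  assumes "v \<noteq> w"
  shows "card (monomials_supported d {v, w}) = d - 1"
proof -
  have "bij_betw (\<lambda>m. lookup m v) (monomials_supported d {v, w}) {1..<d}"
  proof (rule bij_betwI[where g = "\<lambda>a. single v a + single w (d - a)"])
    show "(\<lambda>m. lookup m v) \<in> monomials_supported d {v, w} \<rightarrow> {1..<d}"
    proof
      fix m assume m: "m \<in> monomials_supported d {v, w}"
      then have k: "keys m = {v, w}" "mdeg m = d" by (simp_all add: monomials_supported_def)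
      then have "lookup m v + lookup m w = d"
        using mdeg_keys[of m] assms by simp
      moreover have "v \<in> keys m" "w \<in> keys m" using k by simp_all
      then have "lookup m v \<noteq> 0" "lookup m w \<noteq> 0"
        by (simp_all only: in_keys_iff not_False_eq_True)
      ultimately show "lookup m v \<in> {1..<d}" by auto
    qed
    show "(\<lambda>a. single v a + single w (d - a)) \<in> {1..<d} \<rightarrow> monomials_supported d {v, w}"
    proof
      fix a assume a: "a \<in> {1..<d}"
      have k: "keys (single v a + single w (d - a)) = {v, w}"
        using a by (auto simp: keys_add_nat)
      moreover have "mdeg (single v a + single w (d - a)) = d"
        using a assms by (simp add: mdeg_keys k lookup_add lookup_single when_def)
      ultimately show "single v a + single w (d - a) \<in> monomials_supported d {v, w}"
        by (simp add: monomials_supported_def)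
    qed
    show "single v (lookup m v) + single w (d - lookup m v) = m" if m: "m \<in> monomials_supported d {v, w}" for m
    proof (rule poly_mapping_eqI)
      fix x
      have "keys m = {v, w}" "mdeg m = d" using m by (simp_all add: monomials_supported_def)
      then have "lookup m v + lookup m w = d"
        using mdeg_keys[of m] assms by simp
      moreover have "x \<noteq> v \<Longrightarrow> x \<noteq> w \<Longrightarrow> lookup m x = 0"
        using m by (auto simp: monomials_supported_def simp flip: not_in_keys_iff_lookup_eq_zero)
      ultimately show "lookup (single v (lookup m v) + single w (d - lookup m v)) x = lookup m x"
        using assms by (auto simp: lookup_add lookup_single when_def)
    qed
    show "lookup (single v a + single w (d - a)) v = a" for a
      using assms by (simp add: lookup_add lookup_single when_def)
  qed
  then show ?thesis by (simp add: bij_betw_same_card)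
qed

lemma card_monomials_supported_small:
  assumes "d \<ge> 1" "card F \<le> 2"
  shows "card (monomials_supported d F) = (if card F = 1 then 1 else 0) + (if card F = 2 then d - 1 else 0)"
proof -
  consider "card F = 0" | "card F = 1" | "card F = 2" using assms(2) by linarith
  then show ?thesis
  proof cases
    case 1
    then have "F = {}" by simp
    then show ?thesis using assms(1) by (simp add: card_monomials_supported_empty)
  next
    case 2
    then obtain v where "F = {v}" by (auto simp: card_1_singleton_iff)
    then show ?thesis using assms(1) by (simp add: card_monomials_supported_1)
  next
    case 3
    then obtain v w where "F = {v, w}" "v \<noteq> w" by (auto simp: card_2_iff)
    then show ?thesis by (simp add: card_monomials_supported_2)
  qed
qed

definition faces :: "'n::finite set set \<Rightarrow> nat \<Rightarrow> 'n set set" where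
  "faces \<Delta> c = {F \<in> \<Delta>. card F = c}"

lemma sum_faces: "(\<Sum>F\<in>\<Delta>. if card F = c then x else 0) = card (faces \<Delta> c) * (x :: nat)"
  by (simp add: faces_def sum.If_cases Int_def)

lemma singletons_eq: "{F :: 'n::finite set. card F = 1} = (\<lambda>v. {v}) ` UNIV"
  by (auto simp: card_1_singleton_iff)

lemma card_singletons: "card {F :: 'n::finite set. card F = 1} = CARD('n)"
  unfolding singletons_eq by (rule card_image) (auto simp: inj_on_def)

lemma hilbert_graph:
  fixes \<Delta> :: "'n::finite set set"
  assumes \<Delta>: "graph_complex \<Delta>" and "d \<ge> 1"
  shows "card (std_monomials \<Delta> d) = CARD('n) + card (faces \<Delta> 2) * (d - 1)"
proof -
  have "card (std_monomials \<Delta> d) =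
      (\<Sum>F\<in>\<Delta>. (if card F = 1 then 1 else 0) + (if card F = 2 then d - 1 else 0))"
    unfolding card_std_monomials using assms
    by (intro sum.cong) (simp_all add: card_monomials_supported_small graph_complex_def)
  also have "\<dots> = card (faces \<Delta> 1) + card (faces \<Delta> 2) * (d - 1)"
    by (simp add: sum.distrib sum_faces)
  also have "faces \<Delta> 1 = {F. card F = 1}"
    using \<Delta> by (auto simp: faces_def graph_complex_def card_1_singleton_iff)
  finally show ?thesis by (simp only: card_singletons)
qed

lemma hilbert_graph_0:
  assumes "graph_complex \<Delta>"
  shows "card (std_monomials \<Delta> 0) = 1"
proof -
  have "std_monomials \<Delta> 0 = {0}"
    using graph_complex_empty[OF assms] by (auto simp: std_monomials_def mdeg_eq_0_iff)
  then show ?thesis by simp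
qed

text \<open>The values of the Hilbert function in degrees 1, 2, 3 determine the numbers of vertices, edges
  and triangles.\<close>

lemma graph_complexI_hilbert:
  fixes \<Delta> :: "'n::finite set set"
  assumes dc: "down_closed \<Delta>"
    and H: "\<And>d. d \<ge> 1 \<Longrightarrow> card (std_monomials \<Delta> d) = CARD('n) + k * (d - 1)"
  shows "graph_complex \<Delta>"
proof -
  \<comment> \<open>A support with more than d elements carries no monomial of degree d, so degree 1
    sees only vertices, and degree 2 vertices and edges.\<close>
  have "card (std_monomials \<Delta> 1) = (\<Sum>F\<in>\<Delta>. if card F = 1 then 1 else 0)"
    unfolding card_std_monomials
    by (intro sum.cong refl, case_tac "card x \<le> 2")
       (auto simp: card_monomials_supported_small card_monomials_supported_large)
  then have f1: "card (faces \<Delta> 1) = CARD('n)" using H[of 1] by (simp add: sum_faces)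
  have "card (std_monomials \<Delta> 2) =
      (\<Sum>F\<in>\<Delta>. (if card F = 1 then 1 else 0) + (if card F = 2 then 1 else 0))"
    unfolding card_std_monomials
    by (intro sum.cong refl, case_tac "card x \<le> 2")
       (auto simp: card_monomials_supported_small card_monomials_supported_large)
  then have f2: "card (faces \<Delta> 2) = k" using H[of 2] f1 by (simp add: sum.distrib sum_faces)
  \<comment> \<open>In degree 3 an edge carries two monomials and a triangle at least one, but
    vertices and edges already exhaust the prescribed n + 2 k.\<close>
  have "card (std_monomials \<Delta> 3) \<ge>
      (\<Sum>F\<in>\<Delta>. (if card F = 1 then 1 else 0) + (if card F = 2 then 2 else 0) + (if card F = 3 then 1 else 0))"
    unfolding card_std_monomials
    by (intro sum_mono, case_tac "card i \<le> 2")
       (auto simp: card_monomials_supported_small card_monomials_supported_same[simplified])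
  then have "card (faces \<Delta> 3) = 0" using H[of 3] f1 f2 by (simp add: sum.distrib sum_faces)
  then have f3: "card F \<noteq> 3" if "F \<in> \<Delta>" for F using that by (auto simp: faces_def)
  have faces1: "faces \<Delta> 1 = {F. card F = 1}"
    using f1 card_singletons[where 'n = 'n] by (intro card_subset_eq) (auto simp: faces_def)
  have v: "{v} \<in> \<Delta>" for v
  proof -
    have "{v} \<in> faces \<Delta> 1" unfolding faces1 by simp
    then show ?thesis by (simp add: faces_def)
  qed
  have "card F \<le> 2" if "F \<in> \<Delta>" for F
  proof (rule ccontr)
    assume "\<not> card F \<le> 2"
    then obtain G where "G \<subseteq> F" "card G = 3"
      using obtain_subset_with_card_n[of 3 F] by auto
    then show False using f3 dc that by (auto dest: down_closedD)
  qed
  then show ?thesis using v dc by (simp add: graph_complex_def)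
qed

section \<open>Edge counts of stars and cycles\<close>

lemma card_faces_star:
  assumes "s \<notin> L"
  shows "card (faces (star s L) 2) = card L"
proof -
  have "faces (star s L) 2 = (\<lambda>l. {s, l}) ` L"
    using assms by (auto simp: faces_def star_def card_insert_if)
  then show ?thesis
    using assms by (auto simp: card_image inj_on_def doubleton_eq_iff)
qed

lemma card_faces_cycle:
  fixes e :: "nat \<Rightarrow> 'n::finite"
  assumes e: "cyclic_enum e" and n: "CARD('n) \<ge> 3"
  shows "card (faces (cycle e) 2) = CARD('n)"
proof -
  have neq: "e t \<noteq> e (Suc t)" for t using cyclic_enum_Suc_neq[OF e] n by simp
  \<comment> \<open>Three vertices keep consecutive edges distinct; with two, they would
    coincide.\<close>
  have neq2: "e t \<noteq> e (Suc (Suc t))" for t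
    using cyclic_enum_inj[OF e, of t] n by (auto dest: inj_onD)
  have "faces (cycle e) 2 = (\<lambda>t. {e t, e (Suc t)}) ` {..<CARD('n)}"
  proof (intro equalityI subsetI)
    fix F assume "F \<in> faces (cycle e) 2"
    then have "F \<in> cycle e" "card F = 2" by (auto simp: faces_def)
    then obtain t where t: "F = {e t, e (Suc t)}" by (rule cycle_edge[OF e])
    have t': "e (t mod CARD('n)) = e t" using cyclic_enum_mod[OF e, of t] by simp
    from cyclic_enum_eqD[OF e t'] t t' have "F = {e (t mod CARD('n)), e (Suc (t mod CARD('n)))}"
      by simp
    then show "F \<in> (\<lambda>t. {e t, e (Suc t)}) ` {..<CARD('n)}" by auto
  next
    fix F assume "F \<in> (\<lambda>t. {e t, e (Suc t)}) ` {..<CARD('n)}"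
    then show "F \<in> faces (cycle e) 2" using neq by (auto simp: faces_def cycle_def)
  qed
  moreover have "inj_on (\<lambda>t. {e t, e (Suc t)}) {..<CARD('n)}"
  proof (rule inj_onI)
    fix s t assume st: "s \<in> {..<CARD('n)}" "t \<in> {..<CARD('n)}" "{e s, e (Suc s)} = {e t, e (Suc t)}"
    have "e s = e t"
    proof (rule ccontr)
      assume "e s \<noteq> e t"
      then have "e s = e (Suc t)" "e (Suc s) = e t" using st(3) by (auto simp: doubleton_eq_iff)
      then show False using cyclic_enum_eqD[OF e, of s "Suc t"] neq2[of t] by simp
    qed
    then show "s = t" using cyclic_enum_inj[OF e, of 0] st by (auto dest: inj_onD)
  qed
  ultimately show ?thesis by (simp add: card_image)
qed

section \<open>Betti numbers of graphs\<close>

lemma betti_SR_vanishing: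
  fixes \<Delta> :: "'n::finite set set"
  assumes "graph_complex \<Delta>" and "\<And>u. mdeg u = j \<Longrightarrow> exact_at TYPE('k::field) \<Delta> u i"
  shows "betti (SR \<Delta> :: ('n, 'k) pring set) i j = 0"
proof -
  have dc: "down_closed \<Delta>" and ne: "{} \<in> \<Delta>"
    using assms(1) graph_complex_empty by (auto simp: graph_complex_def)
  obtain \<epsilon> \<phi> where "minimal_graded_free_resolution (SR \<Delta> :: ('n, 'k) pring set)
      (betti (SR \<Delta> :: ('n, 'k) pring set)) \<epsilon> \<phi>"
    using dc ne by (rule minimal_resolution_betti)
  then show ?thesis using dc assms(2) ne by (rule betti_vanishing)
qed

context
  fixes \<Delta> :: "'n::finite set set" and b :: "nat \<Rightarrow> nat \<Rightarrow> nat"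
  assumes \<Delta>: "graph_complex \<Delta>"
    and b: "b = betti (SR \<Delta> :: ('n, 'k::field) pring set)"
begin

lemma betti_graph_high: "j \<ge> i + 3 \<Longrightarrow> b i j = 0"
  unfolding b using \<Delta> by (rule betti_SR_vanishing) (rule exact_at_graph_high[OF \<Delta>], simp)

lemma betti_graph_low: "j \<le> i \<Longrightarrow> 0 < i \<Longrightarrow> b i j = 0"
  unfolding b using \<Delta> by (rule betti_SR_vanishing) (rule exact_at_graph_low[OF \<Delta>], simp_all)

lemma euler_graph:
  "(\<Sum>j\<le>d. (\<Sum>i\<le>j. (- 1) ^ i * int (b i j)) * int (monomials_count TYPE('n) (d - j))) =
    int (card (std_monomials \<Delta> d))"
proof -
  have "down_closed \<Delta>" "{} \<in> \<Delta>"
    using \<Delta> graph_complex_empty by (auto simp: graph_complex_def)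
  then obtain \<epsilon> \<phi> where "minimal_graded_free_resolution (SR \<Delta> :: ('n, 'k) pring set) b \<epsilon> \<phi>"
    unfolding b by (rule minimal_resolution_betti)
  then have "graded_free_resolution (SR \<Delta> :: ('n, 'k) pring set) b \<epsilon> \<phi>"
    by (simp add: minimal_graded_free_resolution_def)
  then show ?thesis
    by (rule euler_characteristic) (simp add: betti_graph_low)
qed

text \<open>In degree a + 2, positions below a vanish by \<open>betti_graph_high\<close> and
  position a + 2 by \<open>betti_graph_low\<close>.\<close>

lemma euler_graph_Suc_Suc:
  "(\<Sum>i\<le>Suc (Suc a). (- 1) ^ i * int (b i (Suc (Suc a)))) =
    (- 1) ^ a * (int (b a (Suc (Suc a))) - int (b (Suc a) (Suc (Suc a))))"
proof -
  have "b i (Suc (Suc a)) = 0" if "i \<notin> {a, Suc a}" "i \<le> Suc (Suc a)" for i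
    using that by (cases "i < a") (auto intro: betti_graph_high betti_graph_low)
  then have "(\<Sum>i\<le>Suc (Suc a). (- 1) ^ i * int (b i (Suc (Suc a)))) =
      (\<Sum>i\<in>{a, Suc a}. (- 1) ^ i * int (b i (Suc (Suc a))))"
    by (intro sum.mono_neutral_right) auto
  then show ?thesis by (simp add: algebra_simps)
qed

end

text \<open>The two surviving Betti numbers have the same difference for both graphs. If one is zero
  for \<open>\<Delta>\<close>, the other equals that difference up to sign, hence is at most the
  matching number for \<open>\<Gamma>\<close>.\<close>

lemma betti_le_betti:
  fixes \<Delta> \<Gamma> :: "'n::finite set set"
  assumes \<Delta>: "graph_complex \<Delta>" and \<Gamma>: "graph_complex \<Gamma>"
    and H: "\<And>d. card (std_monomials \<Delta> d) = card (std_monomials \<Gamma> d)"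
    and pure: "\<And>a. betti (SR \<Delta> :: ('n, 'k::field) pring set) a (a + 2) = 0 \<or>
                     betti (SR \<Delta> :: ('n, 'k) pring set) (a + 1) (a + 2) = 0"
  shows "betti (SR \<Delta> :: ('n, 'k) pring set) i j \<le> betti (SR \<Gamma> :: ('n, 'k) pring set) i j"
proof -
  define x where "x = betti (SR \<Delta> :: ('n, 'k) pring set)"
  define y where "y = betti (SR \<Gamma> :: ('n, 'k) pring set)"
  have euler: "(\<Sum>i\<le>j. (- 1) ^ i * int (x i j)) = (\<Sum>i\<le>j. (- 1) ^ i * int (y i j))" for j
    by (rule convolution_inject[where h = "\<lambda>d. int (monomials_count TYPE('n) d)"])
       (simp_all add: monomials_count_0 euler_graph[OF \<Delta> x_def] euler_graph[OF \<Gamma> y_def] H)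
  have "x i j \<le> y i j"
  \<comment> \<open>Degrees 0 and 1 lie outside the pattern a + 2: there all positions i > 0 vanish
    and the Euler sum determines position 0.\<close>
  proof (cases j)
    case 0
    then show ?thesis using euler[of 0] betti_graph_low[OF \<Delta> x_def, of j i] by (cases "i = 0") auto
  next
    case (Suc j')
    show ?thesis
    proof (cases j')
      case 0
      with Suc have j: "j = Suc 0" by simp
      have "x (Suc 0) (Suc 0) = 0" "y (Suc 0) (Suc 0) = 0"
        by (rule betti_graph_low[OF \<Delta> x_def] betti_graph_low[OF \<Gamma> y_def]; simp)+
      then show ?thesis using euler[of "Suc 0"] betti_graph_low[OF \<Delta> x_def, of j i] j
        by (cases "i = 0") auto
    next
      case (Suc a)
      with \<open>j = Suc j'\<close> have j: "j = Suc (Suc a)" by simp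
      have "int (x a j) - int (x (Suc a) j) = int (y a j) - int (y (Suc a) j)"
        using euler[of j] unfolding j euler_graph_Suc_Suc[OF \<Delta> x_def] euler_graph_Suc_Suc[OF \<Gamma> y_def]
        by simp
      moreover have "x a j = 0 \<or> x (Suc a) j = 0" using pure[of a] by (simp add: x_def j)
      ultimately have "x a j \<le> y a j" "x (Suc a) j \<le> y (Suc a) j" by linarith+
      moreover have "x i j = 0" if "i \<noteq> a" "i \<noteq> Suc a"
        using that j by (cases "i < a")
          (auto intro: betti_graph_high[OF \<Delta> x_def] betti_graph_low[OF \<Delta> x_def])
      ultimately show ?thesis by (cases "i = a \<or> i = Suc a") auto
    qed
  qed
  then show ?thesis by (simp add: x_def y_def)
qed

text \<open>The case n = 1 is separate because the list then has a single entry and does not contain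
  k.\<close>

lemma hilbert_of_f_vector_graph:
  assumes "f = map (\<lambda>i. if i = 0 then n else if i = 1 then k else 0) [0..<n]" "n \<ge> 1" "d \<ge> 1"
  shows "hilbert_of_f_vector f d = n + (if n = 1 then 0 else k) * (d - 1)"
proof -
  have "hilbert_of_f_vector f d =
      (\<Sum>i<n. (if i = 0 then n else if i = 1 then k else 0) * ((d - 1) choose i))"
    unfolding hilbert_of_f_vector_def using assms by (auto intro!: sum.cong)
  also have "\<dots> = n + (if n = 1 then 0 else k) * (d - 1)"
  proof (cases "n = 1")
    case False
    then have "(\<Sum>i<n. (if i = 0 then n else if i = 1 then k else 0) * ((d - 1) choose i)) =
        (\<Sum>i\<in>{0, 1}. (if i = 0 then n else if i = 1 then k else 0) * ((d - 1) choose i))"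
      using assms(2) by (intro sum.mono_neutral_right) auto
    with False show ?thesis by simp
  qed simp
  finally show ?thesis .
qed

lemma optimal_graph_exists:
  assumes "k < CARD('n::finite) \<or> k = CARD('n) \<and> CARD('n) \<ge> 3"
  obtains \<Delta> :: "'n::finite set set" where "graph_complex \<Delta>" "card (faces \<Delta> 2) = k"
    "\<And>a. betti (SR \<Delta> :: ('n, 'k::field) pring set) a (a + 2) = 0 \<or>
         betti (SR \<Delta> :: ('n, 'k) pring set) (a + 1) (a + 2) = 0"
proof (cases "k < CARD('n)")
  case True
  fix s :: 'n
  have "k \<le> card (UNIV - {s})" using True by simp
  then obtain L where L: "L \<subseteq> UNIV - {s}" "card L = k"
    by (rule obtain_subset_with_card_n)
  have "betti (SR (star s L) :: ('n, 'k) pring set) a (a + 2) = 0" for a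
    by (rule betti_SR_vanishing[OF graph_complex_star], rule exact_at_star)
  moreover have "card (faces (star s L) 2) = k"
    using card_faces_star[of s L] L by blast
  ultimately show ?thesis
    using that[of "star s L"] graph_complex_star by blast
next
  case False
  then have k: "k = CARD('n)" "CARD('n) \<ge> 3" using assms by auto
  obtain e :: "nat \<Rightarrow> 'n" where e: "cyclic_enum e" using cyclic_enum_exists by blast
  have "betti (SR (cycle e) :: ('n, 'k) pring set) a (a + 2) = 0 \<or>
      betti (SR (cycle e) :: ('n, 'k) pring set) (a + 1) (a + 2) = 0" for a
  \<comment> \<open>Only in degree n is the restriction the whole cycle; there connectedness gives
    the second alternative, and proper restrictions give the first in all other degrees.\<close>
  proof (cases "a + 2 = CARD('n)")
    case True
    then have "betti (SR (cycle e) :: ('n, 'k) pring set) (a + 1) (a + 2) = 0"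
      using k by (intro betti_SR_vanishing[OF graph_complex_cycle] exact_at_cycle_top[OF e]) simp_all
    then show ?thesis ..
  next
    case False
    then have "betti (SR (cycle e) :: ('n, 'k) pring set) a (a + 2) = 0"
      by (intro betti_SR_vanishing[OF graph_complex_cycle] exact_at_cycle_proper[OF e]) simp_all
    then show ?thesis ..
  qed
  moreover have "card (faces (cycle e) 2) = k"
    using card_faces_cycle[OF e k(2)] k(1) by simp
  ultimately show ?thesis
    using that[OF graph_complex_cycle] by blast
qed

theorem theorem4p4:
  fixes k :: nat and f :: "nat list"
  assumes "k \<le> CARD('n::finite)"
    and "f = map (\<lambda>i. if i = 0 then CARD('n) else if i = 1 then k else 0) [0..<CARD('n)]"
    and "\<exists>\<Delta> :: 'n set set. simplicial_complex \<Delta> \<and> f_vector \<Delta> = f"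
  shows "\<exists>I :: ('n, 'k::field) pring set.
           squarefree_monomial_ideal I \<and>
           (\<forall>d. hilbert_function I d = hilbert_of_f_vector f d) \<and>
           (\<forall>J :: ('n, 'k) pring set.
              squarefree_monomial_ideal J \<and>
              (\<forall>d. hilbert_function J d = hilbert_of_f_vector f d) \<longrightarrow>
              (\<forall>i j. betti I i j \<le> betti J i j))"
proof -
  let ?n = "CARD('n)"
  have n: "?n \<ge> 1" by (simp add: Suc_le_eq)
  \<comment> \<open>The true number of edges: a single vertex has none.\<close>
  define k' where "k' = (if ?n = 1 then 0 else k)"
  have H: "hilbert_of_f_vector f d = ?n + k' * (d - 1)" if "d \<ge> 1" for d
    unfolding k'_def by (rule hilbert_of_f_vector_graph[OF assms(2) n that])
  have H0: "hilbert_of_f_vector f 0 = 1" by (simp add: hilbert_of_f_vector_def)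
  \<comment> \<open>Two vertices carry at most one edge, so the f-vector assumption excludes k = n =
    2, the one case with neither a star nor a cycle.\<close>
  have "k \<noteq> 2" if n2: "?n = 2"
  proof -
    obtain \<Delta> :: "'n set set" where "f_vector \<Delta> = f" using assms(3) by blast
    then have "f_vector \<Delta> ! 1 = f ! 1" by simp
    then have "card {F \<in> \<Delta>. card F = 2} = k"
      by (simp add: f_vector_def assms(2) n2 numeral_2_eq_2 del: upt_Suc)
    moreover have "{F \<in> \<Delta>. card F = 2} \<subseteq> {UNIV}"
    proof
      fix F assume "F \<in> {F \<in> \<Delta>. card F = 2}"
      then have "F = UNIV" using n2 by (intro card_subset_eq) auto
      then show "F \<in> {UNIV}" by simp
    qed
    then have "card {F \<in> \<Delta>. card F = 2} \<le> 1"
      using card_mono[of "{UNIV :: 'n set}"] by fastforce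
    ultimately show ?thesis by simp
  qed
  moreover have "?n = 1 \<or> ?n = 2 \<or> ?n \<ge> 3" using n by linarith
  ultimately have "k' < ?n \<or> k' = ?n \<and> ?n \<ge> 3"
    using assms(1) by (auto simp: k'_def)
  then obtain \<Delta> :: "'n set set" where \<Delta>: "graph_complex \<Delta>" "card (faces \<Delta> 2) = k'"
    and pure: "\<And>a. betti (SR \<Delta> :: ('n, 'k) pring set) a (a + 2) = 0 \<or>
         betti (SR \<Delta> :: ('n, 'k) pring set) (a + 1) (a + 2) = 0"
    using optimal_graph_exists[where 'n = 'n and 'k = 'k] by metis
  have H\<Delta>: "card (std_monomials \<Delta> d) = hilbert_of_f_vector f d" for d
    using hilbert_graph[OF \<Delta>(1), of d] hilbert_graph_0[OF \<Delta>(1)] H[of d] H0 \<Delta>(2) by (cases "d = 0") auto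
  show ?thesis
  proof (intro exI[of _ "SR \<Delta>"] conjI allI impI)
    show "squarefree_monomial_ideal (SR \<Delta> :: ('n, 'k) pring set)"
      using \<Delta>(1) by (intro squarefree_monomial_ideal_SR) (simp add: graph_complex_def)
    show "hilbert_function (SR \<Delta> :: ('n, 'k) pring set) d = hilbert_of_f_vector f d" for d
      by (simp add: hilbert_function_SR H\<Delta>)
  next
    fix J :: "('n, 'k) pring set" and i j
    assume J: "squarefree_monomial_ideal J \<and> (\<forall>d. hilbert_function J d = hilbert_of_f_vector f d)"
    then obtain \<Gamma> where \<Gamma>: "down_closed \<Gamma>" "J = SR \<Gamma>"
      using squarefree_monomial_ideal_imp_SR by blast
    have H\<Gamma>: "card (std_monomials \<Gamma> d) = hilbert_of_f_vector f d" for d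
      using J by (simp add: \<Gamma>(2) hilbert_function_SR)
    \<comment> \<open>Every competitor also comes from a graph on all n vertices, by the Hilbert
      function.\<close>
    then have "graph_complex \<Gamma>"
      using H by (intro graph_complexI_hilbert[OF \<Gamma>(1), of k']) simp
    then show "betti (SR \<Delta> :: ('n, 'k) pring set) i j \<le> betti J i j"
      unfolding \<Gamma>(2) using pure by (intro betti_le_betti[OF \<Delta>(1)]) (simp_all add: H\<Delta> H\<Gamma>)
  qed
qed

end
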